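(* Let $k>0$ and let $V\subset\mathbb R^3$ be a bounded open set with smooth boundary $\partial V$ and connected exterior $\mathbb R^3\smallsetminus(V\cup\partial V)$. Then $$\Vert\hat\gamma\Vert_2\le\min\left\{\frac13\left(k^3\iiint_Vd^3\boldsymbol r\right)^{2/3},\ \frac34(kR_V)^2\right\},$$ where $R_V=\min_{\boldsymbol r\in\mathbb R^3}\max_{\boldsymbol r'\in V\cup\partial V}|\boldsymbol r'-\boldsymbol r|$ is the minimal radius of all circumscribed spheres of $V$.
   Context: The operator $\hat\gamma:L^2(V;\mathbb C^3)\to L^2(V;\mathbb C^3)$ is $$(\hat\gamma\boldsymbol E)(\boldsymbol r)=\nabla\times\nabla\times\iiint_V\frac{\boldsymbol E(\boldsymbol r')(e^{-ik|\boldsymbol r-\boldsymbol r'|}-1)}{4\pi|\boldsymbol r-\boldsymbol r'|}d^3\boldsymbol r'$$ (distributional derivatives). $\Phi(V;\mathbb C^3)$ denotes the $L^2$-closure of the set of smooth, divergence-free, square-integrable vector fields $V\to\mathbb C^3$; it is mapped into itself by $\hat\gamma$. The Hilbert–Schmidt norm is $\Vert\hat A\Vert_2=\sqrt{\sum_{s}\Vert\hat A\boldsymbol e_s\Vert^2_{L^2(V;\mathbb C^3)}}$, where $\{\boldsymbol e_s\}$ is any complete orthonormal basis of the Hilbert space $\Phi(V;\mathbb C^3)$. *)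

theory Defs
  imports "HOL-Analysis.Analysis"
begin

type_synonym field3 = "real^3 \<Rightarrow> complex^3"

text \<open>Smooth functions. The predicates below are meant for open \<open>S\<close> only.\<close>

primrec C_diff_on :: "nat \<Rightarrow> ('a::real_normed_vector \<Rightarrow> 'b::real_normed_vector) \<Rightarrow> 'a set \<Rightarrow> bool" where
  "C_diff_on 0 f S \<longleftrightarrow> continuous_on S f"
| "C_diff_on (Suc n) f S \<longleftrightarrow> (\<forall>x\<in>S. f differentiable (at x)) \<and>
     (\<forall>v. C_diff_on n (\<lambda>x. frechet_derivative f (at x) v) S)"

definition smooth_on :: "('a::real_normed_vector \<Rightarrow> 'b::real_normed_vector) \<Rightarrow> 'a set \<Rightarrow> bool" where
  "smooth_on f S \<longleftrightarrow> (\<forall>n. C_diff_on n f S)"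

text \<open>Near each boundary point, \<open>V\<close> is the sublevel set of a smooth local defining function with
  non-vanishing gradient; in particular \<open>V\<close> lies locally on one side of its boundary.\<close>

definition smooth_boundary :: "(real^3) set \<Rightarrow> bool" where
  "smooth_boundary V \<longleftrightarrow> (\<forall>p\<in>frontier V. \<exists>U (\<rho> :: real^3 \<Rightarrow> real).
     open U \<and> p \<in> U \<and> smooth_on \<rho> U \<and> frechet_derivative \<rho> (at p) \<noteq> (\<lambda>_. 0) \<and>
     V \<inter> U = {x\<in>U. \<rho> x < 0} \<and> frontier V \<inter> U = {x\<in>U. \<rho> x = 0})"

definition partial_deriv :: "3 \<Rightarrow> (real^3 \<Rightarrow> complex) \<Rightarrow> real^3 \<Rightarrow> complex" where
  "partial_deriv i f x = frechet_derivative f (at x) (axis i 1)"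

definition divergence :: "field3 \<Rightarrow> real^3 \<Rightarrow> complex" where
  "divergence F x = (\<Sum>i\<in>UNIV. partial_deriv i (\<lambda>y. F y $ i) x)"

definition curl :: "field3 \<Rightarrow> field3" where
  "curl F x = vector
     [partial_deriv 2 (\<lambda>y. F y $ 3) x - partial_deriv 3 (\<lambda>y. F y $ 2) x,
      partial_deriv 3 (\<lambda>y. F y $ 1) x - partial_deriv 1 (\<lambda>y. F y $ 3) x,
      partial_deriv 1 (\<lambda>y. F y $ 2) x - partial_deriv 2 (\<lambda>y. F y $ 1) x]"

text \<open>Elements of $L^2(V;\mathbb{C}^3)$ are handled through representatives: functions on
  the whole space whose values outside \<open>V\<close> are irrelevant, and that are identified when they agree
  almost everywhere on \<open>V\<close>.\<close>

definition L2_fields :: "(real^3) set \<Rightarrow> field3 set" where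
  "L2_fields V = {F. F \<in> borel_measurable (lebesgue_on V) \<and>
     integrable (lebesgue_on V) (\<lambda>x. (norm (F x))\<^sup>2)}"

definition L2_inner :: "(real^3) set \<Rightarrow> field3 \<Rightarrow> field3 \<Rightarrow> complex" where
  "L2_inner V F G = (LINT x|lebesgue_on V. (\<Sum>i\<in>UNIV. F x $ i * cnj (G x $ i)))"

definition L2_norm :: "(real^3) set \<Rightarrow> field3 \<Rightarrow> real" where
  "L2_norm V F = sqrt (LINT x|lebesgue_on V. (norm (F x))\<^sup>2)"

definition div_free_fields :: "(real^3) set \<Rightarrow> field3 set" where
  "div_free_fields V =
     {F \<in> L2_fields V. smooth_on F V \<and> (\<forall>x\<in>V. divergence F x = 0)}"

definition Phi :: "(real^3) set \<Rightarrow> field3 set" where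
  "Phi V = {F \<in> L2_fields V.
     \<forall>\<epsilon>>0. \<exists>G\<in>div_free_fields V. L2_norm V (\<lambda>x. F x - G x) < \<epsilon>}"

text \<open>A distribution on \<open>V\<close> with values in $\mathbb{C}^3$ is represented by its action on test
  fields. The curl of a distribution carries no sign, since the sign from the integration by parts
  cancels against the antisymmetry of the cross product.\<close>

definition test_fields :: "(real^3) set \<Rightarrow> field3 set" where
  "test_fields V = {\<phi>. smooth_on \<phi> UNIV \<and>
     compact (closure {x. \<phi> x \<noteq> 0}) \<and> closure {x. \<phi> x \<noteq> 0} \<subseteq> V}"

definition regular_dist :: "(real^3) set \<Rightarrow> field3 \<Rightarrow> (field3 \<Rightarrow> complex)" where
  "regular_dist V u \<phi> = (LINT x|lebesgue_on V. (\<Sum>i\<in>UNIV. u x $ i * \<phi> x $ i))"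

definition dist_curl :: "(field3 \<Rightarrow> complex) \<Rightarrow> (field3 \<Rightarrow> complex)" where
  "dist_curl T \<phi> = T (curl \<phi>)"

definition gamma_potential :: "real \<Rightarrow> (real^3) set \<Rightarrow> field3 \<Rightarrow> field3" where
  "gamma_potential k V E r = (LINT r'|lebesgue_on V.
     ((exp (- \<i> * of_real (k * norm (r - r'))) - 1) / of_real (4 * pi * norm (r - r'))) *s E r')"

text \<open>\<open>gamma_hat k V E\<close> is the (almost everywhere unique) square-integrable field on \<open>V\<close>
  representing the distribution $\nabla\times\nabla\times u$, with \<open>u\<close> the potential above. Nothing
  is known about the value unless such a field is shown to exist.\<close>

definition gamma_hat :: "real \<Rightarrow> (real^3) set \<Rightarrow> field3 \<Rightarrow> field3" where
  "gamma_hat k V E = (SOME G. G \<in> L2_fields V \<and>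
     (\<forall>\<phi>\<in>test_fields V. regular_dist V G \<phi> =
        dist_curl (dist_curl (regular_dist V (gamma_potential k V E))) \<phi>))"

text \<open>A basis is a set of representatives; orthonormality forces distinct members of the set
  to be distinct as elements of $L^2$.\<close>

definition complete_orthonormal_basis :: "(real^3) set \<Rightarrow> field3 set \<Rightarrow> field3 set \<Rightarrow> bool" where
  "complete_orthonormal_basis V H B \<longleftrightarrow> B \<subseteq> H \<and>
     (\<forall>e\<in>B. \<forall>f\<in>B. L2_inner V e f = (if e = f then 1 else 0)) \<and>
     (\<forall>F\<in>H. (\<forall>e\<in>B. L2_inner V F e = 0) \<longrightarrow> (AE x in lebesgue_on V. F x = 0))"

definition HS_norm :: "(real^3) set \<Rightarrow> field3 set \<Rightarrow> (field3 \<Rightarrow> field3) \<Rightarrow> ereal" where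
  "HS_norm V B A =
     (if (\<lambda>e. (L2_norm V (A e))\<^sup>2) summable_on B
      then ereal (sqrt (\<Sum>\<^sub>\<infinity>e\<in>B. (L2_norm V (A e))\<^sup>2)) else \<infinity>)"

definition circumradius :: "(real^3) set \<Rightarrow> real" where
  "circumradius V = (INF r. SUP r'\<in>V \<union> frontier V. norm (r' - r))"

end

theory Submission
  imports Defs
begin

text \<open>Differentiating the weakly singular potential twice shows that \<open>\<gamma>\<close> is an integral operator with a
  convolution kernel \<open>K(r - r')\<close>, the matrix \<open>\<nabla>\<nabla> - \<Delta>\<close> of \<open>(e\<^bsup>-ikr\<^esup> - 1) / (4 \<pi> r)\<close>. Its singularity is
  only of order \<open>1 / r\<close>, so integration by parts is justified by replacing \<open>|r - r'|\<close> with
  \<open>sqrt (|r - r'|\<^sup>2 + \<epsilon>\<^sup>2)\<close> and letting \<open>\<epsilon>\<close> tend to \<open>0\<close>. By Bessel's inequality, applied to each row of \<open>K\<close>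
  at each point, the squared Hilbert--Schmidt norm over any orthonormal system is at most the integral
  of the squared Frobenius norm of \<open>K\<close> over \<open>V \<times> V\<close>. An elementary trigonometric inequality gives
  \<open>\<parallel>K(x)\<parallel>\<^sup>2 \<le> 9 k\<^sup>4 / (64 \<pi>\<^sup>2 |x|\<^sup>2)\<close>, which leaves the energy \<open>\<integral>\<integral> |x - y|\<^sup>-\<^sup>2\<close> over \<open>V \<times> V\<close>. By the bathtub
  principle it is at most \<open>4 \<pi> R |V|\<close>, with \<open>R\<close> the radius of the ball of volume \<open>|V|\<close>; by inclusion it
  is at most its value \<open>4 \<pi>\<^sup>2 \<rho>\<^sup>4\<close> for any ball of radius \<open>\<rho>\<close> containing \<open>V\<close>.\<close>

subsection \<open>A trigonometric inequality\<close>

text \<open>Subtracting 1 from the phase removes the Coulomb singularity: the profile is bounded,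
  its second derivatives are locally integrable, and no delta term appears. The constant 9/(64
  \<pi>^2) is the bound 9/4 of the trigonometric inequality divided by (4 \<pi>)^2; times the ball
  energy 4 \<pi>^2 \<rho>^4 it gives the square of 3/4 (k \<rho>)^2. The bathtub bound could not
  give this constant: for a ball it uses the potential at the centre for every point and loses a
  factor 4/3. Hence the exact lens volumes. A second obstacle is that \<open>gamma_hat\<close> is a
  choice: its values are known only once the integral operator is shown to produce a
  square-integrable field with the right distributional double curl, and any two such fields are
  shown to agree almost everywhere. The uniqueness rests on explicit smooth bumps that approximate
  indicators of boxes.\<close>

lemma nonneg_by_deriv:
  fixes f f' :: "real \<Rightarrow> real"
  assumes "\<And>t. (f has_real_derivative f' t) (at t)" "\<And>t. t \<ge> 0 \<Longrightarrow> f' t \<ge> 0" "f 0 = 0" "x \<ge> 0"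
  shows "f x \<ge> 0"
  using DERIV_nonneg_imp_nondecreasing[of 0 x f] assms by metis

text \<open>Each bound is the antiderivative of the preceding one, starting from sin t \<le> t; all
  differences vanish at 0, so the sign propagates along the chain.\<close>

lemma sin_taylor_bounds:
  fixes x :: real
  assumes "x \<ge> 0"
  shows "sin x \<le> x - x^3/6 + x^5/120" "sin x \<ge> x - x^3/6 + x^5/120 - x^7/5040"
proof -
  have s1: "t - sin t \<ge> 0" if "t \<ge> 0" for t :: real
    using sin_x_le_x[OF that] by simp
  have c2: "cos t - (1 - t^2/2) \<ge> 0" if "t \<ge> 0" for t :: real
    by (rule nonneg_by_deriv[where f' = "\<lambda>t. t - sin t"])
       (use s1 that in \<open>auto intro!: derivative_eq_intros simp: field_simps power2_eq_square\<close>)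
  have s3: "sin t - (t - t^3/6) \<ge> 0" if "t \<ge> 0" for t :: real
    by (rule nonneg_by_deriv[where f' = "\<lambda>t. cos t - (1 - t^2/2)"])
       (use c2 that in \<open>auto intro!: derivative_eq_intros simp: field_simps power2_eq_square\<close>)
  have c4: "(1 - t^2/2 + t^4/24) - cos t \<ge> 0" if "t \<ge> 0" for t :: real
    by (rule nonneg_by_deriv[where f' = "\<lambda>t. sin t - (t - t^3/6)"])
       (use s3 that in \<open>auto intro!: derivative_eq_intros simp: field_simps power2_eq_square\<close>)
  have s5: "(t - t^3/6 + t^5/120) - sin t \<ge> 0" if "t \<ge> 0" for t :: real
    by (rule nonneg_by_deriv[where f' = "\<lambda>t. (1 - t^2/2 + t^4/24) - cos t"])
       (use c4 that in \<open>auto intro!: derivative_eq_intros simp: field_simps power2_eq_square\<close>)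
  have c6: "cos t - (1 - t^2/2 + t^4/24 - t^6/720) \<ge> 0" if "t \<ge> 0" for t :: real
    by (rule nonneg_by_deriv[where f' = "\<lambda>t. (t - t^3/6 + t^5/120) - sin t"])
       (use s5 that in \<open>auto intro!: derivative_eq_intros simp: field_simps power2_eq_square\<close>)
  have s7: "sin t - (t - t^3/6 + t^5/120 - t^7/5040) \<ge> 0" if "t \<ge> 0" for t :: real
    by (rule nonneg_by_deriv[where f' = "\<lambda>t. cos t - (1 - t^2/2 + t^4/24 - t^6/720)"])
       (use c6 that in \<open>auto intro!: derivative_eq_intros simp: field_simps power2_eq_square\<close>)
  show "sin x \<le> x - x^3/6 + x^5/120" using s5[OF assms] by simp
  show "sin x \<ge> x - x^3/6 + x^5/120 - x^7/5040" using s7[OF assms] by simp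
qed

text \<open>The derivative of sin x - x cos x is x sin x, so the upper Taylor bound for the sine,
  multiplied by x, can be integrated.\<close>

lemma sin_minus_x_cos_bounds:
  fixes x :: real
  assumes "x \<ge> 0"
  shows "sin x - x * cos x \<le> x^3/3 - x^5/30 + x^7/840"
proof -
  have "(x^3/3 - x^5/30 + x^7/840) - (sin x - x * cos x) \<ge> 0"
  proof (rule nonneg_by_deriv[where x = x and f = "\<lambda>x. (x^3/3 - x^5/30 + x^7/840) - (sin x - x * cos x)"
        and f' = "\<lambda>t. t * ((t - t^3/6 + t^5/120) - sin t)"])
    show "((\<lambda>x. (x^3/3 - x^5/30 + x^7/840) - (sin x - x * cos x)) has_real_derivative
        t * ((t - t^3/6 + t^5/120) - sin t)) (at t)" for t :: real
      by (auto intro!: derivative_eq_intros simp: field_simps power2_eq_square eval_nat_numeral)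
  qed (use sin_taylor_bounds(1) assms in auto)
  then show ?thesis by simp
qed

text \<open>The proof writes the difference of both sides in the Bernstein basis of \<open>[0, 67/10]\<close>, where all
  coefficients are positive.\<close>

lemma taylor_polynomial_inequality:
  fixes x :: real
  assumes "0 \<le> x" "x \<le> 67/10"
  shows "6 * x * (1/3 - x/30 + x^2/840)^2 \<le> 1 + 2 * (1 - x/6 + x^2/120 - x^3/5040)^2"
proof -
  have "1 + 2 * (1 - x/6 + x^2/120 - x^3/5040)^2 - 6 * x * (1/3 - x/30 + x^2/840)^2 =
    3000000/90458382169 * (67/10 - x)^6 + 27200000/271375146507 * x * (67/10 - x)^5
    + 92780000/814125439521 * x^2 * (67/10 - x)^4 + 46997920/814125439521 * x^3 * (67/10 - x)^3
    + 1489788353/136773073839528 * x^4 * (67/10 - x)^2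
    + 2712501/88649214525620 * x^5 * (67/10 - x) + 55238933929/1148893820252035200 * x^6"
    by (simp add: power2_eq_square eval_nat_numeral field_simps)
  also have "\<dots> \<ge> 0"
    using assms by (intro add_nonneg_nonneg mult_nonneg_nonneg zero_le_power) auto
  finally show ?thesis by simp
qed

lemma sin_cos_inequality:
  fixes t :: real
  assumes "t \<ge> 0"
  shows "6 * (sin t - t * cos t)^2 \<le> t^4 + 2 * t^2 * (sin t)^2"
\<comment> \<open>The quadratic x^2 - 4 x - 18 of the second case has the positive root 2 + sqrt 22,
  about 6.69, so 67/10 is barely large enough. In the first case t < 3 < \<pi>, and Taylor
  polynomials suffice.\<close>
proof (cases "t^2 \<le> 67/10")
  case True
  define u where "u = 1/3 - t^2/30 + t^4/840"
  define p where "p = 1 - t^2/6 + t^4/120 - t^6/5040"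
  have tle: "t < pi"
  proof -
    have "t^2 < 3^2" using True by simp
    hence "t < 3" using power_less_imp_less_base by (metis zero_le_numeral)
    thus ?thesis using pi_gt3 by linarith
  qed
  \<comment> \<open>Nonnegativity is needed to square the Taylor upper bound. The derivative x sin x
    is nonnegative because x stays below \<pi>.\<close>
  have pos: "0 \<le> sin t - t * cos t"
  proof -
    have "sin 0 - 0 * cos 0 \<le> sin t - t * cos t"
    proof (rule DERIV_nonneg_imp_nondecreasing[of 0 t "\<lambda>t. sin t - t * cos t", OF assms])
      fix x assume "0 \<le> x" "x \<le> t"
      then have "0 \<le> x * sin x" using tle by (intro mult_nonneg_nonneg sin_ge_zero) auto
      moreover have "((\<lambda>t. sin t - t * cos t) has_real_derivative x * sin x) (at x)"
        by (auto intro!: derivative_eq_intros)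
      ultimately show "\<exists>y. ((\<lambda>t. sin t - t * cos t) has_real_derivative y) (at x) \<and> 0 \<le> y" by blast
    qed
    thus ?thesis by simp
  qed
  have "sin t - t * cos t \<le> t^3 * u"
    using sin_minus_x_cos_bounds[OF assms] by (simp add: u_def algebra_simps eval_nat_numeral)
  with pos have 1: "(sin t - t * cos t)^2 \<le> (t^3 * u)^2" by (intro power_mono)
  define x where "x = t^2"
  have x: "0 \<le> x" "x \<le> 67/10" using True by (auto simp: x_def)
  have pp: "p = 1 - x/6 + x^2/120 - x^3/5040" "u = 1/3 - x/30 + x^2/840"
    by (auto simp: p_def u_def x_def simp flip: power_mult)
  \<comment> \<open>Needed to square the lower bound t p \<le> sin t. Completing the square leaves
    x^2 (7 - x) / 5040, nonnegative on this range.\<close>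
  have "0 \<le> p"
  proof -
    have "p = (1 - x/12)^2 + x^2 * (7 - x) / 5040"
      by (simp add: pp field_simps power2_eq_square power3_eq_cube)
    thus ?thesis using x by simp
  qed
  hence "0 \<le> t * p" using assms by simp
  moreover have "t * p \<le> sin t"
    using sin_taylor_bounds(2)[OF assms] by (simp add: p_def algebra_simps eval_nat_numeral)
  ultimately have 2: "(t * p)^2 \<le> (sin t)^2" by (intro power_mono)
  have "6 * (t^3 * u)^2 = x^2 * (6 * x * u^2)"
    by (simp add: x_def power_mult_distrib flip: power_mult)
  also have "\<dots> \<le> x^2 * (1 + 2 * p^2)"
    unfolding pp using taylor_polynomial_inequality[OF x] by (intro mult_left_mono) auto
  also have "\<dots> = t^4 + 2 * t^2 * (t * p)^2"
    by (simp add: x_def algebra_simps power_mult_distrib flip: power_mult)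
  also have "\<dots> \<le> t^4 + 2 * t^2 * (sin t)^2" using 2 by (intro add_left_mono mult_left_mono) auto
  finally show ?thesis using 1 by linarith
next
  case False
  define x where "x = t^2"
  define s c where "s = sin t" and "c = cos t"
  have x: "x > 67/10" using False by (simp add: x_def)
  have sc: "s^2 + c^2 = 1" by (simp add: s_def c_def)
  have A: "x^2 - 6 * x > 0" using x by (simp add: power2_eq_square)
  have B: "x^2 - 4 * x - 18 \<ge> 0"
  proof -
    have "(x - 67/10) * (x + 27/10) \<ge> 0" using x by simp
    thus ?thesis by (simp add: algebra_simps power2_eq_square)
  qed
  text \<open>The difference of both sides, homogenised with \<open>s^2 + c^2 = 1\<close>, is a quadratic form in \<open>(c, s)\<close>,
    which is positive semidefinite when \<open>x^2 - 4 x - 18 \<ge> 0\<close>.\<close>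
  have "(x^2 - 6 * x) * (x^2 * (s^2 + c^2) + 2 * x * s^2 - 6 * (s - t * c)^2)
      = ((x^2 - 6 * x) * c + 6 * t * s)^2 + x^2 * (x^2 - 4 * x - 18) * s^2"
    by (simp add: x_def algebra_simps power2_eq_square)
  also have "\<dots> \<ge> 0" using B by simp
  finally have "x^2 * (s^2 + c^2) + 2 * x * s^2 - 6 * (s - t * c)^2 \<ge> 0"
    using A by (simp add: zero_le_mult_iff)
  thus ?thesis unfolding sc by (simp add: s_def c_def x_def flip: power_mult)
qed

text \<open>The left side is \<open>2 r^4 - 4 r^2 (1 - cos r) + 6 |N|^2\<close>; half-angle formulas reduce it to the previous inequality at \<open>t = r / 2\<close>.\<close>

lemma kernel_inequality:
  fixes r :: real
  assumes "r \<ge> 0"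
  defines "e \<equiv> exp (- \<i> * of_real r)"
  defines "N \<equiv> 1 - (1 + \<i> * of_real r) * e"
  shows "4 * (cmod N)^2 + 2 * (cmod (N + of_real (r^2) * e))^2 \<le> 9/4 * r^4"
proof -
  define t where "t = r/2"
  have r: "r = 2 * t" by (simp add: t_def)
  have e: "e = Complex (cos r) (- sin r)"
    by (simp add: e_def complex_eq_iff Re_exp Im_exp)
  have sc: "(sin r)^2 + (cos r)^2 = 1" by simp
  have N: "N = Complex (1 - cos r - r * sin r) (sin r - r * cos r)"
    by (simp add: N_def e complex_eq_iff algebra_simps)
  have M: "N + of_real (r^2) * e =
      Complex (1 - cos r - r * sin r + r^2 * cos r) (sin r - r * cos r - r^2 * sin r)"
    by (simp add: N e complex_eq_iff algebra_simps)
  have "4 * (cmod N)^2 + 2 * (cmod (N + of_real (r^2) * e))^2 =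
      4 * ((1 - cos r - r * sin r)^2 + (sin r - r * cos r)^2)
      + 2 * ((1 - cos r - r * sin r + r^2 * cos r)^2 + (sin r - r * cos r - r^2 * sin r)^2)"
    unfolding M unfolding N by (simp add: cmod_power2)
  also have "\<dots> = 6 + 6 * (1 + r^2) * ((sin r)^2 + (cos r)^2) - 12 * cos r - 12 * r * sin r
     + 2 * r^4 * ((sin r)^2 + (cos r)^2) + 4 * r^2 * cos r - 4 * r^2 * ((sin r)^2 + (cos r)^2)"
    by (simp add: algebra_simps power2_eq_square eval_nat_numeral
        del: sin_cos_squared_add sin_cos_squared_add2 sin_cos_squared_add3)
  also have "\<dots> = 12 + 2 * r^2 - 12 * cos r - 12 * r * sin r + 2 * r^4 + 4 * r^2 * cos r"
    unfolding sc by (simp add: algebra_simps)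
  also have "\<dots> = 24 * (sin t)^2 + 24 * t^2 - 48 * t * sin t * cos t - 32 * t^2 * (sin t)^2 + 32 * t^4"
    unfolding r cos_double_sin sin_double by (simp add: algebra_simps power2_eq_square eval_nat_numeral)
  also have "24 * (sin t)^2 + 24 * t^2 - 48 * t * sin t * cos t =
      24 * (sin t - t * cos t)^2 + 24 * t^2 * (1 - (cos t)^2)"
    by (simp add: algebra_simps power2_eq_square)
  also have "1 - (cos t)^2 = (sin t)^2" by (simp add: sin_squared_eq)
  finally have "4 * (cmod N)^2 + 2 * (cmod (N + of_real (r^2) * e))^2 =
     4 * (6 * (sin t - t * cos t)^2 - 2 * t^2 * (sin t)^2) + 32 * t^4" by (simp add: algebra_simps)
  also have "\<dots> \<le> 36 * t^4" using sin_cos_inequality[of t] assms by (simp add: t_def)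
  finally show ?thesis by (simp add: r power_mult_distrib)
qed

subsection \<open>Riesz potentials and the Riesz energy of a ball\<close>

text \<open>Polar coordinates: half-lines generate the Borel sets, and their preimages under the
  norm are closed balls. The density is the derivative of the ball volume, that is the area of the
  sphere.\<close>

lemma distr_norm_lborel:
  "distr lborel borel (norm :: real^3 \<Rightarrow> real) = density lborel (\<lambda>t. ennreal (4 * pi * t^2) * indicator {0..} t)"
proof (rule measure_eqI_generator_eq[where E = "range atMost" and \<Omega> = UNIV and A = "\<lambda>n. {..real n}"])
  show "Int_stable (range (atMost :: real \<Rightarrow> _))"
    by (auto simp: Int_stable_def)
  fix X :: "real set" assume "X \<in> range atMost"
  then obtain a where X: "X = {..a}" by auto
  have "emeasure (distr lborel borel (norm :: real^3 \<Rightarrow> real)) X = emeasure lborel (cball (0 :: real^3) a)"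
    unfolding X by (subst emeasure_distr) (auto intro!: arg_cong[where f = "emeasure lborel"])
  also have "\<dots> = (if a \<ge> 0 then ennreal (4 * pi / 3 * a^3) else 0)"
    by (simp add: emeasure_cball unit_ball_vol_3)
  also have "\<dots> = emeasure (density lborel (\<lambda>t. ennreal (4 * pi * t^2) * indicator {0..} t)) X"
  proof (cases "a \<ge> 0")
    case True
    have "emeasure (density lborel (\<lambda>t. ennreal (4 * pi * t^2) * indicator {0..} t)) X =
        (\<integral>\<^sup>+t. ennreal (4 * pi * t^2) * indicator {0..a} t \<partial>lborel)"
      unfolding X by (subst emeasure_density) (auto intro!: nn_integral_cong split: split_indicator)
    also have "\<dots> = ennreal (4 * pi / 3 * a^3 - 4 * pi / 3 * 0^3)"
      using True by (intro nn_integral_FTC_Icc) (auto intro!: derivative_eq_intros)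
    finally show ?thesis using True by simp
  next
    case False
    have "emeasure (density lborel (\<lambda>t. ennreal (4 * pi * t^2) * indicator {0..} t)) X = 0"
      unfolding X using False
      by (subst emeasure_density) (auto simp: nn_integral_0_iff_AE intro!: AE_I2 split: split_indicator)
    then show ?thesis using False by simp
  qed
  finally show "emeasure (distr lborel borel (norm :: real^3 \<Rightarrow> real)) X =
    emeasure (density lborel (\<lambda>t. ennreal (4 * pi * t^2) * indicator {0..} t)) X" .
next
  fix i :: nat
  have "emeasure (distr lborel borel (norm :: real^3 \<Rightarrow> real)) {..real i} = emeasure lborel (cball (0 :: real^3) (real i))"
    by (subst emeasure_distr) (auto intro!: arg_cong[where f = "emeasure lborel"])
  then show "emeasure (distr lborel borel (norm :: real^3 \<Rightarrow> real)) {..real i} \<noteq> \<infinity>"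
    using emeasure_lborel_cball_finite[of "0 :: real^3" "real i"] by (auto simp: less_top)
next
  show "(\<Union>i. {..real i}) = UNIV" using real_arch_simple by auto
qed (auto simp: borel_eq_atMost)

lemma nn_integral_radial:
  assumes [measurable]: "f \<in> borel_measurable borel"
  shows "(\<integral>\<^sup>+x. f (norm (x :: real^3)) \<partial>lborel) =
    (\<integral>\<^sup>+t. f t * (ennreal (4 * pi * t^2) * indicator {0..} t) \<partial>lborel)"
proof -
  have "(\<integral>\<^sup>+x. f (norm (x :: real^3)) \<partial>lborel) = (\<integral>\<^sup>+t. f t \<partial>distr lborel borel (norm :: real^3 \<Rightarrow> real))"
    by (subst nn_integral_distr) auto
  also have "\<dots> = (\<integral>\<^sup>+t. f t * (ennreal (4 * pi * t^2) * indicator {0..} t) \<partial>lborel)"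
    unfolding distr_norm_lborel by (subst nn_integral_density) (auto simp: mult_ac)
  finally show ?thesis .
qed

lemma emeasure_lborel_plus:
  fixes A :: "'a::euclidean_space set"
  assumes [measurable]: "A \<in> sets borel"
  shows "emeasure lborel {x. x + c \<in> A} = emeasure lborel A"
proof -
  have "emeasure lborel A = emeasure (distr lborel borel ((+) c)) A"
    by (simp add: lborel_distr_plus)
  also have "\<dots> = emeasure lborel {x. x + c \<in> A}"
    by (subst emeasure_distr) (auto intro!: arg_cong[where f = "emeasure lborel"] simp: add.commute)
  finally show ?thesis ..
qed

lemma nn_integral_lborel_plus:
  fixes f :: "'a::euclidean_space \<Rightarrow> ennreal"
  assumes [measurable]: "f \<in> borel_measurable borel"
  shows "(\<integral>\<^sup>+x. f (x + c) \<partial>lborel) = (\<integral>\<^sup>+x. f x \<partial>lborel)"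
proof -
  have "(\<integral>\<^sup>+x. f x \<partial>lborel) = (\<integral>\<^sup>+x. f x \<partial>distr lborel borel ((+) c))"
    by (simp add: lborel_distr_plus)
  also have "\<dots> = (\<integral>\<^sup>+x. f (x + c) \<partial>lborel)"
    by (subst nn_integral_distr) (auto simp: add.commute)
  finally show ?thesis ..
qed

section \<open>Volumes of spherical caps by slicing\<close>

definition vec_of_slice :: "real \<times> complex \<Rightarrow> real^3" where
  "vec_of_slice p = vector [fst p, Re (snd p), Im (snd p)]"

lemma vec_of_slice_nth [simp]:
  "vec_of_slice p $ 1 = fst p" "vec_of_slice p $ 2 = Re (snd p)" "vec_of_slice p $ 3 = Im (snd p)"
  by (simp_all add: vec_of_slice_def)

lemma measurable_vec_of_slice [measurable]: "vec_of_slice \<in> borel \<rightarrow>\<^sub>M borel"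
proof (rule borel_measurable_continuous_onI)
  have "continuous_on UNIV (\<lambda>p. vec_of_slice p $ i)" for i :: 3
    using exhaust_3[of i] by (elim disjE; simp; intro continuous_intros)
  then have "continuous_on UNIV (\<lambda>p. \<chi> i. vec_of_slice p $ i)"
    by (intro continuous_on_vec_lambda)
  then show "continuous_on UNIV vec_of_slice" by (simp add: vec_lambda_eta)
qed

text \<open>Boxes pull back to products of an interval and a planar box of the same total volume.
  With \<open>complex\<close> as the planar factor, the slices of a ball become discs in a
  two-dimensional Euclidean space.\<close>

lemma distr_vec_of_slice: "distr lborel borel vec_of_slice = lborel"
proof (rule lborel_eqI[symmetric])
  fix l u :: "real^3" assume lu: "\<And>b. b \<in> Basis \<Longrightarrow> l \<bullet> b \<le> u \<bullet> b"
  have le: "l $ i \<le> u $ i" for i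
    using lu[of "axis i 1"] by (auto simp: inner_axis Basis_vec_def)
  let ?A = "box (l $ 1) (u $ 1)" and ?B = "box (Complex (l $ 2) (l $ 3)) (Complex (u $ 2) (u $ 3))"
  have "vec_of_slice -` box l u = ?A \<times> ?B"
    by (auto simp: box_def Basis_vec_def forall_3 inner_axis Basis_complex_def)
  then have "emeasure (distr lborel borel vec_of_slice) (box l u) = emeasure (lborel \<Otimes>\<^sub>M lborel) (?A \<times> ?B)"
    by (subst emeasure_distr) (auto simp: lborel_prod)
  also have "\<dots> = emeasure lborel ?A * emeasure lborel ?B"
    by (rule lborel.emeasure_pair_measure_Times) auto
  also have "\<dots> = ennreal (u $ 1 - l $ 1) * ennreal ((u $ 2 - l $ 2) * (u $ 3 - l $ 3))"
    using le by (simp add: emeasure_lborel_box_eq Basis_complex_def)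
  also have "\<dots> = ennreal ((u $ 1 - l $ 1) * ((u $ 2 - l $ 2) * (u $ 3 - l $ 3)))"
    using le by (simp add: ennreal_mult)
  also have "(u $ 1 - l $ 1) * ((u $ 2 - l $ 2) * (u $ 3 - l $ 3)) = (\<Prod>i\<in>UNIV. (u - l) $ i)"
    unfolding UNIV_3 by simp
  also have "\<dots> = (\<Prod>b\<in>Basis. (u - l) \<bullet> b)"
  proof -
    have B: "(Basis :: (real^3) set) = range (\<lambda>i. axis i 1)" by (auto simp: Basis_vec_def)
    have "inj (\<lambda>i :: 3. axis i (1 :: real))" by (auto simp: inj_on_def axis_eq_axis)
    then show ?thesis unfolding B by (subst prod.reindex) (auto simp: inner_axis)
  qed
  finally show "emeasure (distr lborel borel vec_of_slice) (box l u) = ennreal (\<Prod>b\<in>Basis. (u - l) \<bullet> b)" .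
qed auto

lemma norm_vec_of_slice: "(norm (vec_of_slice p))^2 = (fst p)^2 + (cmod (snd p))^2"
  by (simp add: norm_vec_def L2_set_def sum_3 cmod_power2)

text \<open>Volume of the part of a ball of radius \<open>R\<close> beyond a plane at distance
  \<open>d\<close> from its centre: the integral of \<pi> (R^2 - t^2) over t from d to R.\<close>

definition cap_vol :: "real \<Rightarrow> real \<Rightarrow> real" where
  "cap_vol R d = pi * (2 * R^3 / 3 - R^2 * d + d^3 / 3)"

lemma emeasure_axis_cap:
  assumes "0 \<le> d" "d \<le> R"
  shows "emeasure lborel {x :: real^3. norm x \<le> R \<and> d \<le> x $ 1} = ennreal (cap_vol R d)"
proof -
  let ?C = "{x :: real^3. norm x \<le> R \<and> d \<le> x $ 1}"
  have cl: "closed ?C"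
    by (intro closed_Collect_conj closed_Collect_le continuous_intros)
  then have [measurable]: "?C \<in> sets borel" by auto
  have "emeasure lborel ?C = emeasure (distr lborel borel vec_of_slice) ?C"
    by (simp add: distr_vec_of_slice)
  also have "\<dots> = emeasure (lborel \<Otimes>\<^sub>M lborel) (vec_of_slice -` ?C)"
    by (subst emeasure_distr) (auto simp: lborel_prod)
  also have "\<dots> = (\<integral>\<^sup>+t. emeasure lborel (Pair t -` (vec_of_slice -` ?C)) \<partial>lborel)"
  proof (rule lborel.emeasure_pair_measure_alt)
    have "vec_of_slice \<in> lborel \<Otimes>\<^sub>M lborel \<rightarrow>\<^sub>M borel" by (simp add: lborel_prod)
    from measurable_sets[OF this, of ?C] show "vec_of_slice -` ?C \<in> sets (lborel \<Otimes>\<^sub>M lborel)"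
      by (simp add: space_pair_measure)
  qed
  also have "\<dots> = (\<integral>\<^sup>+t. ennreal (pi * (R^2 - t^2)) * indicator {d..R} t \<partial>lborel)"
  proof (intro nn_integral_cong)
    fix t :: real
    have iff: "norm (vec_of_slice (t, z)) \<le> R \<longleftrightarrow> t^2 + (cmod z)^2 \<le> R^2" for z
    proof -
      have "norm (vec_of_slice (t, z)) \<le> R \<longleftrightarrow> (norm (vec_of_slice (t, z)))^2 \<le> R^2"
        using abs_le_square_iff[of "norm (vec_of_slice (t, z))" R] assms by simp
      then show ?thesis by (simp only: norm_vec_of_slice fst_conv snd_conv)
    qed
    show "emeasure lborel (Pair t -` (vec_of_slice -` ?C)) = ennreal (pi * (R^2 - t^2)) * indicator {d..R} t"
    proof (cases "d \<le> t \<and> t \<le> R")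
      case True
      then have le: "t^2 \<le> R^2" using assms by (intro power_mono) auto
      have "cmod z \<le> sqrt (R^2 - t^2) \<longleftrightarrow> t^2 + (cmod z)^2 \<le> R^2" for z
        using real_sqrt_le_iff[of "(cmod z)^2" "R^2 - t^2"] by (simp add: algebra_simps)
      then have "Pair t -` (vec_of_slice -` ?C) = cball 0 (sqrt (R^2 - t^2))"
        using True by (simp add: set_eq_iff iff)
      then show ?thesis using True le
        by (simp add: emeasure_cball unit_ball_vol_2)
    next
      case False
      have "Pair t -` (vec_of_slice -` ?C) = {}"
      proof (rule ccontr)
        assume "Pair t -` (vec_of_slice -` ?C) \<noteq> {}"
        then obtain z where z: "t^2 + (cmod z)^2 \<le> R^2" "d \<le> t" by (auto simp: iff)
        then have "t^2 \<le> R^2" by (smt (verit) zero_le_power2)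
        then have "t \<le> R" using assms z by (simp add: power2_le_iff_abs_le)
        then show False using z False by simp
      qed
      then show ?thesis using False by auto
    qed
  qed
  also have "\<dots> = ennreal (pi * (R^2 * R - R^3/3) - pi * (R^2 * d - d^3/3))"
  proof (rule nn_integral_FTC_Icc)
    fix t assume "t \<in> {d..R}"
    then have "t^2 \<le> R^2" using assms by (intro power_mono) auto
    then show "0 \<le> pi * (R^2 - t^2)" by simp
  qed (use assms in \<open>auto intro!: derivative_eq_intros\<close>)
  also have "pi * (R^2 * R - R^3/3) - pi * (R^2 * d - d^3/3) = cap_vol R d"
    by (simp add: cap_vol_def algebra_simps power2_eq_square power3_eq_cube)
  finally show ?thesis .
qed

text \<open>An orthogonal map taking z to the first coordinate axis reduces this to the
  axis-parallel cap. The condition on x \<bullet> z says that x is at least as close to z as to 0,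
  which is the half of the lens needed later.\<close>

lemma emeasure_cap:
  fixes z :: "real^3"
  assumes "z \<noteq> 0" "norm z \<le> 2 * R"
  shows "emeasure lborel {x. norm x \<le> R \<and> (norm z)^2/2 \<le> x \<bullet> z} = ennreal (cap_vol R (norm z / 2))"
proof -
  let ?S = "{x. norm x \<le> R \<and> (norm z)^2/2 \<le> x \<bullet> z}"
  let ?C = "{x :: real^3. norm x \<le> R \<and> norm z / 2 \<le> x $ 1}"
  have lm: "{x. norm x \<le> R \<and> a \<le> x \<bullet> w} \<in> lmeasurable \<and> {x. norm x \<le> R \<and> a \<le> x \<bullet> w} \<in> sets borel" 
    for a and w :: "real^3"
  proof -
    have "closed {x. norm x \<le> R \<and> a \<le> x \<bullet> w}"
      by (intro closed_Collect_conj closed_Collect_le continuous_intros)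
    moreover have "bounded {x. norm x \<le> R \<and> a \<le> x \<bullet> w}"
      by (auto simp: bounded_iff)
    ultimately show ?thesis by (auto intro: lmeasurable_compact simp: compact_eq_bounded_closed)
  qed
  have C: "?C = {x. norm x \<le> R \<and> norm z / 2 \<le> x \<bullet> axis 1 1}" by (simp add: inner_axis)
  obtain f where f: "orthogonal_transformation f" "f z = norm z *\<^sub>R axis (1::3) (1::real)"
    by (rule orthogonal_transformation_exists[of z "norm z *\<^sub>R axis 1 1"]) auto
  have "f ` ?S = ?C"
  proof (intro equalityI subsetI)
    fix y assume "y \<in> f ` ?S"
    then obtain x where x: "x \<in> ?S" "y = f x" by auto
    have "x \<bullet> z = y \<bullet> f z" using f(1) x by (simp add: orthogonal_transformation_def)
    also have "\<dots> = norm z * y $ 1" by (simp add: f inner_axis)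
    finally have "norm z * (norm z / 2) \<le> norm z * y $ 1" using x by (simp add: power2_eq_square)
    then show "y \<in> ?C" using x f assms by (simp add: orthogonal_transformation_norm mult_le_cancel_left)
  next
    fix y assume y: "y \<in> ?C"
    obtain x where x: "y = f x" using orthogonal_transformation_surj[OF f(1)] by (metis surj_def)
    have "x \<bullet> z = y \<bullet> f z" using f(1) x by (simp add: orthogonal_transformation_def)
    also have "\<dots> = norm z * y $ 1" by (simp add: f inner_axis)
    finally have "x \<in> ?S" using y x f assms
      by (simp add: orthogonal_transformation_norm power2_eq_square)
    then show "y \<in> f ` ?S" using x by auto
  qed
  then have "measure lebesgue ?C = measure lebesgue ?S"
    using measure_orthogonal_image[OF f(1), of ?S] lm by metis
  moreover have "emeasure lborel {x. norm x \<le> R \<and> a \<le> x \<bullet> w} =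
      ennreal (measure lebesgue {x. norm x \<le> R \<and> a \<le> x \<bullet> w})" for a and w :: "real^3"
  proof -
    have "bounded {x. norm x \<le> R \<and> a \<le> x \<bullet> w}" by (auto simp: bounded_iff)
    then have "emeasure lborel {x. norm x \<le> R \<and> a \<le> x \<bullet> w} \<noteq> top"
      using emeasure_bounded_finite by fastforce
    then show ?thesis using lm[of a w] by (simp add: emeasure_eq_ennreal_measure)
  qed
  ultimately have "emeasure lborel ?C = emeasure lborel ?S"
    unfolding C by presburger
  then show ?thesis using emeasure_axis_cap[of "norm z / 2" R] assms by simp
qed

lemma cap_vol_nonneg: "\<lbrakk>0 \<le> d; d \<le> R\<rbrakk> \<Longrightarrow> 0 \<le> cap_vol R d"
proof -
  assume a: "0 \<le> d" "d \<le> R"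
  have "cap_vol R d = pi * ((R - d)^2 * (2 * R + d) / 3)"
    by (simp add: cap_vol_def power2_eq_square power3_eq_cube field_simps)
  also have "\<dots> \<ge> 0" using a by (intro mult_nonneg_nonneg divide_nonneg_nonneg) auto
  finally show ?thesis .
qed

text \<open>The lens is covered by two caps, interchanged by the point reflection at \<open>z / 2\<close>.\<close>

lemma emeasure_lens_le:
  fixes z :: "real^3"
  assumes "z \<noteq> 0" "norm z \<le> 2 * R"
  shows "emeasure lborel (cball 0 R \<inter> cball z R) \<le> ennreal (2 * cap_vol R (norm z / 2))"
proof -
  define A where "A w = {x. norm x \<le> R \<and> (norm w)^2/2 \<le> x \<bullet> w}" for w :: "real^3"
  have m [measurable]: "A w \<in> sets borel" for w
  proof -
    have "closed (A w)" unfolding A_def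
      by (intro closed_Collect_conj closed_Collect_le continuous_intros)
    then show ?thesis by auto
  qed
  have "cball 0 R \<inter> cball z R \<subseteq> A z \<union> {x. x + (-z) \<in> A (-z)}"
    by (auto simp: A_def dist_norm norm_minus_commute inner_diff_left dot_square_norm)
  then have "emeasure lborel (cball 0 R \<inter> cball z R) \<le> emeasure lborel (A z \<union> {x. x + (-z) \<in> A (-z)})"
    by (intro emeasure_mono) auto
  also have "\<dots> \<le> emeasure lborel (A z) + emeasure lborel {x. x + (-z) \<in> A (-z)}"
    by (intro emeasure_subadditive) auto
  also have "emeasure lborel {x. x + (-z) \<in> A (-z)} = emeasure lborel (A (-z))"
    by (rule emeasure_lborel_plus) auto
  also have "emeasure lborel (A z) + emeasure lborel (A (-z)) = ennreal (2 * cap_vol R (norm z / 2))"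
    using emeasure_cap[of z R] emeasure_cap[of "-z" R] assms cap_vol_nonneg[of "norm z / 2" R]
    by (simp add: A_def flip: ennreal_plus)
  finally show ?thesis .
qed

text \<open>With y = x + z, Tonelli turns the double integral into that of |z|^-2 times the volume
  of the intersection of two translates of the ball. The lens bound controls this by a function of
  |z| that vanishes beyond the diameter, and the remaining radial integrand is a polynomial.\<close>

lemma riesz_energy_cball:
  fixes c :: "real^3"
  assumes "R \<ge> 0"
  shows "(\<integral>\<^sup>+x. \<integral>\<^sup>+y. ennreal (1 / (norm (x - y))^2) * indicator (cball c R) y * indicator (cball c R) x \<partial>lborel \<partial>lborel)
    \<le> ennreal (4 * pi^2 * R^4)"
proof -
  let ?B = "cball c R"
  have [measurable]: "cball w R \<in> sets borel" for w :: "real^3" by simp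
  have "(\<integral>\<^sup>+x. \<integral>\<^sup>+y. ennreal (1 / (norm (x - y))^2) * indicator ?B y * indicator ?B x \<partial>lborel \<partial>lborel)
     = (\<integral>\<^sup>+x. \<integral>\<^sup>+z. ennreal (1 / (norm z)^2) * indicator ?B (z + x) * indicator ?B x \<partial>lborel \<partial>lborel)"
  proof (rule nn_integral_cong)
    fix x :: "real^3"
    show "(\<integral>\<^sup>+y. ennreal (1 / (norm (x - y))^2) * indicator ?B y * indicator ?B x \<partial>lborel)
     = (\<integral>\<^sup>+z. ennreal (1 / (norm z)^2) * indicator ?B (z + x) * indicator ?B x \<partial>lborel)"
    proof -
      have "(\<lambda>y. ennreal (1 / (norm (x - y))^2) * indicator ?B y * indicator ?B x) \<in> borel_measurable borel"
        by (intro borel_measurable_times_ennreal borel_measurable_indicator measurable_const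
            measurable_compose[OF _ measurable_ennreal]) auto
      from nn_integral_lborel_plus[OF this, of x] show ?thesis by simp
    qed
  qed
  also have "\<dots> = (\<integral>\<^sup>+z. \<integral>\<^sup>+x. ennreal (1 / (norm z)^2) * indicator ?B (z + x) * indicator ?B x \<partial>lborel \<partial>lborel)"
    by (rule lborel_pair.Fubini') measurable
  also have "\<dots> \<le> (\<integral>\<^sup>+z. ennreal (2 * cap_vol R (norm z / 2) / (norm z)^2 * indicator {0..2*R} (norm (z :: real^3))) \<partial>lborel)"
  proof (rule nn_integral_mono)
    fix z :: "real^3"
    have "(\<integral>\<^sup>+x. ennreal (1 / (norm z)^2) * indicator ?B (z + x) * indicator ?B x \<partial>lborel)
      = (\<integral>\<^sup>+x. ennreal (1 / (norm z)^2) * indicator (cball 0 R \<inter> cball (-z) R) (x + (-c)) \<partial>lborel)"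
      by (intro nn_integral_cong) (auto split: split_indicator simp: dist_norm algebra_simps norm_minus_commute)
    also have "\<dots> = (\<integral>\<^sup>+x. ennreal (1 / (norm z)^2) * indicator (cball 0 R \<inter> cball (-z) R) x \<partial>lborel)"
      by (rule nn_integral_lborel_plus) measurable
    also have "\<dots> = ennreal (1 / (norm z)^2) * emeasure lborel (cball 0 R \<inter> cball (-z) R)"
      by (rule nn_integral_cmult_indicator) auto
    also have "\<dots> \<le> ennreal (2 * cap_vol R (norm z / 2) / (norm z)^2 * indicator {0..2*R} (norm z))"
    proof (cases "z = 0 \<or> norm z > 2 * R")
      case True
      moreover have "cball 0 R \<inter> cball (-z) R = {}" if "norm z > 2 * R"
      proof (rule ccontr)
        assume "cball 0 R \<inter> cball (-z) R \<noteq> {}"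
        then obtain x where "norm x \<le> R" "norm (-z - x) \<le> R" by (auto simp: dist_norm)
        then have "norm (x + (-z - x)) \<le> 2 * R" using norm_triangle_ineq[of x "-z - x"] by linarith
        then show False using that by simp
      qed
      ultimately show ?thesis by auto
    next
      case False
      then have "ennreal (1 / (norm z)^2) * emeasure lborel (cball 0 R \<inter> cball (-z) R) \<le>
          ennreal (1 / (norm z)^2) * ennreal (2 * cap_vol R (norm z / 2))"
        using emeasure_lens_le[of "-z" R] by (intro mult_left_mono) auto
      also have "\<dots> = ennreal (2 * cap_vol R (norm z / 2) / (norm z)^2)"
        using False cap_vol_nonneg[of "norm z / 2" R] by (simp flip: ennreal_mult)
      finally show ?thesis using False by simp
    qed
    finally show "(\<integral>\<^sup>+x. ennreal (1 / (norm z)^2) * indicator ?B (z + x) * indicator ?B x \<partial>lborel)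
      \<le> ennreal (2 * cap_vol R (norm z / 2) / (norm z)^2 * indicator {0..2*R} (norm z))" .
  qed
  also have "\<dots> = (\<integral>\<^sup>+t. ennreal (2 * cap_vol R (t / 2) / t^2 * indicator {0..2*R} t) *
      (ennreal (4 * pi * t^2) * indicator {0..} t) \<partial>lborel)"
    by (rule nn_integral_radial) (simp add: cap_vol_def)
  \<comment> \<open>The surface factor t^2 cancels the singularity. Equality can fail only at t = 0,
    where division by zero makes the left side 0.\<close>
  also have "\<dots> \<le> (\<integral>\<^sup>+t. ennreal (8 * pi * cap_vol R (t / 2)) * indicator {0..2*R} t \<partial>lborel)"
  proof (rule nn_integral_mono)
    fix t :: real
    show "ennreal (2 * cap_vol R (t / 2) / t^2 * indicator {0..2*R} t) *
      (ennreal (4 * pi * t^2) * indicator {0..} t) \<le> ennreal (8 * pi * cap_vol R (t / 2)) * indicator {0..2*R} t"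
      using cap_vol_nonneg[of "t / 2" R]
      by (cases "t = 0") (auto split: split_indicator simp flip: ennreal_mult simp: field_simps)
  qed
  also have "\<dots> = ennreal (8 * pi^2 * (2 * R^3 / 3 * (2 * R) - R^2 * (2 * R)^2 / 4 + (2 * R)^4 / 96)
      - 8 * pi^2 * (2 * R^3 / 3 * 0 - R^2 * 0^2 / 4 + 0^4 / 96))"
  proof (rule nn_integral_FTC_Icc)
    show "DERIV (\<lambda>t. 8 * pi^2 * (2 * R^3 / 3 * t - R^2 * t^2 / 4 + t^4 / 96)) t :> 8 * pi * cap_vol R (t / 2)" for t
      by (auto intro!: derivative_eq_intros simp: cap_vol_def field_simps power2_eq_square power3_eq_cube)
    show "0 \<le> 8 * pi * cap_vol R (t / 2)" if "t \<in> {0..2 * R}" for t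
      using that cap_vol_nonneg[of "t / 2" R] by simp
  qed (use assms in \<open>auto simp: cap_vol_def\<close>)
  also have "8 * pi^2 * (2 * R^3 / 3 * (2 * R) - R^2 * (2 * R)^2 / 4 + (2 * R)^4 / 96)
      - 8 * pi^2 * (2 * R^3 / 3 * 0 - R^2 * 0^2 / 4 + 0^4 / 96) = 4 * pi^2 * R^4"
    by (simp add: field_simps eval_nat_numeral)
  finally show ?thesis .
qed

text \<open>Bathtub principle: \<open>|x|\<^sup>-\<^sup>2 \<le> R\<^sup>-\<^sup>2\<close> off the ball of radius \<open>R\<close>, optimal when the ball has
  the volume of \<open>A\<close>.\<close>

lemma riesz_potential_le:
  fixes x :: "real^3"
  assumes [measurable]: "A \<in> sets lborel" and R: "R > 0"
  shows "(\<integral>\<^sup>+y. ennreal (1 / (norm (x - y))^2) * indicator A y \<partial>lborel)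
    \<le> ennreal (1 / R^2) * emeasure lborel A + ennreal (8 * pi * R / 3)"
proof -
  have "(\<integral>\<^sup>+y. ennreal (1 / (norm (x - y))^2) * indicator A y \<partial>lborel)
    \<le> (\<integral>\<^sup>+y. ennreal (1 / R^2) * indicator A y + ennreal ((1 / (norm (y + (-x)))^2 - 1 / R^2) * indicator {0..R} (norm (y + (-x)))) \<partial>lborel)"
  proof (rule nn_integral_mono)
    fix y :: "real^3"
    show "ennreal (1 / (norm (x - y))^2) * indicator A y
      \<le> ennreal (1 / R^2) * indicator A y + ennreal ((1 / (norm (y + (-x)))^2 - 1 / R^2) * indicator {0..R} (norm (y + (-x))))"
    proof (cases "norm (x - y) \<le> R")
      case True
      show ?thesis
      \<comment> \<open>At y = x the left side is 0 because division by zero gives 0; elsewhere in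
        the ball the two terms on the right add up to |x - y|^-2 on \<open>A\<close>.\<close>
      proof (cases "x = y")
        case False
        then have "1 / R^2 \<le> 1 / (norm (x - y))^2"
          using True R by (intro divide_left_mono power_mono) auto
        then show ?thesis using True R
          by (auto split: split_indicator simp: norm_minus_commute simp flip: ennreal_plus)
      qed (auto simp: indicator_def)
    next
      case False
      then have "1 / (norm (x - y))^2 \<le> 1 / R^2"
        using R by (intro frac_le power_mono) auto
      then show ?thesis using False
        by (auto split: split_indicator simp: norm_minus_commute intro!: ennreal_leI)
    qed
  qed
  also have "\<dots> = (\<integral>\<^sup>+y. ennreal (1 / R^2) * indicator A y \<partial>lborel) +
      (\<integral>\<^sup>+y. ennreal ((1 / (norm (y + (-x)))^2 - 1 / R^2) * indicator {0..R} (norm (y + (-x)))) \<partial>lborel)"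
    by (rule nn_integral_add) measurable
  also have "(\<integral>\<^sup>+y. ennreal (1 / R^2) * indicator A y \<partial>lborel) = ennreal (1 / R^2) * emeasure lborel A"
    by (rule nn_integral_cmult_indicator) (use assms in auto)
  also have "(\<integral>\<^sup>+y. ennreal ((1 / (norm (y + (-x)))^2 - 1 / R^2) * indicator {0..R} (norm (y + (-x)))) \<partial>lborel)
      = (\<integral>\<^sup>+y. ennreal ((1 / (norm y)^2 - 1 / R^2) * indicator {0..R} (norm (y::real^3))) \<partial>lborel)"
    by (rule nn_integral_lborel_plus[where f = "\<lambda>y. ennreal ((1 / (norm y)^2 - 1 / R^2) * indicator {0..R} (norm y))"]) measurable
  also have "\<dots> = (\<integral>\<^sup>+t. ennreal ((1 / t^2 - 1 / R^2) * indicator {0..R} t) * (ennreal (4 * pi * t^2) * indicator {0..} t) \<partial>lborel)"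
    by (rule nn_integral_radial) measurable
  also have "\<dots> \<le> (\<integral>\<^sup>+t. ennreal (4 * pi * (1 - t^2 / R^2)) * indicator {0..R} t \<partial>lborel)"
  proof (rule nn_integral_mono)
    fix t :: real
    show "ennreal ((1 / t^2 - 1 / R^2) * indicator {0..R} t) * (ennreal (4 * pi * t^2) * indicator {0..} t)
      \<le> ennreal (4 * pi * (1 - t^2 / R^2)) * indicator {0..R} t"
    proof (cases "t > 0 \<and> t \<le> R")
      case True
      then have "1 / R^2 \<le> 1 / t^2" by (intro divide_left_mono power_mono) auto
      moreover have "(1 / t^2 - 1 / R^2) * (4 * pi * t^2) = 4 * pi * (1 - t^2 / R^2)"
        using True by (simp add: field_simps)
      ultimately show ?thesis using True by (simp flip: ennreal_mult)
    next
      case False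
      then show ?thesis by (cases "t = 0") (auto split: split_indicator)
    qed
  qed
  also have "\<dots> = ennreal (4 * pi * (R - R^3 / (3 * R^2)) - 4 * pi * (0 - 0^3 / (3 * R^2)))"
  proof (rule nn_integral_FTC_Icc)
    fix t assume t: "t \<in> {0..R}"
    then have "t^2 \<le> R^2" by (intro power_mono) auto
    then show "0 \<le> 4 * pi * (1 - t^2 / R^2)" using R by simp
    show "DERIV (\<lambda>t. 4 * pi * (t - t^3 / (3 * R^2))) t :> 4 * pi * (1 - t^2 / R^2)"
      using R by (auto intro!: derivative_eq_intros simp: field_simps eval_nat_numeral)
  qed (use R in auto)
  also have "4 * pi * (R - R^3 / (3 * R^2)) - 4 * pi * (0 - 0^3 / (3 * R^2)) = 8 * pi * R / 3"
    using R by (simp add: field_simps power2_eq_square power3_eq_cube)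
  finally show ?thesis by (auto intro: add_left_mono order_trans)
qed

subsection \<open>Smooth functions and integration by parts\<close>

lemma C_diff_on_Suc_imp: "C_diff_on (Suc n) f S \<Longrightarrow> C_diff_on n f S"
proof (induction n arbitrary: f)
  case 0
  then show ?case
    by (auto intro!: differentiable_imp_continuous_on simp: differentiable_on_def differentiable_at_withinI)
next
  case (Suc n)
  then show ?case by (metis C_diff_on.simps(2))
qed

lemma frechet_derivative_eq: "(f has_derivative f') (at x) \<Longrightarrow> frechet_derivative f (at x) v = f' v"
  by (drule frechet_derivative_at) (rule fun_cong, rule sym)

lemma frechet_derivative_linear_image:
  assumes "bounded_linear L" "f differentiable (at x)"
  shows "frechet_derivative (\<lambda>y. L (f y)) (at x) v = L (frechet_derivative f (at x) v)"
  by (rule frechet_derivative_eq, rule bounded_linear.has_derivative[OF assms(1)])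
    (use assms(2) in \<open>simp add: frechet_derivative_works\<close>)

lemma C_diff_on_linear_image:
  assumes "bounded_linear L" "C_diff_on n f UNIV"
  shows "C_diff_on n (\<lambda>x. L (f x)) UNIV"
  using assms(2)
proof (induction n arbitrary: f)
  case 0
  then show ?case using assms(1) by (auto intro: bounded_linear.continuous_on)
next
  case (Suc n)
  then have d: "f differentiable (at x)" for x by simp
  then have "(\<lambda>x. L (f x)) differentiable (at x)" for x
    using bounded_linear.has_derivative[OF assms(1)] unfolding differentiable_def by metis
  moreover have "C_diff_on n (\<lambda>x. L (frechet_derivative f (at x) v)) UNIV" for v
    using Suc by simp
  ultimately show ?case
    by (simp add: frechet_derivative_linear_image[OF assms(1) d])
qed

lemma smooth_on_linear_image:
  "bounded_linear L \<Longrightarrow> smooth_on f UNIV \<Longrightarrow> smooth_on (\<lambda>x. L (f x)) UNIV"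
  by (simp add: smooth_on_def C_diff_on_linear_image)

lemma smooth_on_UNIV_D:
  assumes "smooth_on f UNIV"
  shows "f differentiable (at x)" "continuous_on UNIV f"
    "smooth_on (\<lambda>x. frechet_derivative f (at x) v) UNIV"
proof -
  have "C_diff_on n f UNIV" for n using assms by (simp add: smooth_on_def)
  then have C: "C_diff_on 0 f UNIV" "C_diff_on (Suc n) f UNIV" for n by blast+
  show "f differentiable (at x)" using C(2)[of 0] unfolding C_diff_on.simps by blast
  show "continuous_on UNIV f" using C(1) unfolding C_diff_on.simps .
  have "C_diff_on n (\<lambda>x. frechet_derivative f (at x) v) UNIV" for n using C(2)[of n] unfolding C_diff_on.simps by blast
  then show "smooth_on (\<lambda>x. frechet_derivative f (at x) v) UNIV" by (simp add: smooth_on_def)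
qed

lemma integrable_continuous_bounded_support:
  fixes f :: "'a::euclidean_space \<Rightarrow> 'b::euclidean_space"
  assumes c: "continuous_on UNIV f" and "bounded S" "\<And>x. x \<notin> S \<Longrightarrow> f x = 0"
  shows "integrable lborel f"
proof -
  obtain R where R: "S \<subseteq> cball 0 R" 
    using \<open>bounded S\<close> by (meson bounded_subset_ballD ball_subset_cball order_trans)
  have "compact (f ` cball 0 R)"
    by (intro compact_continuous_image continuous_on_subset[OF c]) auto
  then obtain M where M: "\<And>x. x \<in> cball 0 R \<Longrightarrow> norm (f x) \<le> M"
    using compact_imp_bounded bounded_iff by (metis imageI)
  show ?thesis
  proof (rule integrableI_bounded_set[where A = "cball 0 R" and B = M])
    show "f \<in> borel_measurable lborel" using c by (simp add: borel_measurable_continuous_onI)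
    show "AE x in lborel. x \<notin> cball 0 R \<longrightarrow> f x = 0" using R assms(3) by (intro AE_I2) blast
  qed (use M emeasure_lborel_cball_finite[of "0::'a" R] in auto)
qed

lemma integral_lborel_plus:
  fixes f :: "'a::euclidean_space \<Rightarrow> 'b::euclidean_space"
  assumes [measurable]: "f \<in> borel_measurable borel"
  shows "(\<integral>x. f (x + c) \<partial>lborel) = (\<integral>x. f x \<partial>lborel)"
proof -
  have "(\<integral>x. f x \<partial>lborel) = (\<integral>x. f x \<partial>distr lborel borel ((+) c))"
    by (simp add: lborel_distr_plus)
  also have "\<dots> = (\<integral>x. f (x + c) \<partial>lborel)"
    by (subst integral_distr) (auto simp: add.commute)
  finally show ?thesis ..
qed

text \<open>The derivative is the limit of difference quotients, whose integrals vanish by translation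
  invariance.\<close>

lemma integral_derivative_zero:
  fixes F :: "'a::euclidean_space \<Rightarrow> 'b::euclidean_space"
  assumes D: "\<And>x. (F has_derivative F' x) (at x)"
    and cont: "continuous_on UNIV (\<lambda>x. F' x v)"
    and S: "bounded S" "\<And>x. x \<notin> S \<Longrightarrow> F x = 0"
  shows "(\<integral>x. F' x v \<partial>lborel) = 0"
proof -
  have Fc: "continuous_on UNIV F"
    using D by (auto simp: continuous_on_eq_continuous_at intro: has_derivative_continuous)
  then have [measurable]: "F \<in> borel_measurable borel" by (rule borel_measurable_continuous_onI)
  have [measurable]: "(\<lambda>x. F' x v) \<in> borel_measurable borel" using cont by (rule borel_measurable_continuous_onI)
  have Fi: "integrable lborel F" by (rule integrable_continuous_bounded_support[OF Fc S])
  obtain R where R: "S \<subseteq> cball 0 R" "R > 0" using S(1) bounded_subset_cball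
    by (metis bounded_subset_ballD ball_subset_cball order_trans)
  \<comment> \<open>As 0 < h n \<le> 1, the quotient \<open>X n\<close> defined below vanishes
    outside \<open>B\<close>; for x in \<open>B\<close> the segment from x to x + h n v stays in the
    ball of radius R + 2 |v|, where \<open>M\<close> bounds the derivative. This gives one
    dominating function for all n.\<close>
  define B where "B = cball (0::'a) (R + norm v)"
  have "compact ((\<lambda>x. F' x v) ` cball 0 (R + 2 * norm v))"
    by (intro compact_continuous_image continuous_on_subset[OF cont]) auto
  then obtain M where M: "\<And>x. x \<in> cball 0 (R + 2 * norm v) \<Longrightarrow> norm (F' x v) \<le> M"
    using compact_imp_bounded bounded_iff by (metis imageI)
  define h where "h n = 1 / real (Suc n)" for n
  have h: "0 < h n" "h n \<le> 1" for n by (auto simp: h_def divide_simps)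
  define X where "X n x = (1 / h n) *\<^sub>R (F (x + h n *\<^sub>R v) - F x)" for n x
  have line: "((\<lambda>t. F (x + t *\<^sub>R v)) has_derivative (\<lambda>s. s *\<^sub>R F' (x + t *\<^sub>R v) v)) (at t within T)" for x t T
  proof -
    have "((\<lambda>t. F (x + t *\<^sub>R v)) has_derivative (\<lambda>s. F' (x + t *\<^sub>R v) (s *\<^sub>R v))) (at t within T)"
      by (rule has_derivative_compose[where g = F, OF _ D]) (auto intro!: derivative_eq_intros)
    moreover have "F' y (s *\<^sub>R v) = s *\<^sub>R F' y v" for s y
      using has_derivative_bounded_linear[OF D] by (intro linear_scale bounded_linear.linear)
    ultimately show ?thesis by simp
  qed
  have "(\<lambda>n. \<integral>x. X n x \<partial>lborel) \<longlonglongrightarrow> (\<integral>x. F' x v \<partial>lborel)"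
  proof (rule integral_dominated_convergence[where w = "\<lambda>x. M * indicator B x"])
    show "integrable lborel (\<lambda>x. M * indicator B x)"
      using emeasure_lborel_cball_finite[of "0::'a" "R + norm v"]
      by (intro integrable_mult_right integrable_real_indicator) (auto simp: B_def)
    show "AE x in lborel. (\<lambda>i. X i x) \<longlonglongrightarrow> F' x v"
    proof (rule AE_I2)
      fix x
      have "((\<lambda>t. F (x + t *\<^sub>R v)) has_vector_derivative F' x v) (at 0)"
        using line[of x 0 UNIV] by (simp add: has_vector_derivative_def)
      then have "((\<lambda>t. norm (F (x + t *\<^sub>R v) - F x - t *\<^sub>R F' x v) / norm t) \<longlongrightarrow> 0) (at 0)"
        by (simp add: has_vector_derivative_def has_derivative_at)
      moreover have "filterlim h (at 0) sequentially"
        unfolding filterlim_at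
      proof (intro conjI)
        show "h \<longlonglongrightarrow> 0" unfolding h_def using LIMSEQ_inverse_real_of_nat by (simp add: divide_inverse)
      qed (use h in \<open>auto simp: less_imp_neq[symmetric]\<close>)
      ultimately have "(\<lambda>n. norm (F (x + h n *\<^sub>R v) - F x - h n *\<^sub>R F' x v) / norm (h n)) \<longlonglongrightarrow> 0"
        by (rule filterlim_compose)
      moreover have "norm (F (x + h n *\<^sub>R v) - F x - h n *\<^sub>R F' x v) / norm (h n) = norm (X n x - F' x v)" for n
      proof -
        have "X n x - F' x v = (1 / h n) *\<^sub>R (F (x + h n *\<^sub>R v) - F x - h n *\<^sub>R F' x v)"
          using h[of n] by (simp add: X_def scaleR_diff_right)
        then show ?thesis using h[of n] by simp
      qed
      ultimately have "(\<lambda>n. norm (X n x - F' x v)) \<longlonglongrightarrow> 0" by simp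
      then show "(\<lambda>i. X i x) \<longlonglongrightarrow> F' x v" by (simp add: tendsto_norm_zero_iff LIM_zero_iff)
    qed
    show "AE x in lborel. norm (X n x) \<le> M * indicator B x" for n
    proof (rule AE_I2)
      fix x
      show "norm (X n x) \<le> M * indicator B x"
      proof (cases "x \<in> B")
        case True
        have "norm (F (x + h n *\<^sub>R v) - F (x + 0 *\<^sub>R v)) \<le> M * norm (h n - 0)"
        proof (rule differentiable_bound[where S = "{0..1}", OF _ line])
          fix t :: real assume t: "t \<in> {0..1}"
          have "norm (x + t *\<^sub>R v) \<le> norm x + norm (t *\<^sub>R v)" by (rule norm_triangle_ineq)
          also have "norm (t *\<^sub>R v) \<le> norm v" using t by (simp add: mult_left_le_one_le)
          finally have "norm (F' (x + t *\<^sub>R v) v) \<le> M" using True by (intro M) (auto simp: B_def)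
          then show "onorm (\<lambda>s. s *\<^sub>R F' (x + t *\<^sub>R v) v) \<le> M"
            by (intro onorm_le) (simp add: mult.commute[of M] mult_left_mono)
        qed (use h[of n] in auto)
        then show ?thesis using True h[of n] by (simp add: X_def pos_divide_le_eq)
      next
        case False
        then have "norm x > R + norm v" by (simp add: B_def)
        moreover have "norm x \<le> norm (x + h n *\<^sub>R v) + norm (h n *\<^sub>R v)"
          using norm_triangle_ineq4[of "x + h n *\<^sub>R v" "h n *\<^sub>R v"] by simp
        moreover have "norm (h n *\<^sub>R v) \<le> norm v" using h[of n] by (simp add: mult_left_le_one_le)
        ultimately have "norm x > R" "norm (x + h n *\<^sub>R v) > R" using norm_ge_zero[of v] by linarith+
        then have "x \<notin> S" "x + h n *\<^sub>R v \<notin> S" using R by auto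
        then show ?thesis using S(2) False by (simp add: X_def)
      qed
    qed
  qed (auto simp: X_def)
  moreover have "(\<integral>x. X n x \<partial>lborel) = 0" for n
  proof -
    have "integrable lborel (\<lambda>x. F (x + h n *\<^sub>R v))"
      using Fi integrable_distr_eq[of "(+) (h n *\<^sub>R v)" lborel borel F]
      by (simp add: lborel_distr_plus add.commute)
    then show ?thesis using Fi integral_lborel_plus[of F "h n *\<^sub>R v"] by (simp add: X_def)
  qed
  ultimately show ?thesis by (simp add: LIMSEQ_const_iff)
qed

text \<open>The product u w inherits the bounded support of w, so the integral of its derivative
  vanishes; u may live on the whole space.\<close>

lemma integral_by_parts:
  fixes u w :: "'a::euclidean_space \<Rightarrow> complex"
  assumes u: "\<And>x. (u has_derivative u' x) (at x)" "continuous_on UNIV (\<lambda>x. u' x v)"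
    and w: "\<And>x. (w has_derivative w' x) (at x)" "continuous_on UNIV (\<lambda>x. w' x v)"
    and S: "bounded S" "\<And>x. x \<notin> S \<Longrightarrow> w x = 0" "\<And>x. x \<notin> S \<Longrightarrow> w' x v = 0"
  shows "(\<integral>x. u x * w' x v \<partial>lborel) = - (\<integral>x. u' x v * w x \<partial>lborel)"
proof -
  have c: "continuous_on UNIV u" "continuous_on UNIV w"
    using u(1) w(1) by (auto simp: continuous_on_eq_continuous_at intro: has_derivative_continuous)
  have "(\<integral>x. (\<lambda>h. u x * w' x h + u' x h * w x) v \<partial>lborel) = 0"
    by (rule integral_derivative_zero[where F = "\<lambda>x. u x * w x" and S = S])
       (use u w S in \<open>auto intro!: has_derivative_mult continuous_intros c\<close>)
  moreover have "integrable lborel (\<lambda>x. u x * w' x v)" "integrable lborel (\<lambda>x. u' x v * w x)"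
    by (rule integrable_continuous_bounded_support[OF _ S(1)]; use u w S in \<open>auto intro!: continuous_intros c\<close>)+
  ultimately show ?thesis by (simp add: eq_neg_iff_add_eq_0)
qed

subsection \<open>The kernel\<close>

definition phase :: "real \<Rightarrow> real \<Rightarrow> complex" where
  "phase k s = exp (- \<i> * of_real (k * s))"

text \<open>\<open>green1 = green' / s\<close> and \<open>green2 = green1' / s\<close>, so that the second derivatives of
  \<open>green k |x|\<close> are \<open>\<delta>\<^sub>i\<^sub>j green1 + x\<^sub>i x\<^sub>j green2\<close>. At \<open>s = 0\<close> all three take the junk value \<open>0\<close>.\<close>

definition green :: "real \<Rightarrow> real \<Rightarrow> complex" where
  "green k s = (phase k s - 1) / of_real (4 * pi * s)"

definition green1 :: "real \<Rightarrow> real \<Rightarrow> complex" where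
  "green1 k s = (1 - (1 + \<i> * of_real (k * s)) * phase k s) / of_real (4 * pi * s^3)"

definition green2 :: "real \<Rightarrow> real \<Rightarrow> complex" where
  "green2 k s = - (3 * (1 - (1 + \<i> * of_real (k * s)) * phase k s) + of_real ((k * s)^2) * phase k s)
     / of_real (4 * pi * s^5)"

lemma green_deriv:
  assumes "s > 0"
  shows "(green k has_vector_derivative of_real s * green1 k s) (at s)"
proof -
  have "((\<lambda>s. (exp (- \<i> * (of_real k * s)) - 1) / (of_real (4 * pi) * s)) has_field_derivative of_real s * green1 k s) (at (of_real s))"
    using assms by (auto intro!: derivative_eq_intros simp: green1_def phase_def field_simps power3_eq_cube)
  from has_vector_derivative_real_field[OF this] show ?thesis
    by (simp add: green_def[abs_def] phase_def[abs_def])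
qed

lemma green1_deriv:
  assumes "s > 0"
  shows "(green1 k has_vector_derivative of_real s * green2 k s) (at s)"
proof -
  have "((\<lambda>s. (1 - (1 + \<i> * (of_real k * s)) * exp (- \<i> * (of_real k * s))) / (of_real (4 * pi) * s^3))
      has_field_derivative of_real s * green2 k s) (at (of_real s))"
    using assms by (auto intro!: derivative_eq_intros simp: green2_def phase_def field_simps eval_nat_numeral)
  from has_vector_derivative_real_field[OF this] show ?thesis
    by (simp add: green1_def[abs_def] phase_def[abs_def])
qed

lemma continuous_green:
  assumes "s > 0"
  shows "isCont (green k) s" "isCont (green1 k) s" "isCont (green2 k) s"
  using assms unfolding green_def[abs_def] green1_def[abs_def] green2_def[abs_def] phase_def
  by (auto intro!: continuous_intros)

lemma norm_phase [simp]: "norm (phase k s) = 1"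
  by (simp add: phase_def)

text \<open>The first summand of \<open>kernel_inequality\<close> on its own. This quadratic decay
  at s = 0 reduces the singularity of \<open>green1\<close> from order s^-3 to s^-1.\<close>

lemma green_numerator_bound:
  assumes "k \<ge> 0" "s \<ge> 0"
  shows "norm (1 - (1 + \<i> * of_real (k * s)) * phase k s) \<le> 3/4 * (k * s)^2"
proof -
  let ?N = "1 - (1 + \<i> * of_real (k * s)) * phase k s"
  have "4 * (cmod ?N)^2 + 2 * (cmod (?N + of_real ((k * s)^2) * phase k s))^2 \<le> 9/4 * (k * s)^4"
    using kernel_inequality[of "k * s"] assms by (simp add: phase_def)
  then have "4 * (cmod ?N)^2 \<le> 9/4 * (k * s)^4" by (smt (verit) zero_le_power2)
  then have "(cmod ?N)^2 \<le> (3/4 * (k * s)^2)^2" by (simp add: power_mult_distrib power2_eq_square eval_nat_numeral)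
  then show ?thesis by (rule power2_le_imp_le) simp
qed

text \<open>Crude bounds that serve for domination; the sharp estimate is made on the Frobenius
  norm. They also hold at s = 0, where all three left sides are 0 by division by zero.\<close>

lemma green_bounds:
  assumes "k \<ge> 0" "s \<ge> 0"
  shows "norm (green k s) \<le> k" "norm (green1 k s) \<le> k^2 / (4 * s)" "norm (green2 k s) \<le> k^2 / (2 * s^3)"
proof -
  have p: "1 \<le> pi" using pi_gt3 by linarith
  \<comment> \<open>Forms of 3/(16 \<pi>) \<le> 1/4 and 13/(16 \<pi>) \<le> 1/2; the 13/4 below is 3
    * 3/4 + 1.\<close>
  have p': "3 * k^2 \<le> pi * (4 * k^2)" "13 * k^2 \<le> pi * (8 * k^2)"
    using mult_right_mono[of 3 "pi * 4" "k^2"] mult_right_mono[of 13 "pi * 8" "k^2"] pi_gt3 by simp_all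
  let ?N = "1 - (1 + \<i> * of_real (k * s)) * phase k s"
  have N: "norm ?N \<le> 3/4 * (k * s)^2" by (rule green_numerator_bound) fact+
  show "norm (green k s) \<le> k"
  proof (cases "s = 0")
    case False
    have "norm (phase k s - 1) \<le> k * s"
    proof -
      have "norm (phase k s - 1) = 2 * \<bar>sin (- (k * s) / 2)\<bar>"
        using dist_exp_i_1[of "- (k * s)"] by (simp add: phase_def dist_norm)
      also have "\<bar>sin (- (k * s) / 2)\<bar> \<le> \<bar>- (k * s) / 2\<bar>" by (rule abs_sin_x_le_abs_x)
      finally show ?thesis using assms by simp
    qed
    moreover have "norm (green k s) = norm (phase k s - 1) / (4 * pi * s)"
      using assms by (simp add: green_def norm_divide norm_mult)
    ultimately have "norm (green k s) \<le> k * s / (4 * pi * s)"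
      using assms by (metis divide_right_mono mult_nonneg_nonneg pi_ge_zero zero_le_numeral)
    also have "\<dots> = k / (4 * pi)" using False by simp
    also have "\<dots> \<le> k / 1" using assms p by (intro divide_left_mono) auto
    finally show ?thesis by simp
  qed (use assms in \<open>simp add: green_def\<close>)
  show "norm (green1 k s) \<le> k^2 / (4 * s)"
  proof (cases "s = 0")
    case False
    have "norm (green1 k s) = norm ?N / (4 * pi * s^3)"
      using assms by (simp add: green1_def norm_divide norm_mult norm_power)
    also have "\<dots> \<le> (3/4 * (k * s)^2) / (4 * pi * s^3)"
      using assms N by (intro divide_right_mono) auto
    also have "\<dots> = k^2 * 3 / (16 * pi * s)" using False by (simp add: field_simps eval_nat_numeral)
    also have "\<dots> \<le> k^2 / (4 * s)" using False assms p' by (simp add: field_simps)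
    finally show ?thesis .
  qed (simp add: green1_def)
  show "norm (green2 k s) \<le> k^2 / (2 * s^3)"
  proof (cases "s = 0")
    case False
    have "norm (- (3 * ?N + of_real ((k * s)^2) * phase k s)) \<le> norm (3 * ?N) + norm (of_real ((k * s)^2) * phase k s)"
      unfolding norm_minus_cancel by (rule norm_triangle_ineq)
    also have "\<dots> \<le> 13/4 * (k * s)^2" using N unfolding norm_mult norm_of_real norm_phase by simp
    finally have "norm (- (3 * ?N + of_real ((k * s)^2) * phase k s)) / (4 * pi * s^5) \<le> (13/4 * (k * s)^2) / (4 * pi * s^5)"
      using assms by (intro divide_right_mono) auto
    moreover have "norm (green2 k s) = norm (- (3 * ?N + of_real ((k * s)^2) * phase k s)) / (4 * pi * s^5)"
      using assms unfolding green2_def norm_divide norm_of_real by simp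
    ultimately have "norm (green2 k s) \<le> (13/4 * (k * s)^2) / (4 * pi * s^5)" by simp
    also have "\<dots> = k^2 * 13 / (16 * pi * s^3)" using False by (simp add: field_simps eval_nat_numeral)
    also have "\<dots> \<le> k^2 / (2 * s^3)" using False assms p' by (simp add: field_simps)
    finally show ?thesis .
  qed (simp add: green2_def)
qed

definition hess :: "real \<Rightarrow> 3 \<Rightarrow> 3 \<Rightarrow> real^3 \<Rightarrow> complex" where
  "hess k i j x = (if i = j then green1 k (norm x) else 0) + of_real (x $ i * x $ j) * green2 k (norm x)"

text \<open>The matrix of \<open>\<nabla>\<nabla> - \<Delta> = \<nabla>\<times>\<nabla>\<times>\<close> applied to \<open>green k |x|\<close>.\<close>

definition kern :: "real \<Rightarrow> 3 \<Rightarrow> 3 \<Rightarrow> real^3 \<Rightarrow> complex" where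
  "kern k i j x = hess k i j x - (if i = j then \<Sum>l\<in>UNIV. hess k l l x else 0)"

lemma kern_commute: "kern k i j = kern k j i"
  by (auto simp: kern_def hess_def mult.commute fun_eq_iff)

text \<open>In the notation of the proof the matrix is b x x^T - c I. It acts as r^2 b - c = -2 a
  along x and as -c on the orthogonal plane, so its squared Frobenius norm is 4 |a|^2 + 2 |c|^2. Up
  to the factor (4 \<pi> r^3)^-2 this is the left side of \<open>kernel_inequality\<close> at k
  r.\<close>

lemma kern_frobenius:
  assumes "k \<ge> 0"
  shows "(\<Sum>i\<in>UNIV. \<Sum>j\<in>UNIV. (norm (kern k i j x))^2) \<le> 9 * k^4 / (64 * pi^2) * (1 / (norm x)^2)"
proof (cases "x = 0")
  case True
  have "hess k i j 0 = 0" for i j by (auto simp: hess_def green1_def)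
  then have "kern k i j 0 = 0" for i j by (auto simp: kern_def)
  with True show ?thesis by simp
next
  case False
  define r where "r = norm x"
  define a b where "a = green1 k r" and "b = green2 k r"
  define c where "c = 2 * a + of_real (r^2) * b"
  have r: "r > 0" using False by (simp add: r_def)
  have rr: "r^2 = x $ 1 * x $ 1 + x $ 2 * x $ 2 + x $ 3 * x $ 3"
    by (simp add: r_def power2_norm_eq_inner inner_vec_def sum_3)
  have K: "kern k i j x = of_real (x $ i * x $ j) * b - (if i = j then c else 0)" for i j
    by (simp add: kern_def hess_def c_def rr sum_3 algebra_simps a_def b_def r_def[symmetric])
  let ?q = "x $ 1 * x $ 1 + x $ 2 * x $ 2 + x $ 3 * x $ 3"
  have 1: "(\<Sum>i\<in>UNIV. \<Sum>j\<in>UNIV. (norm (kern k i j x))^2) = ?q^2 * ((Re b)^2 + (Im b)^2)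
      - 2 * ?q * (Re b * Re c + Im b * Im c) + 3 * ((Re c)^2 + (Im c)^2)"
    unfolding K sum_3 by (simp add: cmod_power2) (simp add: algebra_simps power2_eq_square)
  have "(\<Sum>i\<in>UNIV. \<Sum>j\<in>UNIV. (norm (kern k i j x))^2) = (r^2)^2 * ((Re b)^2 + (Im b)^2)
      - 2 * r^2 * (Re b * Re c + Im b * Im c) + 3 * ((Re c)^2 + (Im c)^2)"
    unfolding rr by (rule 1)
  also have "\<dots> = 4 * (cmod a)^2 + 2 * (cmod c)^2"
    unfolding cmod_power2 by (simp add: c_def algebra_simps power2_eq_square)
  finally have F: "(\<Sum>i\<in>UNIV. \<Sum>j\<in>UNIV. (norm (kern k i j x))^2) = 4 * (cmod a)^2 + 2 * (cmod c)^2" .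
  define N where "N = 1 - (1 + \<i> * of_real (k * r)) * phase k r"
  have a: "a = N / of_real (4 * pi * r^3)" by (simp add: a_def green1_def N_def)
  have c: "c = - (N + of_real ((k * r)^2) * phase k r) / of_real (4 * pi * r^3)"
  proof -
    have "of_real (r^2) * b = - (3 * N + of_real ((k * r)^2) * phase k r) / of_real (4 * pi * r^3)"
      unfolding b_def green2_def N_def[symmetric] using r by (simp add: field_simps eval_nat_numeral)
    then show ?thesis unfolding c_def a
      by (simp only: times_divide_eq_right add_divide_distrib[symmetric]) simp
  qed
  have "4 * (cmod a)^2 + 2 * (cmod c)^2
      = (4 * (cmod N)^2 + 2 * (cmod (N + of_real ((k * r)^2) * phase k r))^2) / (4 * pi * r^3)^2"
    unfolding a c norm_divide norm_minus_cancel norm_of_real power_divide using r by (simp add: add_divide_distrib)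
  also have "\<dots> \<le> (9/4 * (k * r)^4) / (4 * pi * r^3)^2"
    using kernel_inequality[of "k * r"] assms r unfolding N_def phase_def
    by (intro divide_right_mono) auto
  also have "\<dots> = 9 * k^4 / (64 * pi^2) * (1 / r^2)"
    using r by (simp add: field_simps eval_nat_numeral)
  finally show ?thesis unfolding F r_def .
qed

text \<open>The point x and the scale s are decoupled, so that one bound serves the kernel, with s =
  |x|, and all its regularisations, with s the softened distance.\<close>

lemma hess_bound_aux:
  fixes x :: "real^3"
  assumes "k \<ge> 0" "norm x \<le> s" "s \<ge> 0"
  shows "norm ((if i = j then green1 k s else 0) + of_real (x $ i * x $ j) * green2 k s) \<le> k^2 / s"
proof (cases "s = 0")
  case False
  have "\<bar>x $ i * x $ j\<bar> \<le> s * s"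
    unfolding abs_mult using component_le_norm_cart[of x] assms by (intro mult_mono) (auto intro: order_trans)
  then have "norm (of_real (x $ i * x $ j) * green2 k s) \<le> (s * s) * (k^2 / (2 * s^3))"
    unfolding norm_mult norm_of_real using green_bounds(3)[OF assms(1,3)] by (intro mult_mono) auto
  also have "\<dots> = k^2 / (2 * s)" using False by (simp add: field_simps eval_nat_numeral)
  finally have "norm (of_real (x $ i * x $ j) * green2 k s) \<le> k^2 / (2 * s)" .
  moreover have "norm (if i = j then green1 k s else 0) \<le> k^2 / (2 * s)"
  proof -
    have "k^2 / (4 * s) \<le> k^2 / (2 * s)" using assms False by (intro divide_left_mono) auto
    then show ?thesis using green_bounds(2)[OF assms(1,3)] assms by auto
  qed
  ultimately have "norm ((if i = j then green1 k s else 0) + of_real (x $ i * x $ j) * green2 k s) \<le> k^2 / (2 * s) + k^2 / (2 * s)"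
    by (intro norm_triangle_mono)
  also have "\<dots> = k^2 / s" by simp
  finally show ?thesis .
qed (use assms in \<open>auto simp: green1_def green2_def\<close>)

lemma hess_bound: "k \<ge> 0 \<Longrightarrow> norm (hess k i j x) \<le> k^2 / norm x"
  unfolding hess_def by (rule hess_bound_aux) auto

lemma borel_measurable_green [measurable]:
  "green k \<in> borel_measurable borel" "green1 k \<in> borel_measurable borel" "green2 k \<in> borel_measurable borel"
  unfolding green_def[abs_def] green1_def[abs_def] green2_def[abs_def] phase_def
  by measurable

lemma borel_measurable_hess [measurable]: "hess k i j \<in> borel_measurable borel"
  unfolding hess_def[abs_def] by measurable

lemma borel_measurable_kern [measurable]: "kern k i j \<in> borel_measurable borel"
  unfolding kern_def[abs_def] by measurable

subsection \<open>Second derivatives of the potential\<close>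

definition soft_dist :: "real \<Rightarrow> real^3 \<Rightarrow> real^3 \<Rightarrow> real" where
  "soft_dist \<epsilon> y x = sqrt ((x - y) \<bullet> (x - y) + \<epsilon>^2)"

lemma soft_dist_pos: "\<epsilon> > 0 \<Longrightarrow> soft_dist \<epsilon> y x > 0"
  by (simp add: soft_dist_def add_nonneg_pos)

lemma norm_le_soft_dist: "norm (x - y) \<le> soft_dist \<epsilon> y x"
  by (simp add: soft_dist_def norm_eq_sqrt_inner)

lemma continuous_soft_dist [continuous_intros]: "continuous_on UNIV (soft_dist \<epsilon> y)"
  unfolding soft_dist_def[abs_def] by (intro continuous_intros)

text \<open>The gradient of the softened distance s is (x - y) / s, and the factor s in the
  derivative of \<open>A\<close> cancels its denominator. Hence the regularised profile has
  derivatives built from the same \<open>green1\<close> and \<open>green2\<close>, evaluated at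
  s.\<close>

lemma soft_dist_comp_deriv:
  fixes A :: "real \<Rightarrow> complex"
  assumes "\<epsilon> > 0" and A: "\<And>s. s > 0 \<Longrightarrow> (A has_vector_derivative of_real s * A' s) (at s)"
  shows "((\<lambda>x. A (soft_dist \<epsilon> y x)) has_derivative (\<lambda>h. of_real ((x - y) \<bullet> h) * A' (soft_dist \<epsilon> y x))) (at x)"
proof -
  have p: "soft_dist \<epsilon> y x > 0" "(x - y) \<bullet> (x - y) + \<epsilon>^2 > 0"
    using assms by (auto intro: soft_dist_pos add_nonneg_pos)
  have "(soft_dist \<epsilon> y has_derivative (\<lambda>h. ((x - y) \<bullet> h) / soft_dist \<epsilon> y x)) (at x)"
    unfolding soft_dist_def[abs_def] using p
    by (auto intro!: derivative_eq_intros simp: field_simps inner_commute)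
  from has_derivative_compose[OF this A[OF p(1), unfolded has_vector_derivative_def]]
  show ?thesis using p by (simp add: scaleR_conv_of_real)
qed

lemma frechet_derivative_off_support:
  assumes "closed S" "\<And>x. x \<notin> S \<Longrightarrow> f x = 0" "x \<notin> S"
  shows "frechet_derivative f (at x) v = 0"
proof (rule frechet_derivative_eq)
  show "(f has_derivative (\<lambda>_. 0)) (at x)"
    by (rule has_derivative_transform_within_open[of "\<lambda>_. 0" _ _ _ "- S"]) (use assms in \<open>auto simp: open_Compl\<close>)
qed

lemma partial_deriv_eq: "partial_deriv i f = (\<lambda>x. frechet_derivative f (at x) (axis i 1))"
  by (auto simp: partial_deriv_def)

lemma smooth_partial_deriv: "smooth_on f UNIV \<Longrightarrow> smooth_on (partial_deriv i f) UNIV"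
  unfolding partial_deriv_eq by (rule smooth_on_UNIV_D)

lemma continuous_comp_soft_dist:
  assumes "\<epsilon> > 0" "\<And>s. s > 0 \<Longrightarrow> isCont A s"
  shows "continuous_on UNIV (\<lambda>x. A (soft_dist \<epsilon> y x))"
proof -
  have "continuous_on {0<..} A" using assms(2) by (auto intro: continuous_at_imp_continuous_on)
  then show ?thesis
    by (rule continuous_on_compose2[OF _ continuous_soft_dist]) (use soft_dist_pos[OF assms(1)] in auto)
qed

text \<open>Each derivative is moved by one integration by parts, so the two signs cancel. The
  softened distance never vanishes, which makes the profile differentiable at x = y as well.\<close>

lemma hess_by_parts_regularised:
  fixes f :: "real^3 \<Rightarrow> complex"
  assumes f: "smooth_on f UNIV" and S: "compact S" "\<And>x. x \<notin> S \<Longrightarrow> f x = 0" and e: "\<epsilon> > 0"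
  shows "(\<integral>x. green k (soft_dist \<epsilon> y x) * partial_deriv i (partial_deriv j f) x \<partial>lborel) =
    (\<integral>x. ((if i = j then green1 k (soft_dist \<epsilon> y x) else 0)
        + of_real ((x - y) $ i * (x - y) $ j) * green2 k (soft_dist \<epsilon> y x)) * f x \<partial>lborel)"
proof -
  let ?s = "soft_dist \<epsilon> y"
  let ?f = "partial_deriv j f"
  have S': "closed S" "bounded S" using S(1) by (auto simp: compact_eq_bounded_closed)
  have f1: "smooth_on ?f UNIV" by (rule smooth_partial_deriv[OF f])
  have off: "?f x = 0" if "x \<notin> S" for x
    using frechet_derivative_off_support[OF S'(1) S(2) that] by (simp add: partial_deriv_eq)
  have off2: "frechet_derivative ?f (at x) v = 0" "frechet_derivative f (at x) v = 0" if "x \<notin> S" for x v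
    using frechet_derivative_off_support[OF S'(1) off that] frechet_derivative_off_support[OF S'(1) S(2) that] by auto
  have D: "(g has_derivative frechet_derivative g (at x)) (at x)" "continuous_on UNIV (\<lambda>x. frechet_derivative g (at x) v)"
    if "smooth_on g UNIV" for g :: "real^3 \<Rightarrow> complex" and x v
    using smooth_on_UNIV_D[OF that] smooth_on_UNIV_D(2)[OF smooth_on_UNIV_D(3)[OF that]]
    by (auto simp: frechet_derivative_works)
  have c: "continuous_on UNIV (\<lambda>x. green1 k (?s x))" "continuous_on UNIV (\<lambda>x. green2 k (?s x))"
    by (rule continuous_comp_soft_dist[OF e], rule continuous_green, assumption)+
  have "(\<integral>x. green k (?s x) * frechet_derivative ?f (at x) (axis i 1) \<partial>lborel) =
     - (\<integral>x. of_real ((x - y) \<bullet> axis i 1) * green1 k (?s x) * ?f x \<partial>lborel)"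
    by (rule integral_by_parts[where S = S and u' = "\<lambda>x h. of_real ((x - y) \<bullet> h) * green1 k (?s x)"])
       (use e S' off off2 D[OF f1] in \<open>auto intro!: soft_dist_comp_deriv green_deriv continuous_intros c\<close>)
  also have "(\<integral>x. of_real ((x - y) \<bullet> axis i 1) * green1 k (?s x) * ?f x \<partial>lborel) =
      (\<integral>x. (of_real ((x - y) $ i) * green1 k (?s x)) * frechet_derivative f (at x) (axis j 1) \<partial>lborel)"
    by (simp add: partial_deriv_eq inner_axis)
  also have "\<dots> = - (\<integral>x. (of_real ((x - y) $ i) * (of_real ((x - y) \<bullet> axis j 1) * green2 k (?s x))
       + of_real (axis j 1 $ i) * green1 k (?s x)) * f x \<partial>lborel)"
  proof (rule integral_by_parts[where S = S and u' = "\<lambda>x h. of_real ((x - y) $ i) * (of_real ((x - y) \<bullet> h) * green2 k (?s x))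
       + of_real (h $ i) * green1 k (?s x)"])
    fix x
    have l: "((\<lambda>x. complex_of_real ((x - y) $ i)) has_derivative (\<lambda>h. of_real (h $ i))) (at x)"
      by (auto intro!: derivative_eq_intros bounded_linear.has_derivative[OF bounded_linear_of_real] bounded_linear.has_derivative[OF bounded_linear_vec_nth])
    show "((\<lambda>x. of_real ((x - y) $ i) * green1 k (?s x)) has_derivative
      (\<lambda>h. of_real ((x - y) $ i) * (of_real ((x - y) \<bullet> h) * green2 k (?s x))
       + of_real (h $ i) * green1 k (?s x))) (at x)"
      by (rule has_derivative_mult[OF l soft_dist_comp_deriv[OF e green1_deriv]])
  qed (use S S' off2 D[OF f] in \<open>auto intro!: continuous_intros c\<close>)
  finally have "(\<integral>x. green k (?s x) * partial_deriv i ?f x \<partial>lborel) =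
    (\<integral>x. (of_real ((x - y) $ i) * (of_real ((x - y) \<bullet> axis j 1) * green2 k (?s x))
       + of_real (axis j 1 $ i) * green1 k (?s x)) * f x \<partial>lborel)"
    by (simp add: partial_deriv_eq)
  also have "\<dots> = (\<integral>x. ((if i = j then green1 k (?s x) else 0)
        + of_real ((x - y) $ i * (x - y) $ j) * green2 k (?s x)) * f x \<partial>lborel)"
  proof -
    have ax: "axis j (1 :: real) $ i = (if i = j then 1 else 0)" by (simp add: axis_def)
    have inn: "(x - y) \<bullet> axis j 1 = (x - y) $ j" for x by (simp add: inner_axis)
    show ?thesis unfolding ax inn
      by (intro Bochner_Integration.integral_cong) (auto simp: algebra_simps)
  qed
  finally show ?thesis .
qed

lemma nn_integral_inverse_square_finite:
  fixes y :: "real^3"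
  assumes "bounded A" "A \<in> sets lborel"
  shows "(\<integral>\<^sup>+x. ennreal (1 / (norm (y - x))^2) * indicator A x \<partial>lborel) < \<infinity>"
proof -
  have "emeasure lborel A < \<infinity>" using assms by (intro emeasure_bounded_finite)
  then have "ennreal (1 / 1^2) * emeasure lborel A + ennreal (8 * pi * 1 / 3) < \<infinity>" by simp
  with riesz_potential_le[OF assms(2), of 1 y] show ?thesis using order_le_less_trans by force
qed

lemma integrable_inverse_norm:
  fixes y :: "real^3"
  shows "integrable lborel (\<lambda>x. 1 / norm (x - y) * indicator (cball 0 R) x)"
proof (rule integrableI_bounded)
  have [measurable]: "cball 0 R \<in> sets (borel :: (real^3) measure)" by simp
  show "(\<lambda>x. 1 / norm (x - y) * indicator (cball 0 R) x) \<in> borel_measurable lborel" by measurable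
  have "(\<integral>\<^sup>+x. ennreal (norm (1 / norm (x - y) * indicator (cball 0 R) x)) \<partial>lborel)
    \<le> (\<integral>\<^sup>+x. indicator (cball 0 R) x + ennreal (1 / (norm (y - x))^2) * indicator (cball 0 R) x \<partial>lborel)"
  proof (rule nn_integral_mono)
    fix x
    have "1 / t \<le> 1 + 1 / t^2" for t :: real
      using zero_le_power2[of "1 / t - 1 / 2"] by (simp add: power2_eq_square algebra_simps)
    then have "1 / norm (x - y) \<le> 1 + 1 / (norm (y - x))^2"
      by (cases "x = y") (auto simp: norm_minus_commute)
    then have "ennreal (1 / norm (x - y)) \<le> ennreal (1 + 1 / (norm (y - x))^2)" by (rule ennreal_leI)
    also have "\<dots> = 1 + ennreal (1 / (norm (y - x))^2)" by (subst ennreal_plus) auto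
    finally show "ennreal (norm (1 / norm (x - y) * indicator (cball 0 R) x))
      \<le> indicator (cball 0 R) x + ennreal (1 / (norm (y - x))^2) * indicator (cball 0 R) x"
      by (auto split: split_indicator)
  qed
  also have "\<dots> = emeasure lborel (cball (0 :: real^3) R) + (\<integral>\<^sup>+x. ennreal (1 / (norm (y - x))^2) * indicator (cball 0 R) x \<partial>lborel)"
    by (subst nn_integral_add) auto
  also have "\<dots> < \<infinity>"
    using nn_integral_inverse_square_finite[of "cball 0 R" y] emeasure_lborel_cball_finite[of "0 :: real^3" R] by simp
  finally show "(\<integral>\<^sup>+x. ennreal (norm (1 / norm (x - y) * indicator (cball 0 R) x)) \<partial>lborel) < \<infinity>" .
qed

lemma continuous_bounded_support_bound:
  fixes f :: "'a::euclidean_space \<Rightarrow> 'b::real_normed_vector"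
  assumes c: "continuous_on UNIV f" and "compact S" "\<And>x. x \<notin> S \<Longrightarrow> f x = 0"
  obtains M R where "M \<ge> 0" "\<And>x. norm (f x) \<le> M * indicator (cball 0 R) x"
proof -
  obtain R where R: "S \<subseteq> cball 0 R" 
    using \<open>compact S\<close> by (meson compact_imp_bounded bounded_subset_ballD ball_subset_cball order_trans)
  have "compact (f ` S)"
    by (intro compact_continuous_image continuous_on_subset[OF c] assms) auto
  then obtain M where M: "\<And>x. x \<in> S \<Longrightarrow> norm (f x) \<le> M"
    using compact_imp_bounded bounded_iff by (metis imageI)
  have "norm (f x) \<le> \<bar>M\<bar> * indicator (cball 0 R) x" for x
    using M[of x] R assms(3)[of x] by (cases "x \<in> S") (auto simp: indicator_def)
  then show thesis using that[of "\<bar>M\<bar>" R] by auto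
qed

lemma integrable_hess_mult:
  fixes f :: "real^3 \<Rightarrow> complex"
  assumes k: "k \<ge> 0" and c: "continuous_on UNIV f" and S: "compact S" "\<And>x. x \<notin> S \<Longrightarrow> f x = 0"
  shows "integrable lborel (\<lambda>x. hess k i j (x - y) * f x)"
proof -
  obtain M R where M: "M \<ge> 0" "\<And>x. norm (f x) \<le> M * indicator (cball 0 R) x"
    using continuous_bounded_support_bound[OF c S] by metis
  have [measurable]: "f \<in> borel_measurable borel" using c by (rule borel_measurable_continuous_onI)
  show ?thesis
  proof (rule Bochner_Integration.integrable_bound)
    show "integrable lborel (\<lambda>x. k^2 * M * (1 / norm (x - y) * indicator (cball 0 R) x))"
      by (intro integrable_mult_right integrable_inverse_norm)
    show "AE x in lborel. norm (hess k i j (x - y) * f x) \<le> norm (k^2 * M * (1 / norm (x - y) * indicator (cball 0 R) x))"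
    proof (rule AE_I2)
      fix x
      have "norm (hess k i j (x - y) * f x) \<le> (k^2 / norm (x - y)) * (M * indicator (cball 0 R) x)"
        unfolding norm_mult using M(2) by (intro mult_mono hess_bound k) auto
      then show "norm (hess k i j (x - y) * f x) \<le> norm (k^2 * M * (1 / norm (x - y) * indicator (cball 0 R) x))"
        using M(1) by (simp add: abs_mult)
    qed
  qed measurable
qed

text \<open>Both sides of the regularised identity converge by dominated convergence. Since |x - y|
  \<le> \<open>s n x\<close>, the Hessian terms are dominated by a multiple of 1 / |x - y| on a
  ball, uniformly in n; this integrable majorant is why no delta term survives.\<close>

lemma hess_distributional:
  fixes f :: "real^3 \<Rightarrow> complex"
  assumes k: "k \<ge> 0" and f: "smooth_on f UNIV" and S: "compact S" "\<And>x. x \<notin> S \<Longrightarrow> f x = 0"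
  shows "(\<integral>x. green k (norm (x - y)) * partial_deriv i (partial_deriv j f) x \<partial>lborel) =
    (\<integral>x. hess k i j (x - y) * f x \<partial>lborel)"
proof -
  define e where "e n = 1 / real (Suc n)" for n
  have e: "e n > 0" for n by (simp add: e_def)
  have e0: "e \<longlonglongrightarrow> 0" unfolding e_def using LIMSEQ_inverse_real_of_nat by (simp add: divide_inverse)
  define s where "s n x = soft_dist (e n) y x" for n x
  have s: "s n x > 0" "norm (x - y) \<le> s n x" for n x
    using soft_dist_pos[OF e] norm_le_soft_dist by (auto simp: s_def)
  have slim: "(\<lambda>n. s n x) \<longlonglongrightarrow> norm (x - y)" for x
  proof -
    have "(\<lambda>n. s n x) \<longlonglongrightarrow> sqrt ((x - y) \<bullet> (x - y) + 0^2)"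
      unfolding s_def soft_dist_def by (intro tendsto_intros e0)
    then show ?thesis by (simp add: norm_eq_sqrt_inner)
  qed
  have [measurable]: "s n \<in> borel_measurable borel" for n
    unfolding s_def by (intro borel_measurable_continuous_onI continuous_soft_dist)
  have [measurable]: "(\<lambda>x. (x - y) $ l) \<in> borel_measurable borel" for l
    by (intro borel_measurable_continuous_onI continuous_intros)
  let ?f = "partial_deriv j f"
  let ?f2 = "partial_deriv i ?f"
  have S': "closed S" "bounded S" using S(1) by (auto simp: compact_eq_bounded_closed)
  have off: "?f x = 0" if "x \<notin> S" for x
    using frechet_derivative_off_support[OF S'(1) S(2) that] by (simp add: partial_deriv_eq)
  have off2: "?f2 x = 0" if "x \<notin> S" for x
    using frechet_derivative_off_support[OF S'(1) off that] by (simp add: partial_deriv_eq)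
  have cf: "continuous_on UNIV f" "continuous_on UNIV ?f2"
    using f by (auto intro!: smooth_on_UNIV_D(2) smooth_partial_deriv)
  have [measurable]: "f \<in> borel_measurable borel" "?f2 \<in> borel_measurable borel"
    using cf by (auto intro: borel_measurable_continuous_onI)
  have ae: "AE x in lborel. x \<noteq> y" by (rule AE_lborel_singleton)
  obtain M R where M: "M \<ge> 0" "\<And>x. norm (f x) \<le> M * indicator (cball 0 R) x"
    using continuous_bounded_support_bound[OF cf(1) S] by metis
  define u where "u n x = ((if i = j then green1 k (s n x) else 0)
        + of_real ((x - y) $ i * (x - y) $ j) * green2 k (s n x)) * f x" for n x
  have cts: "(\<lambda>n. A (s n x)) \<longlonglongrightarrow> A (norm (x - y))" if "x \<noteq> y" "\<And>s. s > 0 \<Longrightarrow> isCont A s" for A :: "real \<Rightarrow> complex" and x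
    using that by (intro isCont_tendsto_compose[OF _ slim]) auto
  have "(\<lambda>n. \<integral>x. green k (s n x) * ?f2 x \<partial>lborel) \<longlonglongrightarrow> (\<integral>x. green k (norm (x - y)) * ?f2 x \<partial>lborel)"
  proof (rule integral_dominated_convergence[where w = "\<lambda>x. k * norm (?f2 x)"])
    show "integrable lborel (\<lambda>x. k * norm (?f2 x))"
      using integrable_continuous_bounded_support[OF cf(2) S'(2) off2] by auto
    show "AE x in lborel. (\<lambda>n. green k (s n x) * ?f2 x) \<longlonglongrightarrow> green k (norm (x - y)) * ?f2 x"
      using ae by eventually_elim (intro tendsto_mult cts tendsto_const continuous_green)
    show "AE x in lborel. norm (green k (s n x) * ?f2 x) \<le> k * norm (?f2 x)" for n
      unfolding norm_mult using s(1)[of n] by (intro AE_I2 mult_right_mono green_bounds k) (auto intro: less_imp_le)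
  qed measurable
  moreover have "(\<lambda>n. \<integral>x. u n x \<partial>lborel) \<longlonglongrightarrow> (\<integral>x. hess k i j (x - y) * f x \<partial>lborel)"
  proof (rule integral_dominated_convergence[where w = "\<lambda>x. k^2 * M * (1 / norm (x - y) * indicator (cball 0 R) x)"])
    show "integrable lborel (\<lambda>x. k^2 * M * (1 / norm (x - y) * indicator (cball 0 R) x))"
      by (intro integrable_mult_right integrable_inverse_norm)
    show "AE x in lborel. (\<lambda>n. u n x) \<longlonglongrightarrow> hess k i j (x - y) * f x"
      using ae
    proof eventually_elim
      case (elim x)
      have "isCont (\<lambda>a. ((if i = j then green1 k a else 0) + of_real ((x - y) $ i * (x - y) $ j) * green2 k a) * f x) a"
        if "a > 0" for a
        using continuous_green[OF that, of k] by (cases "i = j") (auto intro!: continuous_intros)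
      from cts[OF elim this] show ?case unfolding u_def hess_def .
    qed
    show "AE x in lborel. norm (u n x) \<le> k^2 * M * (1 / norm (x - y) * indicator (cball 0 R) x)" for n
      using ae
    proof eventually_elim
      case (elim x)
      have "norm (u n x) \<le> (k^2 / s n x) * (M * indicator (cball 0 R) x)"
        unfolding u_def norm_mult using hess_bound_aux[OF k s(2) less_imp_le[OF s(1)]] M(2) s(1)[of n x] k
        by (intro mult_mono) auto
      also have "\<dots> \<le> (k^2 / norm (x - y)) * (M * indicator (cball 0 R) x)"
        using s[where n = n and x = x] elim M(1) by (intro mult_right_mono divide_left_mono) auto
      finally show ?case by (simp add: mult_ac)
    qed
  qed (unfold u_def, measurable)
  moreover have "(\<integral>x. green k (s n x) * ?f2 x \<partial>lborel) = (\<integral>x. u n x \<partial>lborel)" for n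
    unfolding s_def u_def using hess_by_parts_regularised[OF f S e] by simp
  ultimately show ?thesis by (simp add: LIMSEQ_unique)
qed

subsection \<open>Bump functions and the fundamental lemma\<close>

lemma C_diff_on_const: "C_diff_on n (\<lambda>_. c) UNIV"
proof (induction n arbitrary: c)
  case (Suc n)
  have "frechet_derivative (\<lambda>_. c) (at x) v = 0" for x v by (rule frechet_derivative_eq) simp
  then show ?case using Suc by simp
qed simp

lemma C_diff_on_add:
  "\<lbrakk>C_diff_on n f UNIV; C_diff_on n g UNIV\<rbrakk> \<Longrightarrow> C_diff_on n (\<lambda>x. f x + g x) UNIV"
proof (induction n arbitrary: f g)
  case (Suc n)
  then have d: "f differentiable (at x)" "g differentiable (at x)" for x by simp_all
  have "frechet_derivative (\<lambda>x. f x + g x) (at x) v = frechet_derivative f (at x) v + frechet_derivative g (at x) v" for x v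
    by (rule frechet_derivative_eq) (intro has_derivative_add d[unfolded frechet_derivative_works])
  then show ?case using Suc d by simp
qed (simp add: continuous_on_add)

lemma C_diff_on_mult:
  fixes f g :: "'a::real_normed_vector \<Rightarrow> real"
  shows "\<lbrakk>C_diff_on n f UNIV; C_diff_on n g UNIV\<rbrakk> \<Longrightarrow> C_diff_on n (\<lambda>x. f x * g x) UNIV"
proof (induction n arbitrary: f g)
  case (Suc n)
  then have d: "f differentiable (at x)" "g differentiable (at x)" for x by simp_all
  have D: "frechet_derivative (\<lambda>x. f x * g x) (at x) v = f x * frechet_derivative g (at x) v + frechet_derivative f (at x) v * g x" for x v
    by (rule frechet_derivative_eq) (intro has_derivative_mult d[unfolded frechet_derivative_works])
  \<comment> \<open>The product rule leaves one factor undifferentiated, so its order of smoothness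
    has to be lowered to match the other.\<close>
  have "C_diff_on n f UNIV" "C_diff_on n g UNIV" using Suc.prems C_diff_on_Suc_imp by blast+
  then have "C_diff_on n (\<lambda>x. f x * frechet_derivative g (at x) v + frechet_derivative f (at x) v * g x) UNIV" for v
    using Suc.prems by (intro C_diff_on_add Suc.IH) auto
  then show ?case using d by (simp add: D)
qed (simp add: continuous_on_mult)

lemma smooth_on_mult:
  fixes f g :: "'a::real_normed_vector \<Rightarrow> real"
  shows "\<lbrakk>smooth_on f UNIV; smooth_on g UNIV\<rbrakk> \<Longrightarrow> smooth_on (\<lambda>x. f x * g x) UNIV"
  by (simp add: smooth_on_def C_diff_on_mult)

lemma smooth_on_prod:
  fixes f :: "'b \<Rightarrow> 'a::real_normed_vector \<Rightarrow> real"
  assumes "\<And>i. i \<in> I \<Longrightarrow> smooth_on (f i) UNIV"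
  shows "smooth_on (\<lambda>x. \<Prod>i\<in>I. f i x) UNIV"
  using assms
proof (induction I rule: infinite_finite_induct)
  case (insert i I)
  then show ?case by (simp add: smooth_on_mult)
qed (auto simp: smooth_on_def C_diff_on_const)

text \<open>These functions are closed under differentiation, and vanish to infinite order at \<open>0\<close>.\<close>

definition flat :: "real \<Rightarrow> real poly \<Rightarrow> real \<Rightarrow> real" where
  "flat c p t = (if t > 0 then poly p (1 / t) * exp (- c / t) else 0)"

lemma poly_times_exp_tendsto_0:
  fixes c :: real
  assumes "c > 0"
  shows "((\<lambda>u. poly p u * exp (- c * u)) \<longlongrightarrow> 0) at_top"
proof -
  \<comment> \<open>The extra power is needed for the induction: splitting off the constant
    coefficient leaves a factor u in front of the remaining polynomial.\<close>
  have "((\<lambda>u. u ^ k * poly p u * exp (- c * u)) \<longlongrightarrow> 0) at_top" for k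
  proof (induction p arbitrary: k)
    case (pCons a p)
    have "filterlim (\<lambda>u. c * u) at_top at_top"
      by (rule filterlim_tendsto_pos_mult_at_top[where f = "\<lambda>_. c" and c = c])
        (use assms in \<open>auto intro: filterlim_ident\<close>)
    from filterlim_compose[OF tendsto_power_div_exp_0 this]
    have "((\<lambda>u. a / c ^ k * ((c * u) ^ k / exp (c * u))) \<longlongrightarrow> a / c ^ k * 0) at_top"
      by (intro tendsto_mult tendsto_const)
    also have "(\<lambda>u. a / c ^ k * ((c * u) ^ k / exp (c * u))) = (\<lambda>u. a * u ^ k * exp (- c * u))"
      using assms by (simp add: fun_eq_iff power_mult_distrib exp_minus field_simps)
    finally have "((\<lambda>u. a * u ^ k * exp (- c * u) + u ^ Suc k * poly p u * exp (- c * u)) \<longlongrightarrow> 0 + 0) at_top"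
      using pCons(2)[of "Suc k"] by (intro tendsto_add) simp_all
    then show ?case by (simp add: algebra_simps)
  qed simp
  from this[of 0] show ?thesis by simp
qed

text \<open>For t > 0, differentiating p(1/t) exp(-c/t) multiplies the exponential by (c p -
  p')(1/t) / t^2, again a polynomial in 1/t. At 0 the right difference quotient becomes a polynomial
  times exp(-c u) under u = 1/h, and the left one is 0.\<close>

lemma flat_deriv:
  assumes "c > 0"
  shows "(flat c p has_real_derivative flat c ([:0, 0, c:] * p - [:0, 0, 1:] * pderiv p) t) (at t)"
proof (cases t "0::real" rule: linorder_cases)
  case less
  have "((\<lambda>_. 0) has_real_derivative 0) (at t)" by simp
  then have "(flat c p has_real_derivative 0) (at t)"
    by (rule has_field_derivative_transform_within_open[where S = "{..<0}"]) (use less in \<open>auto simp: flat_def\<close>)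
  then show ?thesis using less by (simp add: flat_def)
next
  case greater
  have "((\<lambda>t. poly p (1 / t) * exp (- c / t)) has_real_derivative
      flat c ([:0, 0, c:] * p - [:0, 0, 1:] * pderiv p) t) (at t)"
    using greater by (auto intro!: derivative_eq_intros DERIV_chain2[OF poly_DERIV] simp: flat_def field_simps power2_eq_square)
  then show ?thesis
    by (rule has_field_derivative_transform_within_open[where S = "{0<..}"]) (use greater in \<open>auto simp: flat_def\<close>)
next
  case equal
  have "((\<lambda>h. flat c p h / h) \<longlongrightarrow> 0) (at 0)"
  proof (rule filterlim_split_at)
    show "((\<lambda>h. flat c p h / h) \<longlongrightarrow> 0) (at_left 0)"
      by (rule tendsto_eventually) (auto simp: eventually_at_filter flat_def)
    have "((\<lambda>h. poly ([:0, 1:] * p) (inverse h) * exp (- c * inverse h)) \<longlongrightarrow> 0) (at_right 0)"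
      by (rule filterlim_compose[OF poly_times_exp_tendsto_0[OF assms] filterlim_inverse_at_top_right])
    then show "((\<lambda>h. flat c p h / h) \<longlongrightarrow> 0) (at_right 0)"
      by (rule Lim_transform_eventually) (auto simp: eventually_at_filter flat_def field_simps)
  qed
  then show ?thesis using equal by (simp add: DERIV_def flat_def)
qed

text \<open>The affine substitution covers both faces of a box, x_i - a_i and b_i - x_i. Arbitrary
  polynomials let the induction close, since each derivative has the same form up to a constant
  factor.\<close>

lemma flat_C_diff:
  assumes "c > 0"
  shows "C_diff_on n (\<lambda>x :: real^'n. flat c p (a * x $ i + b)) UNIV"
proof (induction n arbitrary: p)
  case 0
  have "isCont (flat c p) t" for t using flat_deriv[OF assms] by (rule DERIV_isCont)
  then have "continuous_on UNIV (flat c p)" by (simp add: continuous_at_imp_continuous_on)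
  then show ?case by (auto intro!: continuous_on_compose2[of UNIV "flat c p"] continuous_intros)
next
  case (Suc n)
  let ?q = "[:0, 0, c:] * p - [:0, 0, 1:] * pderiv p"
  have D: "((\<lambda>x :: real^'n. flat c p (a * x $ i + b)) has_derivative (\<lambda>v. (a * v $ i) * flat c ?q (a * x $ i + b))) (at x)" for x
  proof -
    have "((\<lambda>x :: real^'n. a * x $ i + b) has_derivative (\<lambda>v. a * v $ i)) (at x)"
      by (auto intro!: derivative_eq_intros bounded_linear.has_derivative[OF bounded_linear_vec_nth])
    from has_derivative_compose[OF this flat_deriv[OF assms, unfolded has_field_derivative_def]]
    show ?thesis by (simp add: mult.commute)
  qed
  have "C_diff_on n (\<lambda>x :: real^'n. (a * v $ i) * flat c ?q (a * x $ i + b)) UNIV" for v :: "real^'n"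
    by (rule C_diff_on_linear_image[OF bounded_linear_mult_right Suc.IH])
  then show ?case using D frechet_derivative_eq[OF D] unfolding C_diff_on.simps differentiable_def by auto
qed

text \<open>Positive exactly on the open box. The parameter \<open>c\<close> is there to be sent to
  0: every factor then tends to 1 inside the box, and the indicator of the box arises as a bounded
  limit.\<close>

definition bump :: "real \<Rightarrow> real^'n \<Rightarrow> real^'n \<Rightarrow> real^'n \<Rightarrow> real" where
  "bump c a b x = (\<Prod>i\<in>UNIV. flat c 1 (x $ i - a $ i) * flat c 1 (b $ i - x $ i))"

lemma smooth_bump: "c > 0 \<Longrightarrow> smooth_on (bump c a b) UNIV"
proof -
  assume c: "c > 0"
  have "smooth_on (\<lambda>x. flat c 1 (x $ i - a $ i)) UNIV" for i
    using flat_C_diff[OF c, of _ 1 1 i "- a $ i"] by (simp add: smooth_on_def)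
  moreover have "smooth_on (\<lambda>x. flat c 1 (b $ i - x $ i)) UNIV" for i
    using flat_C_diff[OF c, of _ 1 "-1" i "b $ i"] by (simp add: smooth_on_def)
  ultimately show ?thesis unfolding bump_def[abs_def] by (intro smooth_on_prod smooth_on_mult)
qed

lemma bump_outside: "x \<notin> box a b \<Longrightarrow> bump c a b x = 0"
  by (force simp: bump_def mem_box_cart flat_def intro!: prod_zero)

lemma bump_bounds: "c > 0 \<Longrightarrow> \<bar>bump c a b x\<bar> \<le> 1"
  unfolding bump_def abs_prod by (intro prod_le_1) (auto simp: flat_def abs_mult intro!: mult_le_one)

lemma bump_tendsto:
  fixes a b x :: "real^'n"
  shows "(\<lambda>n. bump (1 / real (Suc n)) a b x) \<longlonglongrightarrow> indicator (box a b) x"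
proof (cases "x \<in> box a b")
  case True
  have "(\<lambda>n. exp (- (1 / real (Suc n)) / t)) \<longlonglongrightarrow> exp (- 0 / t)" if "t \<noteq> 0" for t :: real
    using LIMSEQ_inverse_real_of_nat that unfolding divide_inverse[of 1] mult_1 by (intro tendsto_intros tendsto_minus) auto
  then have *: "(\<lambda>n. flat (1 / real (Suc n)) 1 t) \<longlonglongrightarrow> 1" if "t > 0" for t
    using that by (simp add: flat_def)
  have "(\<lambda>n. bump (1 / real (Suc n)) a b x) \<longlonglongrightarrow> (\<Prod>i\<in>(UNIV :: 'n set). 1 * 1)"
    unfolding bump_def using True by (intro tendsto_prod tendsto_mult *) (auto simp: mem_box_cart)
  then show ?thesis using True by simp
qed (simp add: bump_outside)

lemma bump_test_field:
  assumes "c > 0" "cbox a b \<subseteq> V"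
  shows "(\<lambda>x. axis j (of_real (bump c a b x))) \<in> test_fields V"
proof -
  have ax: "axis j (complex_of_real r) = r *\<^sub>R axis j 1" for r and j :: 3
    by (auto simp: vec_eq_iff axis_def complex_eq_iff)
  have sub: "closure {x. axis j (complex_of_real (bump c a b x)) \<noteq> 0} \<subseteq> cbox a b"
  proof (rule closure_minimal)
    show "{x. axis j (complex_of_real (bump c a b x)) \<noteq> 0} \<subseteq> cbox a b"
      using bump_outside box_subset_cbox by (fastforce simp: ax)
  qed auto
  moreover have "compact (closure {x. axis j (complex_of_real (bump c a b x)) \<noteq> 0})"
    using sub by (meson bounded_cbox bounded_subset closed_closure compact_eq_bounded_closed)
  moreover have "smooth_on (\<lambda>x. axis j (complex_of_real (bump c a b x))) UNIV"
    unfolding ax by (rule smooth_on_linear_image[OF bounded_linear_scaleR_left smooth_bump[OF assms(1)]])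
  ultimately show ?thesis using assms(2) by (auto simp: test_fields_def)
qed

section \<open>From vanishing box integrals to vanishing almost everywhere\<close>

lemma sigma_finite_lebesgue: "sigma_finite_measure (lebesgue :: 'a::euclidean_space measure)"
proof -
  obtain A :: "'a set set" where A: "countable A" "A \<subseteq> sets lborel" "\<Union>A = space lborel"
      "\<forall>a\<in>A. emeasure lborel a \<noteq> \<infinity>"
    using lborel.sigma_finite_countable by metis
  have *: "a \<in> sets lebesgue" "emeasure lebesgue a = emeasure lborel a" if "a \<in> A" for a
    using subsetD[OF A(2) that] by (simp_all add: sets_completionI_sets)
  show ?thesis
    by (rule sigma_finite_measure.intro, rule exI[of _ A])
       (use A(1) A(3,4) * in \<open>simp add: subset_iff\<close>)
qed

text \<open>Boxes are closed under intersection and generate the Borel sets, and the sets with zero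
  integral form a Dynkin system; \<open>tot\<close> supplies the whole space, which is not a box.
  Lebesgue sets differ from Borel sets by null sets.\<close>

lemma AE_zero_if_box_integrals_zero:
  fixes g :: "'a::euclidean_space \<Rightarrow> 'b::{banach, second_countable_topology}"
  assumes g: "integrable lebesgue g" and tot: "(\<integral>x. g x \<partial>lebesgue) = 0"
    and box: "\<And>l u. (LINT x:box l u|lebesgue. g x) = 0"
  shows "AE x in lebesgue. g x = 0"
proof -
  have si: "set_integrable lebesgue A g" if "A \<in> sets lebesgue" for A
    using g that by (simp add: set_integrable_def integrable_mult_indicator)
  have leb: "A \<in> sets lebesgue" if "A \<in> sets borel" for A :: "'a set"
    using that by (simp add: sets_completionI_sets)
  have borel: "(LINT x:A|lebesgue. g x) = 0" if "A \<in> sets borel" for A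
  proof -
    have "Int_stable (range (\<lambda>(a, b). box a b :: 'a set))"
      by (auto simp: Int_stable_def box_Int_box)
    moreover have "range (\<lambda>(a, b). box a b :: 'a set) \<subseteq> Pow UNIV" by auto
    moreover have "A \<in> sigma_sets UNIV (range (\<lambda>(a, b). box a b))"
      using that by (simp add: borel_eq_box)
    ultimately show ?thesis
    proof (induction rule: sigma_sets_induct_disjoint)
      case (basic A)
      then show ?case using box by auto
    next
      case empty
      show ?case by (simp add: set_lebesgue_integral_def)
    next
      case (compl A)
      then have A: "A \<in> sets lebesgue" using leb by (simp add: borel_eq_box)
      have "(LINT x:A \<union> (UNIV - A)|lebesgue. g x) = (LINT x:A|lebesgue. g x) + (LINT x:UNIV - A|lebesgue. g x)"
        using A by (intro set_integral_Un si) auto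
      moreover have "A \<union> (UNIV - A) = UNIV" by auto
      ultimately show ?case using compl tot by (simp add: set_lebesgue_integral_def)
    next
      case (union A)
      then have "A i \<in> sigma_sets UNIV (range (\<lambda>(a, b). box a b))" for i by blast
      then have A: "A i \<in> sets lebesgue" for i using leb by (simp add: borel_eq_box)
      have "(LINT x:(\<Union>i. A i)|lebesgue. g x) = (\<Sum>i. (LINT x:A i|lebesgue. g x))"
        using union A by (intro lebesgue_integral_countable_add si) (auto simp: disjoint_family_on_def)
      then show ?case using union by simp
    qed
  qed
  have "set_lebesgue_integral lebesgue A g = set_lebesgue_integral lebesgue A (\<lambda>_. 0)" if A: "A \<in> sets lebesgue" for A
  proof -
    obtain S N N' where S: "A = S \<union> N" "N \<subseteq> N'" "N' \<in> null_sets lborel" "S \<in> sets lborel"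
      using A by (rule sets_completionE)
    have "AE x in lebesgue. x \<notin> N'" using S(3) by (intro AE_not_in) (simp add: null_sets_completionI)
    then have "AE x in lebesgue. indicator A x *\<^sub>R g x = indicator S x *\<^sub>R g x"
      by eventually_elim (use S in \<open>auto simp: indicator_def\<close>)
    then have "set_lebesgue_integral lebesgue A g = set_lebesgue_integral lebesgue S g"
      unfolding set_lebesgue_integral_def
      using si[OF A] si[OF leb[of S]] S(4) by (intro integral_cong_AE) (auto simp: set_integrable_def)
    also have "\<dots> = 0" using S(4) by (intro borel) simp
    finally show ?thesis by (simp add: set_lebesgue_integral_def)
  qed
  then show ?thesis by (intro sigma_finite_measure.density_unique_banach[OF sigma_finite_lebesgue] g) auto
qed

text \<open>Letting c tend to 0 replaces the bumps by indicators of boxes whose closure lies in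
  \<open>V\<close>. A countable cover of \<open>V\<close> by closed boxes then localises the
  claim.\<close>

lemma fundamental_lemma:
  fixes g :: "real^'n \<Rightarrow> complex"
  assumes V: "open V" and g: "integrable (lebesgue_on V) g"
    and zero: "\<And>c a b. c > 0 \<Longrightarrow> cbox a b \<subseteq> V \<Longrightarrow> (LINT x|lebesgue_on V. g x * of_real (bump c a b x)) = 0"
  shows "AE x in lebesgue_on V. g x = 0"
proof -
  have VL: "V \<in> sets lebesgue" using V by auto
  have [measurable]: "bump c a b \<in> borel_measurable (lebesgue_on V)" if "c > 0" for c a b
  proof -
    have "bump c a b \<in> borel_measurable borel"
      by (rule borel_measurable_continuous_onI[OF smooth_on_UNIV_D(2)[OF smooth_bump[OF that]]])
    then show ?thesis by (simp add: measurable_completion measurable_restrict_space1)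
  qed
  have box: "(LINT x|lebesgue_on V. indicator (box a b) x *\<^sub>R g x) = 0" if ab: "cbox a b \<subseteq> V" for a b
  proof -
    have "(\<lambda>n. LINT x|lebesgue_on V. g x * of_real (bump (1 / real (Suc n)) a b x)) \<longlonglongrightarrow>
        (LINT x|lebesgue_on V. g x * of_real (indicator (box a b) x))"
    proof (rule integral_dominated_convergence[where w = "\<lambda>x. norm (g x)"])
      show "AE x in lebesgue_on V. (\<lambda>n. g x * of_real (bump (1 / real (Suc n)) a b x)) \<longlonglongrightarrow> g x * of_real (indicator (box a b) x)"
        by (intro AE_I2 tendsto_mult tendsto_const tendsto_of_real bump_tendsto)
      show "AE x in lebesgue_on V. norm (g x * of_real (bump (1 / real (Suc n)) a b x)) \<le> norm (g x)" for n
      proof (rule AE_I2)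
        fix x
        have "norm (g x * of_real (bump (1 / real (Suc n)) a b x)) \<le> norm (g x) * 1"
          unfolding norm_mult norm_of_real using bump_bounds[of "1 / real (Suc n)" a b x]
          by (intro mult_left_mono) auto
        then show "norm (g x * of_real (bump (1 / real (Suc n)) a b x)) \<le> norm (g x)" by simp
      qed
      have "(indicator (box a b) :: _ \<Rightarrow> real) \<in> borel_measurable (borel :: (real^'n) measure)" by simp
      then have "(indicator (box a b) :: _ \<Rightarrow> real) \<in> borel_measurable (lebesgue_on V)"
        by (intro measurable_restrict_space1 measurable_completion) simp
      then show "(\<lambda>x. g x * complex_of_real (indicator (box a b) x)) \<in> borel_measurable (lebesgue_on V)"
        using g by (intro borel_measurable_times borel_measurable_of_real) auto
      show "(\<lambda>x. g x * complex_of_real (bump (1 / real (Suc n)) a b x)) \<in> borel_measurable (lebesgue_on V)" for n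
        using g by (intro borel_measurable_times borel_measurable_of_real) auto
    qed (use g in auto)
    then show ?thesis using zero[OF _ ab] by (simp add: LIMSEQ_const_iff scaleR_conv_of_real mult.commute)
  qed
  obtain D where D: "countable D" "\<And>X. X \<in> D \<Longrightarrow> \<exists>a b. X = cbox a b" "\<Union>D = V"
    using open_countable_Union_open_cbox[OF V] by metis
  have cb: "AE x in lebesgue. x \<in> X \<longrightarrow> g x = 0" if "X \<in> D" for X
  proof -
    obtain a b where X: "X = cbox a b" using D(2)[OF \<open>X \<in> D\<close>] by auto
    have XV: "cbox a b \<subseteq> V" using D(3) that X by auto
    have bV: "box a b \<subseteq> V" using XV box_subset_cbox by blast
    have gi: "integrable lebesgue (\<lambda>x. indicator V x *\<^sub>R g x)"
      using g VL by (simp add: integrable_restrict_space)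
    have eq: "indicator (box a b) x *\<^sub>R g x = indicator (box a b) x *\<^sub>R (indicator V x *\<^sub>R g x)" for x
      using bV by (auto simp: indicator_def)
    have i: "integrable lebesgue (\<lambda>x. indicator (box a b) x *\<^sub>R g x)"
      unfolding eq by (intro integrable_mult_indicator gi) simp
    have LI: "(\<integral>x. indicator (box l u) x *\<^sub>R g x \<partial>lebesgue) = 0" if "cbox l u \<subseteq> V" for l u
    proof -
      have eq': "indicator V x *\<^sub>R indicator (box l u) x *\<^sub>R g x = indicator (box l u) x *\<^sub>R g x" for x
        using that box_subset_cbox by (fastforce simp: indicator_def)
      have "(\<integral>x. indicator V x *\<^sub>R indicator (box l u) x *\<^sub>R g x \<partial>lebesgue) = 0"
        using box[OF that] VL by (simp add: integral_restrict_space del: scaleR_scaleR)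
      then show ?thesis unfolding eq' .
    qed
    have "AE x in lebesgue. indicator (box a b) x *\<^sub>R g x = 0"
    proof (rule AE_zero_if_box_integrals_zero[OF i LI[OF XV]])
      fix l u :: "real^'n"
      \<comment> \<open>Restricting g to a box keeps the class of test boxes stable: any box meets
        \<open>box a b\<close> in a box that is empty or has its closure in
        \<open>V\<close>.\<close>
      obtain a' b' where ab: "box l u \<inter> box a b = box a' b'"
        unfolding box_Int_box by blast
      have "cbox a' b' \<subseteq> V" if "box a' b' \<noteq> {}"
        using ab XV closure_box[OF that] closure_mono[of "box a' b'" "box a b"] closure_box[of a b]
        by (metis Int_empty_right closure_mono inf_le2 order_trans that)
      then have "(\<integral>x. indicator (box a' b') x *\<^sub>R g x \<partial>lebesgue) = 0"
        by (cases "box a' b' = {}") (auto intro: LI)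
      then show "(LINT x:box l u|lebesgue. indicator (box a b) x *\<^sub>R g x) = 0"
        unfolding set_lebesgue_integral_def ab[symmetric] by (simp add: indicator_inter_arith)
    qed
    moreover have "AE x in lebesgue. x \<notin> cbox a b - box a b"
      by (intro AE_not_in) (simp add: negligible_iff_null_sets[symmetric] negligible_frontier_interval)
    ultimately show ?thesis unfolding X by eventually_elim (auto simp: indicator_def)
  qed
  have "AE x in lebesgue. \<forall>X\<in>D. x \<in> X \<longrightarrow> g x = 0"
    unfolding AE_ball_countable[OF D(1)] using cb by blast
  then show ?thesis using VL D(3) by (subst AE_restrict_space_iff) (auto elim!: eventually_mono)
qed

subsection \<open>The integral operator\<close>

lemma measurable_id_lebesgue_on: "(\<lambda>x. x) \<in> lebesgue_on V \<rightarrow>\<^sub>M borel"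
  by (intro measurable_restrict_space1 measurable_completion) simp

lemma borel_measurable_lebesgue_on: "f \<in> borel_measurable borel \<Longrightarrow> f \<in> borel_measurable (lebesgue_on V)"
  by (rule measurable_compose[OF measurable_id_lebesgue_on])

lemma measurable_vec_nth_complex [measurable (raw)]:
  fixes f :: "'a \<Rightarrow> complex^3"
  assumes "f \<in> borel_measurable M"
  shows "(\<lambda>x. f x $ i) \<in> borel_measurable M"
  by (rule measurable_compose[OF assms borel_measurable_continuous_onI]) (intro continuous_intros)

lemma borel_measurable_vecI:
  fixes f :: "'a \<Rightarrow> complex^3"
  assumes "\<And>i. (\<lambda>x. f x $ i) \<in> borel_measurable M"
  shows "f \<in> borel_measurable M"
  unfolding borel_measurable_euclidean_space[of f]
  using assms by (auto simp: Basis_vec_def inner_axis)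

lemma borel_measurable_cnj [measurable (raw)]:
  assumes "f \<in> borel_measurable M"
  shows "(\<lambda>x. cnj (f x)) \<in> borel_measurable M"
  by (rule measurable_compose[OF assms borel_measurable_continuous_onI]) (intro continuous_intros)

lemma norm_vec_sq: "(norm (x :: complex^3))^2 = (\<Sum>i\<in>UNIV. (norm (x $ i))^2)"
  by (simp add: norm_vec_def L2_set_def sum_nonneg)

lemma norm_mult_le_sum_squares: "norm (a * b :: complex) \<le> (norm a)^2 + (norm b)^2"
proof -
  have "2 * (norm a * norm b) \<le> (norm a)^2 + (norm b)^2"
    using sum_squares_bound[of "norm a" "norm b"] by simp
  then show ?thesis by (simp add: norm_mult) (smt (verit) mult_nonneg_nonneg norm_ge_zero)
qed

lemma integrable_mult_L2:
  fixes f g :: "'a \<Rightarrow> complex"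
  assumes [measurable]: "f \<in> borel_measurable M" "g \<in> borel_measurable M"
    and "integrable M (\<lambda>x. (norm (f x))^2)" "integrable M (\<lambda>x. (norm (g x))^2)"
  shows "integrable M (\<lambda>x. f x * g x)"
  by (rule Bochner_Integration.integrable_bound[OF Bochner_Integration.integrable_add[OF assms(3,4)]])
     (auto intro!: AE_I2 order_trans[OF norm_mult_le_sum_squares])

section \<open>The double curl of a test field against the scalar profile\<close>

lemma partial_deriv_diff:
  assumes "smooth_on f UNIV" "smooth_on g UNIV"
  shows "partial_deriv i (\<lambda>y. f y - g y) x = partial_deriv i f x - partial_deriv i g x"
  unfolding partial_deriv_eq
  by (rule frechet_derivative_eq)
     (intro has_derivative_diff assms[THEN smooth_on_UNIV_D(1), unfolded frechet_derivative_works])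

lemma smooth_on_vec_nth:
  fixes \<phi> :: field3
  shows "smooth_on \<phi> UNIV \<Longrightarrow> smooth_on (\<lambda>x. \<phi> x $ i) UNIV"
  by (rule smooth_on_linear_image[OF bounded_linear_vec_nth])

lemma curl_nth:
  "curl F x $ 1 = partial_deriv 2 (\<lambda>y. F y $ 3) x - partial_deriv 3 (\<lambda>y. F y $ 2) x"
  "curl F x $ 2 = partial_deriv 3 (\<lambda>y. F y $ 1) x - partial_deriv 1 (\<lambda>y. F y $ 3) x"
  "curl F x $ 3 = partial_deriv 1 (\<lambda>y. F y $ 2) x - partial_deriv 2 (\<lambda>y. F y $ 1) x"
  by (simp_all add: curl_def)

lemma curl_curl_nth:
  fixes \<phi> :: field3
  assumes "smooth_on \<phi> UNIV"
  defines "P \<equiv> \<lambda>i j l. partial_deriv i (partial_deriv j (\<lambda>y. \<phi> y $ l))"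
  shows "curl (curl \<phi>) x $ 1 = P 2 1 2 x - P 2 2 1 x - (P 3 3 1 x - P 3 1 3 x)"
    "curl (curl \<phi>) x $ 2 = P 3 2 3 x - P 3 3 2 x - (P 1 1 2 x - P 1 2 1 x)"
    "curl (curl \<phi>) x $ 3 = P 1 3 1 x - P 1 1 3 x - (P 2 2 3 x - P 2 3 2 x)"
proof -
  have s: "smooth_on (partial_deriv j (\<lambda>y. \<phi> y $ l)) UNIV" for j l
    by (intro smooth_partial_deriv smooth_on_vec_nth assms)
  show "curl (curl \<phi>) x $ 1 = P 2 1 2 x - P 2 2 1 x - (P 3 3 1 x - P 3 1 3 x)"
    "curl (curl \<phi>) x $ 2 = P 3 2 3 x - P 3 3 2 x - (P 1 1 2 x - P 1 2 1 x)"
    "curl (curl \<phi>) x $ 3 = P 1 3 1 x - P 1 1 3 x - (P 2 2 3 x - P 2 3 2 x)"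
    by (simp_all only: curl_nth partial_deriv_diff[OF s s] P_def)
qed

lemma second_partial_support:
  fixes f :: "real^3 \<Rightarrow> complex"
  assumes f: "smooth_on f UNIV" and S: "compact S" "\<And>x. x \<notin> S \<Longrightarrow> f x = 0"
  shows "continuous_on UNIV (partial_deriv i (partial_deriv j f))"
    "x \<notin> S \<Longrightarrow> partial_deriv i (partial_deriv j f) x = 0"
proof -
  show "continuous_on UNIV (partial_deriv i (partial_deriv j f))"
    by (intro smooth_on_UNIV_D(2) smooth_partial_deriv f)
  have S': "closed S" using S(1) by (rule compact_imp_closed)
  have "partial_deriv j f x = 0" if "x \<notin> S" for x
    using frechet_derivative_off_support[OF S' S(2) that] by (simp add: partial_deriv_eq)
  from frechet_derivative_off_support[OF S' this]
  show "x \<notin> S \<Longrightarrow> partial_deriv i (partial_deriv j f) x = 0" by (simp add: partial_deriv_eq)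
qed

lemma curl_curl_support:
  fixes \<phi> :: field3
  assumes f: "smooth_on \<phi> UNIV" and S: "compact S" "\<And>x. x \<notin> S \<Longrightarrow> \<phi> x = 0"
  shows "continuous_on UNIV (\<lambda>x. curl (curl \<phi>) x $ i)" "x \<notin> S \<Longrightarrow> curl (curl \<phi>) x $ i = 0"
proof -
  have z: "\<phi> x $ l = 0" if "x \<notin> S" for x l using S(2)[OF that] by simp
  note P = second_partial_support[OF smooth_on_vec_nth[OF f] S(1) z]
  show "continuous_on UNIV (\<lambda>x. curl (curl \<phi>) x $ i)"
    using exhaust_3[of i] by (elim disjE; simp only: curl_curl_nth[OF f]; intro continuous_intros P)
  show "x \<notin> S \<Longrightarrow> curl (curl \<phi>) x $ i = 0"
    using exhaust_3[of i] by (elim disjE) (simp_all add: curl_curl_nth[OF f] P)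
qed

lemma curl_curl_distributional:
  fixes \<phi> :: field3
  assumes k: "k \<ge> 0" and f: "smooth_on \<phi> UNIV" and S: "compact S" "\<And>x. x \<notin> S \<Longrightarrow> \<phi> x = 0"
  shows "(\<integral>x. green k (norm (x - y)) * curl (curl \<phi>) x $ i \<partial>lborel) =
    (\<Sum>j\<in>UNIV. \<integral>x. kern k i j (x - y) * \<phi> x $ j \<partial>lborel)"
proof -
  have z: "\<phi> x $ l = 0" if "x \<notin> S" for x l using S(2)[OF that] by simp
  note P = second_partial_support[OF smooth_on_vec_nth[OF f] S(1) z]
  have D: "(\<integral>x. green k (norm (x - y)) * partial_deriv i (partial_deriv j (\<lambda>x. \<phi> x $ l)) x \<partial>lborel) =
    (\<integral>x. hess k i j (x - y) * \<phi> x $ l \<partial>lborel)" for i j l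
    by (rule hess_distributional[OF k smooth_on_vec_nth[OF f] S(1) z])
  have gi: "integrable lborel (\<lambda>x. green k (norm (x - y)) * partial_deriv i (partial_deriv j (\<lambda>x. \<phi> x $ l)) x)" for i j l
  proof (rule Bochner_Integration.integrable_bound)
    have [measurable]: "partial_deriv i (partial_deriv j (\<lambda>x. \<phi> x $ l)) \<in> borel_measurable borel"
      by (rule borel_measurable_continuous_onI[OF P(1)])
    show "(\<lambda>x. green k (norm (x - y)) * partial_deriv i (partial_deriv j (\<lambda>x. \<phi> x $ l)) x) \<in> borel_measurable lborel"
      by measurable
    show "integrable lborel (\<lambda>x. k *\<^sub>R partial_deriv i (partial_deriv j (\<lambda>x. \<phi> x $ l)) x)"
      by (intro integrable_scaleR_right integrable_continuous_bounded_support[OF P(1) compact_imp_bounded[OF S(1)] P(2)])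
    show "AE x in lborel. norm (green k (norm (x - y)) * partial_deriv i (partial_deriv j (\<lambda>x. \<phi> x $ l)) x)
        \<le> norm (k *\<^sub>R partial_deriv i (partial_deriv j (\<lambda>x. \<phi> x $ l)) x)"
      using k by (intro AE_I2) (auto simp: norm_mult intro!: mult_right_mono green_bounds)
  qed
  have hi: "integrable lborel (\<lambda>x. hess k i j (x - y) * \<phi> x $ l)" for i j l
    by (rule integrable_hess_mult[OF k smooth_on_UNIV_D(2)[OF smooth_on_vec_nth[OF f]] S(1) z])
  \<comment> \<open>In component i of curl curl \<phi> the second derivative of \<phi>_i in
    direction i cancels. This matches \<open>kern k i i\<close>, which is minus the sum of the two
    other diagonal entries of \<open>hess\<close>.\<close>
  have kd: "(\<integral>x. kern k 1 1 (x - y) * \<phi> x $ 1 \<partial>lborel) = - (\<integral>x. hess k 2 2 (x - y) * \<phi> x $ 1 \<partial>lborel) - (\<integral>x. hess k 3 3 (x - y) * \<phi> x $ 1 \<partial>lborel)"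
    "(\<integral>x. kern k 2 2 (x - y) * \<phi> x $ 2 \<partial>lborel) = - (\<integral>x. hess k 1 1 (x - y) * \<phi> x $ 2 \<partial>lborel) - (\<integral>x. hess k 3 3 (x - y) * \<phi> x $ 2 \<partial>lborel)"
    "(\<integral>x. kern k 3 3 (x - y) * \<phi> x $ 3 \<partial>lborel) = - (\<integral>x. hess k 1 1 (x - y) * \<phi> x $ 3 \<partial>lborel) - (\<integral>x. hess k 2 2 (x - y) * \<phi> x $ 3 \<partial>lborel)"
    unfolding Bochner_Integration.integral_minus[symmetric]
    by (subst Bochner_Integration.integral_diff[symmetric]; (intro Bochner_Integration.integrable_minus hi)?;
        simp add: kern_def sum_3 algebra_simps)+
  have ko: "(\<integral>x. kern k i j (x - y) * \<phi> x $ j \<partial>lborel) = (\<integral>x. hess k i j (x - y) * \<phi> x $ j \<partial>lborel)" if "i \<noteq> j" for i j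
    using that by (simp add: kern_def)
  \<comment> \<open>Two curls produce mixed partials in both orders; the symmetry of
    \<open>hess\<close> matches them with the index order of \<open>kern\<close>.\<close>
  have hs: "hess k i j = hess k j i" for i j by (auto simp: hess_def mult.commute fun_eq_iff)
  show ?thesis
    using exhaust_3[of i]
    by (elim disjE) (simp_all add: curl_curl_nth[OF f] right_diff_distrib Bochner_Integration.integral_diff Bochner_Integration.integrable_diff gi D sum_3 ko kd hs[of 2 1] hs[of 3 1] hs[of 3 2])
qed

section \<open>Square-integrable fields on a bounded open set\<close>

context
  fixes V :: "(real^3) set"
  assumes V: "open V" "bounded V"
begin

abbreviation (input) W :: "(real^3) measure" where "W \<equiv> lebesgue_on V"

lemmas [measurable] = measurable_id_lebesgue_on[of V]

lemma V_sets: "V \<in> sets lebesgue" "V \<in> sets lborel"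
  using V by auto

lemma nn_integral_W:
  assumes "f \<in> borel_measurable borel"
  shows "(\<integral>\<^sup>+x. f x \<partial>W) = (\<integral>\<^sup>+x. f x * indicator V x \<partial>lborel)"
  using V_sets by (simp add: nn_integral_restrict_space nn_integral_completion)

lemma emeasure_W: "emeasure W (space W) = emeasure lborel V" "emeasure lborel V < \<infinity>"
proof -
  show "emeasure lborel V < \<infinity>" by (rule emeasure_bounded_finite[OF V(2)])
  show "emeasure W (space W) = emeasure lborel V"
    using V_sets by (simp add: emeasure_restrict_space)
qed

lemma finite_measure_W: "finite_measure W"
  by (rule finite_measureI) (use emeasure_W in auto)

interpretation W: finite_measure W by (rule finite_measure_W)
interpretation WW: pair_sigma_finite W W ..

text \<open>The last two facts use that a bounded \<open>V\<close> has finite measure: t \<le> 1 +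
  t^2 then embeds L^2 into L^1.\<close>

lemma L2_fields_D:
  assumes "F \<in> L2_fields V"
  shows "F \<in> borel_measurable W" "integrable W (\<lambda>x. (norm (F x))^2)"
    "(\<lambda>x. F x $ i) \<in> borel_measurable W" "integrable W (\<lambda>x. (norm (F x $ i))^2)" "integrable W (\<lambda>x. F x $ i)"
    "integrable W F"
proof -
  show [measurable]: "F \<in> borel_measurable W" and i: "integrable W (\<lambda>x. (norm (F x))^2)"
    using assms by (auto simp: L2_fields_def)
  show "(\<lambda>x. F x $ i) \<in> borel_measurable W" by measurable
  show "integrable W (\<lambda>x. (norm (F x $ i))^2)"
    by (rule Bochner_Integration.integrable_bound[OF i])
       (auto intro!: AE_I2 power_mono Finite_Cartesian_Product.norm_nth_le)
  have le: "t \<le> 1 + t^2" for t :: real using zero_le_power2[of "t - 1/2"] by (simp add: power2_eq_square algebra_simps)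
  show *: "integrable W F"
    by (rule Bochner_Integration.integrable_bound[OF Bochner_Integration.integrable_add[OF W.integrable_const[of 1] i]])
       (auto intro!: AE_I2 le)
  show "integrable W (\<lambda>x. F x $ i)"
    by (rule Bochner_Integration.integrable_bound[OF *]) (auto intro!: AE_I2 Finite_Cartesian_Product.norm_nth_le)
qed

lemma L2_fieldsI:
  assumes "\<And>i. (\<lambda>x. F x $ i) \<in> borel_measurable W" "\<And>i. integrable W (\<lambda>x. (norm (F x $ i))^2)"
  shows "F \<in> L2_fields V"
  unfolding L2_fields_def norm_vec_sq using assms by (auto intro!: borel_measurable_vecI)

lemma L2_fields_diff:
  assumes "F \<in> L2_fields V" "G \<in> L2_fields V"
  shows "(\<lambda>x. F x - G x) \<in> L2_fields V"
proof (rule L2_fieldsI)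
  note [measurable] = L2_fields_D(3)[OF assms(1)] L2_fields_D(3)[OF assms(2)]
  fix i
  show "(\<lambda>x. (F x - G x) $ i) \<in> borel_measurable W" by simp
  show "integrable W (\<lambda>x. (norm ((F x - G x) $ i))^2)"
  proof (rule Bochner_Integration.integrable_bound)
    show "integrable W (\<lambda>x. 2 * ((norm (F x $ i))^2 + (norm (G x $ i))^2))"
      using L2_fields_D(4)[OF assms(1)] L2_fields_D(4)[OF assms(2)] by simp
    have "(norm (a - b))^2 \<le> 2 * ((norm a)^2 + (norm b)^2)" for a b :: complex
    proof -
      have "(norm (a - b))^2 \<le> (norm a + norm b)^2" by (intro power_mono norm_triangle_ineq4) auto
      also have "\<dots> \<le> 2 * ((norm a)^2 + (norm b)^2)"
        using sum_squares_bound[of "norm a" "norm b"] by (simp add: power2_sum)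
      finally show ?thesis .
    qed
    then show "AE x in W. norm ((norm ((F x - G x) $ i))^2) \<le> norm (2 * ((norm (F x $ i))^2 + (norm (G x $ i))^2))"
      by (intro AE_I2) (simp add: abs_of_nonneg)
  qed simp
qed

lemma L2_fields_scale:
  assumes "F \<in> L2_fields V"
  shows "(\<lambda>x. c *s F x) \<in> L2_fields V"
  using L2_fields_D(3,4)[OF assms] by (intro L2_fieldsI) (auto simp: norm_mult power_mult_distrib)

lemma L2_fields_diff_sum:
  assumes "finite B" "F \<in> L2_fields V" "B \<subseteq> L2_fields V"
  shows "(\<lambda>x. F x - (\<Sum>e\<in>B. d e *s e x)) \<in> L2_fields V"
  using assms
proof (induction B)
  case (insert e B)
  then have "(\<lambda>x. (F x - (\<Sum>e\<in>B. d e *s e x)) - d e *s e x) \<in> L2_fields V"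
    by (intro L2_fields_diff[OF insert.IH] L2_fields_scale) auto
  moreover have eq: "F x - (\<Sum>e\<in>insert e B. d e *s e x) = (F x - (\<Sum>e\<in>B. d e *s e x)) - d e *s e x" for x
    using insert(1,2) by (simp add: diff_diff_eq add.commute)
  ultimately show ?case unfolding eq by blast
qed simp

lemma L2_inner_integrable:
  assumes "F \<in> L2_fields V" "G \<in> L2_fields V"
  shows "integrable W (\<lambda>x. \<Sum>i\<in>UNIV. F x $ i * cnj (G x $ i))"
  by (intro Bochner_Integration.integrable_sum integrable_mult_L2)
     (use L2_fields_D[OF assms(1)] L2_fields_D[OF assms(2)] in \<open>auto\<close>)

lemma L2_inner_commute: "L2_inner V F G = cnj (L2_inner V G F)"
  unfolding L2_inner_def Bochner_Integration.integral_cnj[symmetric]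
  by (simp add: mult.commute del: Bochner_Integration.integral_cnj)

lemma L2_inner_diff_sum:
  assumes "finite B" "F \<in> L2_fields V" "B \<subseteq> L2_fields V" "G \<in> L2_fields V"
  shows "L2_inner V (\<lambda>x. F x - (\<Sum>e\<in>B. d e *s e x)) G = L2_inner V F G - (\<Sum>e\<in>B. d e * L2_inner V e G)"
proof -
  have "L2_inner V (\<lambda>x. F x - (\<Sum>e\<in>B. d e *s e x)) G =
    (LINT x|W. (\<Sum>i\<in>UNIV. F x $ i * cnj (G x $ i)) - (\<Sum>e\<in>B. d e * (\<Sum>i\<in>UNIV. e x $ i * cnj (G x $ i))))"
    unfolding L2_inner_def
    by (intro Bochner_Integration.integral_cong)
       (simp_all add: sum_distrib_right sum_distrib_left left_diff_distrib sum_subtractf mult.assoc sum.swap[of _ B])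
  also have "\<dots> = L2_inner V F G - (\<Sum>e\<in>B. d e * L2_inner V e G)"
  proof -
    have i: "integrable W (\<lambda>x. \<Sum>i\<in>UNIV. F x $ i * cnj (G x $ i))"
      "\<And>e. e \<in> B \<Longrightarrow> integrable W (\<lambda>x. d e * (\<Sum>i\<in>UNIV. e x $ i * cnj (G x $ i)))"
      by (intro L2_inner_integrable integrable_mult_right; use assms(2-4) in blast)+
    show ?thesis
      unfolding L2_inner_def
      by (simp only: Bochner_Integration.integral_diff[OF i(1) Bochner_Integration.integrable_sum[OF i(2)]]
          Bochner_Integration.integral_sum[OF i(2)] integral_mult_right_zero)
  qed
  finally show ?thesis .
qed

lemma L2_inner_self: "L2_inner V F F = of_real (LINT x|W. (norm (F x))^2)"
  unfolding L2_inner_def norm_vec_sq integral_complex_of_real[symmetric]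
  by (simp only: of_real_sum complex_norm_square)

lemma L2_norm_sq: "(L2_norm V F)^2 = (LINT x|W. (norm (F x))^2)"
  by (simp add: L2_norm_def)

text \<open>The residual \<open>D\<close> of \<open>F\<close> after subtracting its projection is
  orthogonal to \<open>B\<close>, so its squared norm equals the difference of the two
  sides.\<close>

lemma bessel:
  assumes B: "finite B" "B \<subseteq> L2_fields V" and F: "F \<in> L2_fields V"
    and on: "\<And>e f. e \<in> B \<Longrightarrow> f \<in> B \<Longrightarrow> L2_inner V e f = (if e = f then 1 else 0)"
  shows "(\<Sum>e\<in>B. (norm (L2_inner V F e))^2) \<le> (LINT x|W. (norm (F x))^2)"
proof -
  define d where "d e = L2_inner V F e" for e
  define D where "D x = F x - (\<Sum>e\<in>B. d e *s e x)" for x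
  have D: "D \<in> L2_fields V" unfolding D_def by (rule L2_fields_diff_sum[OF B(1) F B(2)])
  have inn: "L2_inner V D G = L2_inner V F G - (\<Sum>e\<in>B. d e * L2_inner V e G)" if "G \<in> L2_fields V" for G
    unfolding D_def using L2_inner_diff_sum[OF B(1) F B(2) that] .
  have "L2_inner V D f = 0" if "f \<in> B" for f
  proof -
    have "(\<Sum>e\<in>B. d e * L2_inner V e f) = (\<Sum>e\<in>B. if e = f then d e else 0)"
      using on that by (intro sum.cong) auto
    also have "\<dots> = d f" using B(1) that by simp
    finally show ?thesis using inn[of f] that B(2) by (auto simp: d_def)
  qed
  then have "L2_inner V f D = 0" if "f \<in> B" for f
    using L2_inner_commute[of f D] that by simp
  then have "L2_inner V D D = L2_inner V F D" using inn[OF D] by simp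
  also have "\<dots> = cnj (L2_inner V D F)" by (rule L2_inner_commute)
  also have "\<dots> = cnj (L2_inner V F F) - (\<Sum>e\<in>B. cnj (d e) * d e)"
  proof -
    have "L2_inner V e F = cnj (d e)" for e unfolding d_def by (rule L2_inner_commute)
    then show ?thesis unfolding inn[OF F] by (simp add: mult.commute)
  qed
  also have "(\<Sum>e\<in>B. cnj (d e) * d e) = of_real (\<Sum>e\<in>B. (norm (d e))^2)"
    by (simp only: of_real_sum complex_norm_square mult.commute)
  finally have "(LINT x|W. (norm (D x))^2) = (LINT x|W. (norm (F x))^2) - (\<Sum>e\<in>B. (norm (d e))^2)"
    unfolding L2_inner_self complex_cnj_complex_of_real of_real_diff[symmetric] of_real_eq_iff .
  moreover have "(LINT x|W. (norm (D x))^2) \<ge> 0" by (rule integral_nonneg_AE) auto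
  ultimately show ?thesis by (simp add: d_def)
qed

section \<open>The convolution operator and its mapping properties\<close>

definition gamma_kernel_op :: "real \<Rightarrow> field3 \<Rightarrow> field3" where
  "gamma_kernel_op k E r = (\<chi> j. LINT r'|W. (\<Sum>i\<in>UNIV. kern k j i (r - r') * E r' $ i))"

lemma riesz_potential_bound:
  "(\<integral>\<^sup>+x. ennreal (1 / (norm (y - x))^2) \<partial>W) \<le> emeasure lborel V + ennreal (8 * pi / 3)"
proof -
  have "(\<integral>\<^sup>+x. ennreal (1 / (norm (y - x))^2) \<partial>W) = (\<integral>\<^sup>+x. ennreal (1 / (norm (y - x))^2) * indicator V x \<partial>lborel)"
    by (rule nn_integral_W) measurable
  also have "\<dots> \<le> emeasure lborel V + ennreal (8 * pi / 3)"
    using riesz_potential_le[OF V_sets(2), of 1 y] by simp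
  finally show ?thesis .
qed

lemma kern_sq_bound: "k \<ge> 0 \<Longrightarrow> (norm (kern k i j x))^2 \<le> 9 * k^4 / (64 * pi^2) * (1 / (norm x)^2)"
proof -
  assume k: "k \<ge> 0"
  have "(norm (kern k i j x))^2 \<le> (\<Sum>j\<in>UNIV. (norm (kern k i j x))^2)"
    by (rule member_le_sum) auto
  also have "\<dots> \<le> (\<Sum>i\<in>UNIV. \<Sum>j\<in>UNIV. (norm (kern k i j x))^2)"
    by (rule member_le_sum[where f = "\<lambda>i. \<Sum>j\<in>UNIV. (norm (kern k i j x))^2"]) (auto intro: sum_nonneg)
  also have "\<dots> \<le> 9 * k^4 / (64 * pi^2) * (1 / (norm x)^2)" by (rule kern_frobenius[OF k])
  finally show ?thesis .
qed

text \<open>Bounds the integral over \<open>V\<close> of each squared kernel entry, uniformly in the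
  position of the singularity. Its purpose is finiteness, so the radius in the bathtub estimate is
  simply taken as 1.\<close>

definition kern_const :: "real \<Rightarrow> ennreal" where
  "kern_const k = ennreal (9 * k^4 / (64 * pi^2)) * (emeasure lborel V + ennreal (8 * pi / 3))"

lemma kern_const_finite: "kern_const k < \<infinity>"
  using emeasure_W by (simp add: kern_const_def ennreal_mult_less_top)

lemma kern_sq_nn_integral:
  assumes "k \<ge> 0"
  shows "(\<integral>\<^sup>+x. ennreal ((norm (kern k i j (y - x)))^2) \<partial>W) \<le> kern_const k"
    "(\<integral>\<^sup>+x. ennreal ((norm (kern k i j (x - y)))^2) \<partial>W) \<le> kern_const k"
proof -
  have *: "(\<integral>\<^sup>+x. ennreal (9 * k^4 / (64 * pi^2) * (1 / (norm (y - x))^2)) \<partial>W) \<le> kern_const k"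
  proof -
    have "(\<integral>\<^sup>+x. ennreal (9 * k^4 / (64 * pi^2) * (1 / (norm (y - x))^2)) \<partial>W)
      = ennreal (9 * k^4 / (64 * pi^2)) * (\<integral>\<^sup>+x. ennreal (1 / (norm (y - x))^2) \<partial>W)"
      by (subst nn_integral_cmult[symmetric]) (auto simp: ennreal_mult[symmetric] intro!: borel_measurable_lebesgue_on)
    then show ?thesis unfolding kern_const_def by (simp add: riesz_potential_bound mult_left_mono)
  qed
  show "(\<integral>\<^sup>+x. ennreal ((norm (kern k i j (y - x)))^2) \<partial>W) \<le> kern_const k"
    by (rule order_trans[OF nn_integral_mono *]) (intro ennreal_leI kern_sq_bound assms)
  show "(\<integral>\<^sup>+x. ennreal ((norm (kern k i j (x - y)))^2) \<partial>W) \<le> kern_const k"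
    by (rule order_trans[OF nn_integral_mono *])
       (use kern_sq_bound[OF assms, of i j] in \<open>auto simp: norm_minus_commute[of y] intro!: ennreal_leI\<close>)
qed

lemma kern_nn_integral:
  assumes "k \<ge> 0"
  shows "(\<integral>\<^sup>+x. ennreal (norm (kern k i j (x - y))) \<partial>W) \<le> emeasure lborel V + kern_const k"
proof -
  have le: "t \<le> 1 + t^2" for t :: real using zero_le_power2[of "t - 1/2"] by (simp add: power2_eq_square algebra_simps)
  have "(\<integral>\<^sup>+x. ennreal (norm (kern k i j (x - y))) \<partial>W) \<le> (\<integral>\<^sup>+x. 1 + ennreal ((norm (kern k i j (x - y)))^2) \<partial>W)"
  proof (rule nn_integral_mono)
    fix x
    have "ennreal (norm (kern k i j (x - y))) \<le> ennreal (1 + (norm (kern k i j (x - y)))^2)" by (intro ennreal_leI le)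
    then show "ennreal (norm (kern k i j (x - y))) \<le> 1 + ennreal ((norm (kern k i j (x - y)))^2)" by simp
  qed
  also have "\<dots> = emeasure W (space W) + (\<integral>\<^sup>+x. ennreal ((norm (kern k i j (x - y)))^2) \<partial>W)"
    by (subst nn_integral_add) (auto intro!: borel_measurable_lebesgue_on)
  also have "\<dots> \<le> emeasure lborel V + kern_const k"
    unfolding emeasure_W by (intro add_left_mono kern_sq_nn_integral assms)
  finally show ?thesis .
qed

text \<open>This holds for every r, not just almost every r, so each component of the operator at a
  point is an inner product in L^2(V), to which Bessel's inequality applies.\<close>

lemma kern_L2:
  assumes "k \<ge> 0"
  shows "(\<lambda>r'. kern k i j (r - r')) \<in> borel_measurable W"
    "integrable W (\<lambda>r'. (norm (kern k i j (r - r')))^2)"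
proof -
  show [measurable]: "(\<lambda>r'. kern k i j (r - r')) \<in> borel_measurable W"
    by (intro borel_measurable_lebesgue_on) measurable
  show "integrable W (\<lambda>r'. (norm (kern k i j (r - r')))^2)"
    using order_le_less_trans[OF kern_sq_nn_integral(1)[OF assms] kern_const_finite]
    by (intro integrableI_bounded) auto
qed

text \<open>The value at each point is bounded, uniformly in r, by squared norms of the kernel row
  and of \<open>E\<close>; a bounded measurable function on a set of finite measure is
  square-integrable.\<close>

lemma gamma_kernel_op_L2:
  assumes k: "k \<ge> 0" and E: "E \<in> L2_fields V"
  shows "gamma_kernel_op k E \<in> L2_fields V"
proof (rule L2_fieldsI)
  note [measurable] = L2_fields_D(3)[OF E]
  fix j
  show m: "(\<lambda>x. gamma_kernel_op k E x $ j) \<in> borel_measurable W"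
    unfolding gamma_kernel_op_def vec_lambda_beta
    by (rule W.borel_measurable_lebesgue_integral) (simp add: case_prod_unfold, measurable)
  define C where "C = (\<Sum>i\<in>(UNIV :: 3 set). enn2real (kern_const k) + (LINT x|W. (norm (E x $ i))^2))"
  have bound: "norm (gamma_kernel_op k E r $ j) \<le> C" for r
  proof -
    have "norm (gamma_kernel_op k E r $ j) \<le> (LINT r'|W. (\<Sum>i\<in>UNIV. (norm (kern k j i (r - r')))^2 + (norm (E r' $ i))^2))"
      unfolding gamma_kernel_op_def vec_lambda_beta
    proof (rule order_trans[OF integral_norm_bound Bochner_Integration.integral_mono])
      show "integrable W (\<lambda>r'. norm (\<Sum>i\<in>UNIV. kern k j i (r - r') * E r' $ i))"
        by (intro integrable_norm Bochner_Integration.integrable_sum integrable_mult_L2 kern_L2[OF k] L2_fields_D[OF E])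
      show "integrable W (\<lambda>r'. \<Sum>i\<in>UNIV. (norm (kern k j i (r - r')))^2 + (norm (E r' $ i))^2)"
        by (intro Bochner_Integration.integrable_sum Bochner_Integration.integrable_add kern_L2[OF k] L2_fields_D[OF E])
      show "norm (\<Sum>i\<in>UNIV. kern k j i (r - r') * E r' $ i) \<le> (\<Sum>i\<in>UNIV. (norm (kern k j i (r - r')))^2 + (norm (E r' $ i))^2)" for r'
        by (intro sum_norm_le norm_mult_le_sum_squares)
    qed
    also have "\<dots> = (\<Sum>i\<in>UNIV. (LINT r'|W. (norm (kern k j i (r - r')))^2) + (LINT r'|W. (norm (E r' $ i))^2))"
      using kern_L2[OF k] L2_fields_D[OF E]
      by (simp add: Bochner_Integration.integral_sum Bochner_Integration.integral_add)
    also have "\<dots> \<le> C" unfolding C_def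
    proof (intro sum_mono add_right_mono)
      fix i
      have "(LINT r'|W. (norm (kern k j i (r - r')))^2) = enn2real (\<integral>\<^sup>+r'. ennreal ((norm (kern k j i (r - r')))^2) \<partial>W)"
        using kern_L2[OF k] by (intro integral_eq_nn_integral) auto
      also have "\<dots> \<le> enn2real (kern_const k)"
        using kern_const_finite kern_sq_nn_integral(1)[OF k] by (intro enn2real_mono) auto
      finally show "(LINT r'|W. (norm (kern k j i (r - r')))^2) \<le> enn2real (kern_const k)" .
    qed
    finally show ?thesis .
  qed
  show "integrable W (\<lambda>x. (norm (gamma_kernel_op k E x $ j))^2)"
    using m bound by (intro W.integrable_const_bound[where B = "C^2"]) (auto intro!: AE_I2 power_mono)
qed

text \<open>Fubini, with absolute integrability coming from uniformly bounded integrals of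
  \<open>A\<close>, an integrable \<open>e\<close> and a bounded \<phi>. The function
  \<open>A\<close> is general because the swap is made twice, for the profile \<open>green\<close>
  and for the singular entries of \<open>kern\<close>.\<close>

lemma kernel_swap:
  fixes A :: "real^3 \<Rightarrow> complex" and e \<phi> :: "real^3 \<Rightarrow> complex"
  assumes A [measurable]: "A \<in> borel_measurable borel"
    and C: "\<And>y. (\<integral>\<^sup>+x. ennreal (norm (A (x - y))) \<partial>W) \<le> C" "C < \<infinity>"
    and e: "integrable W e" and \<phi>: "\<phi> \<in> borel_measurable borel" "\<And>x. norm (\<phi> x) \<le> M"
  shows "integrable W (\<lambda>r. (LINT r'|W. A (r - r') * e r') * \<phi> r)" (is ?th1)
    "integrable W (\<lambda>r'. e r' * (LINT r|W. A (r - r') * \<phi> r))" (is ?th2)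
    "(LINT r|W. (LINT r'|W. A (r - r') * e r') * \<phi> r) = (LINT r'|W. e r' * (LINT r|W. A (r - r') * \<phi> r))" (is ?th3)
proof -
  have [measurable]: "e \<in> borel_measurable W" "\<phi> \<in> borel_measurable W"
    using e \<phi>(1) by (auto intro: borel_measurable_lebesgue_on)
  let ?f = "\<lambda>r r'. A (r - r') * e r' * \<phi> r"
  have M: "M \<ge> 0" using \<phi>(2)[of 0] norm_ge_zero order_trans by blast
  have int: "integrable (W \<Otimes>\<^sub>M W) (case_prod ?f)"
  proof (rule integrableI_bounded)
    show "case_prod ?f \<in> borel_measurable (W \<Otimes>\<^sub>M W)"
      by (simp add: case_prod_unfold, measurable)
    have "(\<integral>\<^sup>+p. ennreal (norm (case_prod ?f p)) \<partial>(W \<Otimes>\<^sub>M W)) = (\<integral>\<^sup>+r'. \<integral>\<^sup>+r. ennreal (norm (?f r r')) \<partial>W \<partial>W)"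
      by (subst WW.nn_integral_snd[symmetric]) (auto simp: case_prod_unfold)
    also have "\<dots> \<le> (\<integral>\<^sup>+r'. ennreal (M * norm (e r')) * C \<partial>W)"
    proof (rule nn_integral_mono)
      fix r'
      have "(\<integral>\<^sup>+r. ennreal (norm (?f r r')) \<partial>W) \<le> (\<integral>\<^sup>+r. ennreal (M * norm (e r')) * ennreal (norm (A (r - r'))) \<partial>W)"
      proof (rule nn_integral_mono)
        fix r
        have "norm (?f r r') \<le> M * norm (e r') * norm (A (r - r'))"
          using mult_right_mono[OF \<phi>(2)[of r], of "norm (e r') * norm (A (r - r'))"] by (simp add: norm_mult mult_ac)
        then show "ennreal (norm (?f r r')) \<le> ennreal (M * norm (e r')) * ennreal (norm (A (r - r')))"
          using M by (simp flip: ennreal_mult add: ennreal_leI)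
      qed
      also have "\<dots> = ennreal (M * norm (e r')) * (\<integral>\<^sup>+r. ennreal (norm (A (r - r'))) \<partial>W)"
        by (rule nn_integral_cmult) (intro borel_measurable_lebesgue_on, measurable)
      also have "\<dots> \<le> ennreal (M * norm (e r')) * C" by (intro mult_left_mono C) auto
      finally show "(\<integral>\<^sup>+r. ennreal (norm (?f r r')) \<partial>W) \<le> ennreal (M * norm (e r')) * C" .
    qed
    also have "\<dots> = (\<integral>\<^sup>+r'. ennreal (M * norm (e r')) \<partial>W) * C"
      by (rule nn_integral_multc) measurable
    also have "\<dots> < \<infinity>"
    proof -
      have "integrable W (\<lambda>r'. M * norm (e r'))" using e by auto
      then have "(\<integral>\<^sup>+r'. ennreal (M * norm (e r')) \<partial>W) < \<infinity>"
        using M by (simp add: nn_integral_eq_integral)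
      then show ?thesis using C(2) by (simp add: ennreal_mult_less_top)
    qed
    finally show "(\<integral>\<^sup>+p. ennreal (norm (case_prod ?f p)) \<partial>(W \<Otimes>\<^sub>M W)) < \<infinity>" .
  qed
  have 1: "(LINT r'|W. ?f r r') = (LINT r'|W. A (r - r') * e r') * \<phi> r" for r by simp
  have 2: "(LINT r|W. ?f r r') = e r' * (LINT r|W. A (r - r') * \<phi> r)" for r'
    by (simp add: mult.assoc mult.left_commute[of _ "e r'"])
  show ?th1 using WW.integrable_fst[OF int] unfolding 1 .
  show ?th2 using WW.integrable_snd[OF int] unfolding 2 .
  show ?th3 using WW.Fubini_integral[OF int] unfolding 1 2 by simp
qed

lemma integral_W:
  fixes h :: "real^3 \<Rightarrow> complex"
  assumes "h \<in> borel_measurable borel" "\<And>x. x \<notin> V \<Longrightarrow> h x = 0"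
  shows "(LINT x|W. h x) = (\<integral>x. h x \<partial>lborel)"
proof -
  have "indicator V x *\<^sub>R h x = h x" for x using assms(2)[of x] by (auto simp: indicator_def)
  then show ?thesis
    using V_sets assms(1) by (simp add: integral_restrict_space integral_completion)
qed

text \<open>Fubini lets the profile be integrated against the double curl of the test field for
  fixed r', so that all derivatives fall on a smooth compactly supported field. There they are
  exchanged for the kernel, and Fubini restores the order.\<close>

lemma gamma_kernel_op_distributional:
  assumes k: "k \<ge> 0" and E: "E \<in> L2_fields V" and \<phi>: "\<phi> \<in> test_fields V"
  shows "regular_dist V (gamma_kernel_op k E) \<phi> =
    dist_curl (dist_curl (regular_dist V (gamma_potential k V E))) \<phi>"
proof -
  define S where "S = closure {x. \<phi> x \<noteq> 0}"
  have S: "compact S" "S \<subseteq> V" "\<And>x. x \<notin> S \<Longrightarrow> \<phi> x = 0" and sm: "smooth_on \<phi> UNIV"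
    using \<phi> closure_subset[of "{x. \<phi> x \<noteq> 0}"] by (auto simp: test_fields_def S_def)
  define \<psi> where "\<psi> = curl (curl \<phi>)"
  note cc = curl_curl_support[OF sm S(1,3), folded \<psi>_def]
  have \<phi>c: "continuous_on UNIV (\<lambda>x. \<phi> x $ j)" for j
    using smooth_on_UNIV_D(2)[OF sm] by (intro continuous_intros)
  have \<phi>0: "\<phi> x $ j = 0" if "x \<notin> S" for x j using S(3)[OF that] by simp
  have [measurable]: "(\<lambda>x. \<phi> x $ j) \<in> borel_measurable borel" "(\<lambda>x. \<psi> x $ j) \<in> borel_measurable borel" for j
    using \<phi>c cc(1) by (auto intro: borel_measurable_continuous_onI)
  have bd: "\<exists>M. \<forall>x. norm (f x) \<le> M" if c: "continuous_on UNIV f" and z: "\<And>x. x \<notin> S \<Longrightarrow> f x = 0" for f :: "real^3 \<Rightarrow> complex"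
  proof -
    obtain M R where M: "M \<ge> 0" "\<And>x. norm (f x) \<le> M * indicator (cball 0 R) x"
      using continuous_bounded_support_bound[OF c S(1) z] by metis
    then have "norm (f x) \<le> M" for x using M(1) M(2)[of x] by (cases "norm x \<le> R") auto
    then show ?thesis by blast
  qed
  have "\<exists>M. \<forall>x. norm (\<phi> x $ j) \<le> M" "\<exists>M. \<forall>x. norm (\<psi> x $ j) \<le> M" for j
    using bd[OF \<phi>c \<phi>0] bd[OF cc(1,2)] by auto
  then obtain M1 M2 where M1: "\<And>j x. norm (\<phi> x $ j) \<le> M1 j" and M2: "\<And>j x. norm (\<psi> x $ j) \<le> M2 j"
    by metis
  have mg: "(\<lambda>x. green k (norm x)) \<in> borel_measurable borel" by measurable
  have Cg: "(\<integral>\<^sup>+x. ennreal (norm (green k (norm (x - y)))) \<partial>W) \<le> ennreal k * emeasure lborel V" for y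
  proof -
    have "(\<integral>\<^sup>+x. ennreal (norm (green k (norm (x - y)))) \<partial>W) \<le> (\<integral>\<^sup>+x. ennreal k \<partial>W)"
      by (intro nn_integral_mono ennreal_leI green_bounds k) auto
    then show ?thesis using emeasure_W by simp
  qed
  have Cgf: "ennreal k * emeasure lborel V < \<infinity>" using emeasure_W by (simp add: ennreal_mult_less_top)
  have Ckf: "emeasure lborel V + kern_const k < \<infinity>" using emeasure_W kern_const_finite by simp
  note G = kernel_swap[OF mg Cg Cgf L2_fields_D(5)[OF E] _ M2]
  note K = kernel_swap[OF borel_measurable_kern kern_nn_integral[OF k] Ckf L2_fields_D(5)[OF E] _ M1]
  have pot: "gamma_potential k V E r $ i = (LINT r'|W. green k (norm (r - r')) * E r' $ i)" for r i
  proof -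
    let ?g = "\<lambda>r'. green k (norm (r - r')) *s E r'"
    have [measurable]: "(\<lambda>r'. green k (norm (r - r'))) \<in> borel_measurable W"
      by (intro borel_measurable_lebesgue_on) measurable
    have "integrable W ?g"
    proof (rule Bochner_Integration.integrable_bound)
      show "integrable W (\<lambda>r'. k *\<^sub>R E r')" by (intro integrable_scaleR_right L2_fields_D[OF E])
      show "?g \<in> borel_measurable W"
        using L2_fields_D(3)[OF E] by (intro borel_measurable_vecI) simp
      have "norm (a *s x) = norm a * norm x" for a and x :: "complex^3"
        by (simp add: norm_vec_def L2_set_def norm_mult power_mult_distrib real_sqrt_mult flip: sum_distrib_left)
      then show "AE r' in W. norm (?g r') \<le> norm (k *\<^sub>R E r')"
        using k by (intro AE_I2) (auto intro!: mult_right_mono green_bounds)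
    qed
    then have "(LINT r'|W. ?g r') $ i = (LINT r'|W. ?g r' $ i)"
      by (rule integral_bounded_linear[OF bounded_linear_vec_nth, symmetric])
    then show ?thesis by (simp add: gamma_potential_def green_def phase_def)
  qed
  have "dist_curl (dist_curl (regular_dist V (gamma_potential k V E))) \<phi> =
      (LINT r|W. (\<Sum>i\<in>UNIV. (LINT r'|W. green k (norm (r - r')) * E r' $ i) * \<psi> r $ i))"
    by (simp add: dist_curl_def regular_dist_def \<psi>_def pot)
  also have "\<dots> = (\<Sum>i\<in>UNIV. LINT r|W. (LINT r'|W. green k (norm (r - r')) * E r' $ i) * \<psi> r $ i)"
    by (intro Bochner_Integration.integral_sum G) measurable
  also have "\<dots> = (\<Sum>i\<in>UNIV. LINT r'|W. E r' $ i * (LINT r|W. green k (norm (r - r')) * \<psi> r $ i))"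
    by (intro sum.cong refl G) measurable
  also have "\<dots> = (\<Sum>i\<in>UNIV. LINT r'|W. E r' $ i * (\<Sum>j\<in>UNIV. LINT r|W. kern k i j (r - r') * \<phi> r $ j))"
  proof -
    have "(LINT r|W. green k (norm (r - y)) * \<psi> r $ i) = (\<Sum>j\<in>UNIV. LINT r|W. kern k i j (r - y) * \<phi> r $ j)" for y i
    proof -
      have "(LINT r|W. green k (norm (r - y)) * \<psi> r $ i) = (\<integral>r. green k (norm (r - y)) * \<psi> r $ i \<partial>lborel)"
        using S(2) cc(2) by (intro integral_W) auto
      also have "\<dots> = (\<Sum>j\<in>UNIV. \<integral>r. kern k i j (r - y) * \<phi> r $ j \<partial>lborel)"
        unfolding \<psi>_def by (rule curl_curl_distributional[OF k sm S(1,3)])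
      also have "\<dots> = (\<Sum>j\<in>UNIV. LINT r|W. kern k i j (r - y) * \<phi> r $ j)"
        using S(2) \<phi>0 by (intro sum.cong refl integral_W[symmetric]) auto
      finally show ?thesis .
    qed
    then show ?thesis by simp
  qed
  also have "\<dots> = (\<Sum>i\<in>UNIV. \<Sum>j\<in>UNIV. LINT r'|W. E r' $ i * (LINT r|W. kern k i j (r - r') * \<phi> r $ j))"
    unfolding sum_distrib_left by (intro sum.cong refl Bochner_Integration.integral_sum K) measurable
  also have "\<dots> = (\<Sum>i\<in>UNIV. \<Sum>j\<in>UNIV. LINT r|W. (LINT r'|W. kern k i j (r - r') * E r' $ i) * \<phi> r $ j)"
    by (intro sum.cong refl K(3)[symmetric]) measurable
  also have "\<dots> = (\<Sum>j\<in>UNIV. \<Sum>i\<in>UNIV. LINT r|W. (LINT r'|W. kern k j i (r - r') * E r' $ i) * \<phi> r $ j)"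
    by (subst sum.swap) (simp add: kern_commute)
  also have "\<dots> = (LINT r|W. (\<Sum>j\<in>UNIV. \<Sum>i\<in>UNIV. (LINT r'|W. kern k j i (r - r') * E r' $ i) * \<phi> r $ j))"
  proof -
    have i: "integrable W (\<lambda>r. (LINT r'|W. kern k j i (r - r') * E r' $ i) * \<phi> r $ j)" for i j
      by (rule K) measurable
    show ?thesis
      by (simp only: Bochner_Integration.integral_sum[OF Bochner_Integration.integrable_sum[OF i]] Bochner_Integration.integral_sum[OF i])
  qed
  also have "\<dots> = regular_dist V (gamma_kernel_op k E) \<phi>"
  proof -
    have "(LINT r'|W. (\<Sum>i\<in>UNIV. kern k j i (r - r') * E r' $ i)) = (\<Sum>i\<in>UNIV. LINT r'|W. kern k j i (r - r') * E r' $ i)" for r j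
      by (intro Bochner_Integration.integral_sum integrable_mult_L2 kern_L2[OF k] L2_fields_D[OF E])
    then show ?thesis by (simp add: regular_dist_def gamma_kernel_op_def sum_distrib_right)
  qed
  finally show ?thesis ..
qed

lemma regular_dist_axis: "regular_dist V G (\<lambda>x. axis j (f x)) = (LINT x|W. G x $ j * f x)"
  unfolding regular_dist_def axis_def by (simp add: if_distrib cong: if_cong)

text \<open>\<open>gamma_kernel_op k E\<close> witnesses the choice behind \<open>gamma_hat\<close>,
  so the chosen field has the same distributional action. Testing each component with bumps shows
  that the two agree almost everywhere.\<close>

lemma L2_norm_gamma_hat:
  assumes k: "k \<ge> 0" and E: "E \<in> L2_fields V"
  shows "L2_norm V (gamma_hat k V E) = L2_norm V (gamma_kernel_op k E)"
proof -
  let ?P = "\<lambda>G. G \<in> L2_fields V \<and> (\<forall>\<phi>\<in>test_fields V. regular_dist V G \<phi> =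
        dist_curl (dist_curl (regular_dist V (gamma_potential k V E))) \<phi>)"
  let ?H = "gamma_kernel_op k E"
  define G where "G = gamma_hat k V E"
  have H: "?P ?H" using gamma_kernel_op_L2[OF k E] gamma_kernel_op_distributional[OF k E] by blast
  have G: "?P G" unfolding G_def gamma_hat_def by (rule someI[of ?P, OF H])
  have z: "AE x in W. G x $ j - ?H x $ j = 0" for j
  proof (rule fundamental_lemma[OF V(1)])
    show "integrable W (\<lambda>x. G x $ j - ?H x $ j)"
      using G H L2_fields_D(5) by (intro Bochner_Integration.integrable_diff) auto
    fix c :: real and a b assume c: "c > 0" "cbox a b \<subseteq> V"
    let ?b = "\<lambda>x. complex_of_real (bump c a b x)"
    have [measurable]: "bump c a b \<in> borel_measurable W"
      by (intro borel_measurable_lebesgue_on borel_measurable_continuous_onI smooth_on_UNIV_D(2) smooth_bump c)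
    have i: "integrable W (\<lambda>x. F x $ j * ?b x)" if "F \<in> L2_fields V" for F
    proof (rule Bochner_Integration.integrable_bound[OF L2_fields_D(5)[OF that, of j]])
      show "(\<lambda>x. F x $ j * ?b x) \<in> borel_measurable W" using L2_fields_D(3)[OF that] by measurable
      have "norm (F x $ j * ?b x) \<le> norm (F x $ j) * 1" for x
        unfolding norm_mult norm_of_real using bump_bounds[OF c(1)] by (intro mult_left_mono) auto
      then show "AE x in W. norm (F x $ j * ?b x) \<le> norm (F x $ j)" by simp
    qed
    have "(LINT x|W. G x $ j * ?b x) = (LINT x|W. ?H x $ j * ?b x)"
      using G H bump_test_field[OF c, of j] unfolding regular_dist_axis[symmetric] by metis
    then show "(LINT x|W. (G x $ j - ?H x $ j) * ?b x) = 0"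
      using G H i by (simp add: left_diff_distrib Bochner_Integration.integral_diff)
  qed
  have "AE x in W. \<forall>j\<in>UNIV. G x $ j - ?H x $ j = 0"
    using z by (subst AE_finite_all) auto
  then have "AE x in W. (norm (G x))^2 = (norm (?H x))^2"
    by eventually_elim (simp add: norm_vec_sq)
  then have "(LINT x|W. (norm (G x))^2) = (LINT x|W. (norm (?H x))^2)"
    using G H L2_fields_D(2) by (intro integral_cong_AE) auto
  then show ?thesis by (simp add: L2_norm_def G_def)
qed

text \<open>The energy bound enters as a parameter \<open>J\<close>, so that the volume estimate and
  the circumscribed-ball estimate share one argument.\<close>

lemma sum_gamma_hat_le:
  assumes k: "k \<ge> 0" and B: "finite B" "B \<subseteq> L2_fields V"
    and on: "\<And>e f. e \<in> B \<Longrightarrow> f \<in> B \<Longrightarrow> L2_inner V e f = (if e = f then 1 else 0)"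
    and J: "(\<integral>\<^sup>+x. \<integral>\<^sup>+y. ennreal (1 / (norm (x - y))^2) \<partial>W \<partial>W) \<le> ennreal J" "J \<ge> 0"
  shows "(\<Sum>e\<in>B. (L2_norm V (gamma_hat k V e))^2) \<le> 9 * k^4 / (64 * pi^2) * J"
proof -
  define c where "c = 9 * k^4 / (64 * pi^2)"
  have c: "c \<ge> 0" by (simp add: c_def)
  have L: "gamma_kernel_op k e \<in> L2_fields V" if "e \<in> B" for e
    using gamma_kernel_op_L2[OF k] B that by blast
  have pt: "ennreal (\<Sum>e\<in>B. (norm (gamma_kernel_op k e r))^2) \<le> ennreal c * (\<integral>\<^sup>+y. ennreal (1 / (norm (r - y))^2) \<partial>W)" for r
  proof -
    \<comment> \<open>The conjugated row j of the kernel at r: as \<open>L2_inner\<close> conjugates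
      its second argument, component j of the operator at r is the inner product of e with this
      field. Bessel is then applied to \<kappa> j, not to e.\<close>
    define \<kappa> where "\<kappa> j r' = (\<chi> i. cnj (kern k j i (r - r')))" for j r'
    have \<kappa>: "\<kappa> j \<in> L2_fields V" for j
      by (rule L2_fieldsI) (use kern_L2[OF k] in \<open>auto simp: \<kappa>_def\<close>)
    have "gamma_kernel_op k e r $ j = L2_inner V e (\<kappa> j)" for e j
      by (simp add: gamma_kernel_op_def L2_inner_def \<kappa>_def mult.commute)
    then have n: "norm (gamma_kernel_op k e r $ j) = norm (L2_inner V (\<kappa> j) e)" for e j
      using L2_inner_commute[of e "\<kappa> j"] by simp
    have "(\<Sum>e\<in>B. (norm (gamma_kernel_op k e r))^2) = (\<Sum>j\<in>UNIV. \<Sum>e\<in>B. (norm (L2_inner V (\<kappa> j) e))^2)"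
      unfolding norm_vec_sq n by (rule sum.swap)
    also have "\<dots> \<le> (\<Sum>j\<in>UNIV. LINT r'|W. (norm (\<kappa> j r'))^2)"
      by (intro sum_mono bessel B \<kappa> on)
    also have "\<dots> = (LINT r'|W. (\<Sum>j\<in>UNIV. (norm (\<kappa> j r'))^2))"
      by (intro Bochner_Integration.integral_sum[symmetric] L2_fields_D(2) \<kappa>)
    finally have "ennreal (\<Sum>e\<in>B. (norm (gamma_kernel_op k e r))^2) \<le> ennreal (LINT r'|W. (\<Sum>j\<in>UNIV. (norm (\<kappa> j r'))^2))"
      by (rule ennreal_leI)
    also have "\<dots> = (\<integral>\<^sup>+r'. ennreal (\<Sum>j\<in>UNIV. (norm (\<kappa> j r'))^2) \<partial>W)"
      by (intro nn_integral_eq_integral[symmetric] Bochner_Integration.integrable_sum L2_fields_D(2) \<kappa>)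
         (auto intro!: AE_I2 sum_nonneg)
    also have "\<dots> \<le> (\<integral>\<^sup>+r'. ennreal c * ennreal (1 / (norm (r - r'))^2) \<partial>W)"
    proof (rule nn_integral_mono)
      fix r'
      have "(\<Sum>j\<in>UNIV. (norm (\<kappa> j r'))^2) \<le> c * (1 / (norm (r - r'))^2)"
        using kern_frobenius[OF k, of "r - r'"] by (simp add: norm_vec_sq \<kappa>_def c_def)
      then show "ennreal (\<Sum>j\<in>UNIV. (norm (\<kappa> j r'))^2) \<le> ennreal c * ennreal (1 / (norm (r - r'))^2)"
        using c by (simp flip: ennreal_mult add: ennreal_leI)
    qed
    also have "\<dots> = ennreal c * (\<integral>\<^sup>+y. ennreal (1 / (norm (r - y))^2) \<partial>W)"
      by (rule nn_integral_cmult) (intro borel_measurable_lebesgue_on, measurable)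
    finally show ?thesis .
  qed
  have "(\<Sum>e\<in>B. (L2_norm V (gamma_hat k V e))^2) = (\<Sum>e\<in>B. LINT r|W. (norm (gamma_kernel_op k e r))^2)"
    by (intro sum.cong refl) (simp only: L2_norm_gamma_hat[OF k subsetD[OF B(2)]] L2_norm_sq)
  also have "\<dots> = (LINT r|W. (\<Sum>e\<in>B. (norm (gamma_kernel_op k e r))^2))"
    by (intro Bochner_Integration.integral_sum[symmetric] L2_fields_D(2) L)
  finally have "ennreal (\<Sum>e\<in>B. (L2_norm V (gamma_hat k V e))^2) = ennreal (LINT r|W. (\<Sum>e\<in>B. (norm (gamma_kernel_op k e r))^2))"
    by simp
  also have "\<dots> = (\<integral>\<^sup>+r. ennreal (\<Sum>e\<in>B. (norm (gamma_kernel_op k e r))^2) \<partial>W)"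
    by (intro nn_integral_eq_integral[symmetric] Bochner_Integration.integrable_sum L2_fields_D(2) L)
       (auto intro!: AE_I2 sum_nonneg)
  also have "\<dots> \<le> (\<integral>\<^sup>+r. ennreal c * (\<integral>\<^sup>+y. ennreal (1 / (norm (r - y))^2) \<partial>W) \<partial>W)"
    by (intro nn_integral_mono pt)
  also have "\<dots> = ennreal c * (\<integral>\<^sup>+r. \<integral>\<^sup>+y. ennreal (1 / (norm (r - y))^2) \<partial>W \<partial>W)"
    by (rule nn_integral_cmult) measurable
  also have "\<dots> \<le> ennreal c * ennreal J" by (intro mult_left_mono J) auto
  also have "\<dots> = ennreal (c * J)" using c J by (simp add: ennreal_mult)
  finally show ?thesis using c J by (simp add: c_def)
qed

section \<open>Bounds for the Riesz energy of \<open>V\<close>, and the circumradius\<close>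

lemma energy_le_volume:
  "(\<integral>\<^sup>+x. \<integral>\<^sup>+y. ennreal (1 / (norm (x - y))^2) \<partial>W \<partial>W)
    \<le> ennreal (4 * pi * root 3 (3 * measure lborel V / (4 * pi)) * measure lborel V)"
proof -
  define \<mu> where "\<mu> = measure lborel V"
  have em: "emeasure lborel V = ennreal \<mu>"
    unfolding \<mu>_def using emeasure_W(2) by (intro emeasure_eq_ennreal_measure) auto
  have \<mu>: "\<mu> \<ge> 0" by (simp add: \<mu>_def)
  define R where "R = root 3 (3 * \<mu> / (4 * pi))"
  have R: "R \<ge> 0" using \<mu> by (simp add: R_def)
  have R3: "R^3 = 3 * \<mu> / (4 * pi)" using \<mu> by (simp add: R_def)
  have inner: "(\<integral>\<^sup>+y. ennreal (1 / (norm (x - y))^2) \<partial>W) \<le> ennreal (4 * pi * R)" if "\<mu> > 0" for x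
  proof -
    have R0: "R > 0" using that by (simp add: R_def)
    have "(\<integral>\<^sup>+y. ennreal (1 / (norm (x - y))^2) \<partial>W) = (\<integral>\<^sup>+y. ennreal (1 / (norm (x - y))^2) * indicator V y \<partial>lborel)"
      by (rule nn_integral_W) measurable
    also have "\<dots> \<le> ennreal (1 / R^2) * ennreal \<mu> + ennreal (8 * pi * R / 3)"
      using riesz_potential_le[OF V_sets(2) R0] by (simp add: em)
    also have "\<dots> = ennreal (\<mu> / R^2 + 8 * pi * R / 3)"
      using \<mu> R by (simp flip: ennreal_mult ennreal_plus)
    \<comment> \<open>By the choice of \<open>R\<close> the two terms are one third and two thirds
      of 4 \<pi> R, the potential of a ball at its centre.\<close>
    also have "\<mu> / R^2 = 4 * pi * R / 3"
      using R3 R0 by (simp add: field_simps eval_nat_numeral)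
    also have "4 * pi * R / 3 + 8 * pi * R / 3 = 4 * pi * R" by simp
    finally show ?thesis .
  qed
  have "(\<integral>\<^sup>+x. \<integral>\<^sup>+y. ennreal (1 / (norm (x - y))^2) \<partial>W \<partial>W) \<le> ennreal (4 * pi * R) * ennreal \<mu>"
  proof (cases "\<mu> = 0")
    case True
    \<comment> \<open>Here R = 0, which the bathtub estimate excludes, but \<open>V\<close> is a
      null set and both sides are 0.\<close>
    then have "AE x in W. False" using em emeasure_W True by (intro AE_I[of _ _ "space W"]) auto
    then have "(\<integral>\<^sup>+x. \<integral>\<^sup>+y. ennreal (1 / (norm (x - y))^2) \<partial>W \<partial>W) = (\<integral>\<^sup>+x. 0 \<partial>W)"
      by (intro nn_integral_cong_AE) auto
    then show ?thesis by simp
  next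
    case False
    then have "(\<integral>\<^sup>+x. \<integral>\<^sup>+y. ennreal (1 / (norm (x - y))^2) \<partial>W \<partial>W) \<le> (\<integral>\<^sup>+x. ennreal (4 * pi * R) \<partial>W)"
      using \<mu> by (intro nn_integral_mono inner) simp
    then show ?thesis using em emeasure_W by simp
  qed
  also have "\<dots> = ennreal (4 * pi * R * \<mu>)" using R \<mu> by (simp add: ennreal_mult)
  finally show ?thesis unfolding R_def \<mu>_def .
qed

lemma energy_le_cball:
  assumes "V \<subseteq> cball c R" "R \<ge> 0"
  shows "(\<integral>\<^sup>+x. \<integral>\<^sup>+y. ennreal (1 / (norm (x - y))^2) \<partial>W \<partial>W) \<le> ennreal (4 * pi^2 * R^4)"
proof -
  have [measurable]: "V \<in> sets borel" using V by auto
  have "(\<integral>\<^sup>+x. \<integral>\<^sup>+y. ennreal (1 / (norm (x - y))^2) \<partial>W \<partial>W) =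
      (\<integral>\<^sup>+x. \<integral>\<^sup>+y. ennreal (1 / (norm (x - y))^2) * indicator V y \<partial>lborel \<partial>W)"
    by (intro nn_integral_cong nn_integral_W) measurable
  also have "\<dots> = (\<integral>\<^sup>+x. (\<integral>\<^sup>+y. ennreal (1 / (norm (x - y))^2) * indicator V y \<partial>lborel) * indicator V x \<partial>lborel)"
    by (rule nn_integral_W) measurable
  also have "\<dots> = (\<integral>\<^sup>+x. \<integral>\<^sup>+y. ennreal (1 / (norm (x - y))^2) * indicator V y * indicator V x \<partial>lborel \<partial>lborel)"
  proof (intro nn_integral_cong nn_integral_multc[symmetric])
    show "(\<lambda>y. ennreal (1 / (norm (x - y))^2) * indicator V y) \<in> borel_measurable lborel" for x
    proof (intro borel_measurable_times_ennreal borel_measurable_indicator V_sets)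
      have "(\<lambda>y. ennreal (1 / (norm (x - y))^2)) \<in> borel_measurable borel" by measurable
      then show "(\<lambda>y. ennreal (1 / (norm (x - y))^2)) \<in> borel_measurable lborel" by simp
    qed
  qed
  also have "\<dots> \<le> (\<integral>\<^sup>+x. \<integral>\<^sup>+y. ennreal (1 / (norm (x - y))^2) * indicator (cball c R) y * indicator (cball c R) x \<partial>lborel \<partial>lborel)"
    using assms(1) by (intro nn_integral_mono mult_mono) (auto simp: indicator_def)
  also have "\<dots> \<le> ennreal (4 * pi^2 * R^4)" by (rule riesz_energy_cball[OF assms(2)])
  finally show ?thesis .
qed

text \<open>A ball for every radius above the infimum suffices, since the final bound is continuous
  in the radius. The bounds on the suprema are established because \<open>SUP\<close> and
  \<open>INF\<close> over the reals are meaningful only for bounded nonempty families.\<close>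

lemma circumradius_cball:
  assumes "V \<noteq> {}" "\<rho> > circumradius V"
  obtains c where "V \<subseteq> cball c \<rho>" 
proof -
  let ?A = "V \<union> frontier V"
  have "?A \<subseteq> closure V" by (auto simp: frontier_def closure_subset[THEN subsetD])
  then have bA: "bounded ?A" using bounded_closure[OF V(2)] bounded_subset by blast
  have bdd: "bdd_above ((\<lambda>r'. norm (r' - r)) ` ?A)" for r
  proof -
    obtain B where B: "\<And>x. x \<in> ?A \<Longrightarrow> norm x \<le> B" using bA by (auto simp: bounded_iff)
    show ?thesis
    proof (rule bdd_aboveI2)
      fix x assume "x \<in> ?A"
      then show "norm (x - r) \<le> B + norm r" using B[of x] norm_triangle_ineq4[of x r] by linarith
    qed
  qed
  obtain x0 where x0: "x0 \<in> V" using assms(1) by auto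
  have "0 \<le> (SUP r'\<in>?A. norm (r' - r))" for r
    by (rule cSUP_upper2[OF bdd, of x0]) (use x0 in auto)
  then have "bdd_below (range (\<lambda>r. SUP r'\<in>?A. norm (r' - r)))" by (intro bdd_belowI2[of _ 0])
  then obtain c where c: "(SUP r'\<in>?A. norm (r' - c)) < \<rho>"
    using assms(2) unfolding circumradius_def by (subst (asm) cINF_less_iff) auto
  have "norm (x - c) \<le> \<rho>" if "x \<in> V" for x
    using cSUP_upper[OF _ bdd, of x c] that c by fastforce
  then show thesis by (intro that[of c]) (auto simp: dist_norm norm_minus_commute)
qed

lemma circumradius_nonneg: "V \<noteq> {} \<Longrightarrow> circumradius V \<ge> 0"
proof (rule ccontr)
  assume "V \<noteq> {}" "\<not> circumradius V \<ge> 0"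
  \<comment> \<open>A negative number is less than its half, which is then the radius of an empty
    ball.\<close>
  then obtain c where "V \<subseteq> cball c (circumradius V / 2)"
    using circumradius_cball[of "circumradius V / 2"] by auto
  then show False using \<open>V \<noteq> {}\<close> \<open>\<not> circumradius V \<ge> 0\<close> by simp
qed

end

text \<open>The constant \<open>1/3\<close> has almost no slack here: the inequality amounts to
  \<open>81\<^sup>3 \<cdot> 3 \<le> 4 \<cdot> 16\<^sup>3 \<pi>\<^sup>4\<close>.\<close>

lemma volume_constant:
  fixes k \<mu> :: real
  assumes "k > 0" "\<mu> \<ge> 0"
  shows "9 * k^4 / (64 * pi^2) * (4 * pi * root 3 (3 * \<mu> / (4 * pi)) * \<mu>) \<le> (1/3 * (k^3 * \<mu>) powr (2/3))^2"
proof -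
  define m R where "m = root 3 \<mu>" and "R = root 3 (3 * \<mu> / (4 * pi))"
  have m: "m \<ge> 0" "m^3 = \<mu>" using assms by (auto simp: m_def)
  have R: "R \<ge> 0" "R^3 = 3 * \<mu> / (4 * pi)" using assms by (auto simp: R_def)
  \<comment> \<open>Three decimals matter: \<pi>^4 has to be at least 81^3 * 3 / (4 * 16^3), about
    97.31, whereas 3.14^4 is only about 97.21.\<close>
  have "3.141 \<le> pi" using pi_approx(1) by simp
  then have "(3.141 :: real)^4 \<le> pi^4" by (intro power_mono) auto
  then have pi4: "81^3 * 3 \<le> 4 * 16^3 * pi^4" by (simp add: power_numeral_reduce)
  \<comment> \<open>With \<mu> = m^3 and k^4 \<mu> cancelled, the claim reads 9 R / (16 \<pi>) \<le>
    m / 9, which is this inequality; comparing cubes removes the roots.\<close>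
  have "81 * R \<le> 16 * pi * m"
  proof (rule power_le_imp_le_base[of _ 2])
    have "(81 * R)^3 = 81^3 * 3 * \<mu> / (4 * pi)" by (simp add: power_mult_distrib R)
    also have "\<dots> \<le> (4 * 16^3 * pi^4) * \<mu> / (4 * pi)"
      using assms by (intro divide_right_mono mult_right_mono pi4) auto
    also have "\<dots> = (16 * pi * m)^3" unfolding m(2)[symmetric] by (simp add: power_mult_distrib eval_nat_numeral)
    finally show "(81 * R)^Suc 2 \<le> (16 * pi * m)^Suc 2" by simp
  qed (use m in auto)
  have pw: "(k^3 * \<mu>) powr (2/3) = (k * m)^2"
  proof (cases "\<mu> = 0")
    case False
    then have "k * m > 0" using assms by (simp add: m_def)
    then have "((k * m)^3) powr (2/3) = ((k * m) powr 3) powr (2/3)" by (simp add: powr_numeral)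
    also have "\<dots> = (k * m)^2" unfolding powr_powr using \<open>k * m > 0\<close> by (simp add: powr_numeral)
    finally show ?thesis by (simp add: power_mult_distrib m)
  qed (simp add: m_def)
  have "9 * k^4 / (64 * pi^2) * (4 * pi * R * \<mu>) = (81 * R) * (k^4 * \<mu> / (144 * pi))"
    by (simp add: field_simps power2_eq_square)
  also have "\<dots> \<le> (16 * pi * m) * (k^4 * \<mu> / (144 * pi))"
    using \<open>81 * R \<le> 16 * pi * m\<close> assms by (intro mult_right_mono) auto
  also have "\<dots> = (16 * pi * m) * (k^4 * m^3 / (144 * pi))" by (simp only: m(2))
  also have "\<dots> = (1/3 * (k * m)^2)^2"
    by (simp add: field_simps eval_nat_numeral)
  finally show ?thesis unfolding pw R_def .
qed

theorem theorem2p2: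
  fixes k :: real and V :: "(real^3) set" and B :: "(real^3 \<Rightarrow> complex^3) set"
  assumes "k > 0"
    and "bounded V" and "open V" and "smooth_boundary V"
    and "connected (UNIV - (V \<union> frontier V))"
    and "complete_orthonormal_basis V (Phi V) B"
  shows "HS_norm V B (gamma_hat k V) \<le>
    ereal (min (1/3 * (k^3 * (LINT r|lebesgue_on V. 1)) powr (2/3))
               (3/4 * (k * circumradius V)\<^sup>2))"
proof -
  note V = \<open>open V\<close> \<open>bounded V\<close>
  define \<mu> where "\<mu> = measure lborel V"
  have \<mu>: "\<mu> \<ge> 0" by (simp add: \<mu>_def)
  have LINT1: "(LINT r|lebesgue_on V. 1) = \<mu>"
    using V_sets[OF V] by (simp add: \<mu>_def measure_restrict_space)
  define b1 b2 where "b1 = 1/3 * (k^3 * \<mu>) powr (2/3)" and "b2 = 3/4 * (k * circumradius V)^2"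
  have b: "b1 \<ge> 0" "b2 \<ge> 0" by (auto simp: b1_def b2_def)
  have B: "B \<subseteq> L2_fields V" "\<And>e f. e \<in> B \<Longrightarrow> f \<in> B \<Longrightarrow> L2_inner V e f = (if e = f then 1 else 0)"
    using assms(6) by (auto simp: complete_orthonormal_basis_def Phi_def)
  define t where "t = (\<lambda>e. (L2_norm V (gamma_hat k V e))^2)"
  have fin: "sum t F \<le> 9 * k^4 / (64 * pi^2) * J"
    if "finite F" "F \<subseteq> B" "J \<ge> 0"
      "(\<integral>\<^sup>+x. \<integral>\<^sup>+y. ennreal (1 / (norm (x - y))^2) \<partial>lebesgue_on V \<partial>lebesgue_on V) \<le> ennreal J" for F J
  proof -
    have "L2_inner V e f = (if e = f then 1 else 0)" if "e \<in> F" "f \<in> F" for e f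
      using B(2) that \<open>F \<subseteq> B\<close> by blast
    moreover have "F \<subseteq> L2_fields V" using B(1) \<open>F \<subseteq> B\<close> by blast
    ultimately show ?thesis
      unfolding t_def using assms(1) that(1,3,4) by (intro sum_gamma_hat_le[OF V]) auto
  qed
  have 1: "sum t F \<le> b1^2" if "finite F" "F \<subseteq> B" for F
  proof -
    have "sum t F \<le> 9 * k^4 / (64 * pi^2) * (4 * pi * root 3 (3 * \<mu> / (4 * pi)) * \<mu>)"
      using energy_le_volume[OF V] \<mu> by (intro fin that) (auto simp: \<mu>_def)
    also have "\<dots> \<le> b1^2" unfolding b1_def by (rule volume_constant[OF assms(1) \<mu>])
    finally show ?thesis .
  qed
  have 2: "sum t F \<le> b2^2" if F: "finite F" "F \<subseteq> B" for F
  proof (cases "V = {}")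
    case True
    \<comment> \<open>The supremum in \<open>circumradius\<close> carries no information for the
      empty set, so the volume bound is used instead: it is 0 here, and b2^2 is nonnegative.\<close>
    then have "b1 = 0" by (simp add: b1_def \<mu>_def)
    then have "sum t F \<le> 0" using 1[OF F] by simp
    then show ?thesis using order_trans zero_le_power2 by blast
  next
    case False
    define r where "r = circumradius V"
    have r: "r \<ge> 0" unfolding r_def by (rule circumradius_nonneg[OF V False])
    have le: "sum t F \<le> 9/16 * (k * \<rho>)^4" if \<rho>: "\<rho> > r" for \<rho>
    proof -
      obtain c where "V \<subseteq> cball c \<rho>"
        using circumradius_cball[OF V False, of \<rho>] \<rho> unfolding r_def by blast
      then have "sum t F \<le> 9 * k^4 / (64 * pi^2) * (4 * pi^2 * \<rho>^4)"
        using r \<rho> by (intro fin F energy_le_cball[OF V]) auto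
      also have "\<dots> = 9/16 * (k * \<rho>)^4" by (simp add: power_mult_distrib)
      finally show ?thesis .
    qed
    \<comment> \<open>Balls are available for every \<rho> > r, so the bound at r itself is reached
      as a limit from the right.\<close>
    have "((\<lambda>\<rho>. 9/16 * (k * \<rho>)^4) \<longlongrightarrow> 9/16 * (k * r)^4) (at_right r)"
      by (intro tendsto_intros)
    then have "sum t F \<le> 9/16 * (k * r)^4"
      by (rule tendsto_lowerbound) (use le in \<open>auto simp: eventually_at_filter\<close>)
    also have "\<dots> = b2^2" by (simp add: b2_def r_def power_mult_distrib power_divide flip: power_mult)
    finally show ?thesis .
  qed
  \<comment> \<open>The uniform bound on finite partial sums yields summability, so
    \<open>HS_norm\<close> takes its finite branch.\<close>
  have sm: "t summable_on B"
    by (rule nonneg_bdd_above_summable_on) (auto simp: t_def intro!: bdd_aboveI2[of _ _ "b1^2"] 1[unfolded t_def])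
  have "infsum t B \<le> b1^2" "infsum t B \<le> b2^2"
    by (intro infsum_le_finite_sums sm 1 2; assumption)+
  then have "sqrt (infsum t B) \<le> b1" "sqrt (infsum t B) \<le> b2"
    using b by (auto intro: real_le_lsqrt)
  moreover have "HS_norm V B (gamma_hat k V) = ereal (sqrt (infsum t B))"
    using sm by (simp add: HS_norm_def t_def)
  ultimately show ?thesis unfolding LINT1 b1_def b2_def by simp
qed

end
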